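(* In the setting described in the context, take the coarse space $V_0=V_{H,1}$. If $c_tH^2\le\Delta t\le C_tH^2$ for constants $0<c_t\le C_t$, and $\eta_0$ and $\kappa_0$ are uniformly bounded, then $$\operatorname{cond}\Big(\big(R_0^T\widetilde A_0^{-1}R_0+\sum_{i=1}^NR_i^T\widetilde A_i^{-1}R_i\big)\widetilde A\Big)=O(1),$$ where $\widetilde A=\Delta t\,A+M$ and $\widetilde A_i=\Delta t\,A_i+M_i$ ($i=0,1,\dots,N$); that is, the condition number (ratio of the largest to the smallest eigenvalue) is bounded by a constant independent of $h$, $H$ and the contrast $\eta=\kappa_{\max}/\kappa_{\min}$.
   Context: **Domain and meshes.** $\Omega\subset\mathbb R^d$ ($d=2,3$) is a bounded domain; $\kappa\in L^\infty(\Omega)$ satisfies $0<\kappa_{\min}\le\kappa\le\kappa_{\max}$, with contrast $\eta=\kappa_{\max}/\kappa_{\min}$. $\mathcal T^h$ is a fine partition with mesh size $h$, $V_h=P_1(\mathcal T^h)$ is the space of continuous piecewise linear functions, and $V_{h,0}=\{v\in V_h: v=0\text{ on }\partial\Omega\}$. $\mathcal T^H$ is a coarse partition of $\Omega$ with mesh size $H$ and elements $K_1,\dots,K_N$. **Forms.** $a(u,v)=\int_\Omega\kappa\nabla u\cdot\nabla v\,dx$, $s(u,v)=H^{-2}\int_\Omega\kappa uv\,dx$, $\|u\|_a^2=a(u,u)$, $\|u\|_s^2=s(u,u)$; $\|\cdot\|_{a(K)},\|\cdot\|_{s(K)}$ are the same with integrals restricted to $K$. $\Delta t>0$ is the time step.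 **Auxiliary space.** In each coarse element $K$ there are pairwise disjoint connected open Lipschitz subdomains $K_h^i\subset K$ (high-permeability components), and $K_l=K\setminus\bigcup_iK_h^i$. There are constants $\eta_0,\kappa_0$ with $\max_{K_h^i}\kappa/\min_{K_h^i}\kappa\le\eta_0$, $\min_{K_h^i}\kappa\ge\kappa_0$, $\max_{K_l}\kappa<\kappa_0$, and a constant $C$ independent of $H$ and $K$ with $\int_{K_h^i}|u|^2\le CH^2\int_{K_h^i}|\nabla u|^2$ whenever $\int_{K_h^i}u=0$. $V_{\mathrm{aux},1}$ is the span of the characteristic functions of all $K_h^i$ (over all $K$), $V_{\mathrm{aux},2}$ the span of the characteristic functions of all $K_l$, $V_{\mathrm{aux}}=V_{\mathrm{aux},1}+V_{\mathrm{aux},2}$, and $\pi$ is the $s$-orthogonal projection onto $V_{\mathrm{aux}}$; $\pi_K$ denotes $\pi$ on the element $K$. It is assumed that $\|(I-\pi_K)u\|_{s(K)}^2\le C_\pi\|u\|_{a(K)}^2$ for all $u\in H^1(K)$ and all $K$, with $C_\pi$ independent of $H$ and of the contrast. **Coarse space.** For $\psi\in V_{\mathrm{aux}}$ let $\phi_\psi\in V_{h,0}$ solve $a(\phi_\psi,v)+s(\pi\phi_\psi,\pi v)=s(\psi,\pi v)$ for all $v\in V_{h,0}$. Then $V_{H,1}=\{\phi_\psi:\psi\in V_{\mathrm{aux},1}\}$. **Overlapping subdomains.** $\omega_i$ is obtained by extending $K_i$ by layers of fine elements; $\Omega=\bigcup_i\omega_i$, and each point of $\Omega$ lies in at most a fixed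 number of the $\omega_i$, independent of $h,H,\eta$. $V_i=V_{h,0}(\omega_i)$ ($i\ge1$) is the space of fine finite element functions on $\omega_i$ vanishing on $\partial\omega_i$. There is a partition of unity $\{\chi_i\}\subset V_h$ with $\chi_i$ supported in $\omega_i$, $\sum_i\chi_i=1$, $\sum_i\chi_i^2\le1$, $|\nabla\chi_i|\le CH^{-1}$. The fine nodal interpolant $I_h$ satisfies $\|I_hv\|_a\le C_I\|v\|_a$ and $\|I_hv\|_s\le C_I\|v\|_s$ for all continuous $v$ that are piecewise quadratic on $\mathcal T^h$, with $C_I$ independent of $h,H,\eta$. **Matrices.** $A$ and $M$ are the fine-grid stiffness matrix (of $a$) and mass matrix (of the $L^2(\Omega)$ inner product) on $V_{h,0}$. $R_i^T:V_i\to V_{h,0}$ is the matrix of the extension by zero for $i\ge1$ and of the inclusion $V_0\subset V_{h,0}$ for $i=0$ (in terms of a basis of $V_0$); $A_i=R_iAR_i^T$, $M_i=R_iMR_i^T$ for $i=0,\dots,N$. *)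

theory Defs
  imports
    "HOL-Analysis.Analysis"
    "HOL-Probability.Essential_Supremum"
    "Jordan_Normal_Form.Spectral_Radius"
    "Jordan_Normal_Form.Gauss_Jordan_Elimination"
begin

section \<open>Forms and Sobolev functions\<close>

text \<open>Pointwise gradient. A finite element function is differentiable off the skeleton of its mesh,
  which is a null set; the arbitrary value chosen there does not affect the integrals below.\<close>

definition grad :: "('a::euclidean_space \<Rightarrow> real) \<Rightarrow> 'a \<Rightarrow> 'a" where
  "grad u x = (SOME D. GDERIV u x :> D)"

definition a_form :: "('a::euclidean_space \<Rightarrow> real) \<Rightarrow> 'a set \<Rightarrow> ('a \<Rightarrow> real) \<Rightarrow> ('a \<Rightarrow> real) \<Rightarrow> real" where
  "a_form \<kappa> U u v = (LINT x|lebesgue_on U. \<kappa> x * inner (grad u x) (grad v x))"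

definition s_form :: "('a::euclidean_space \<Rightarrow> real) \<Rightarrow> real \<Rightarrow> 'a set \<Rightarrow> ('a \<Rightarrow> real) \<Rightarrow> ('a \<Rightarrow> real) \<Rightarrow> real" where
  "s_form \<kappa> H U u v = (LINT x|lebesgue_on U. \<kappa> x * u x * v x) / H\<^sup>2"

definition l2_form :: "'a::euclidean_space set \<Rightarrow> ('a \<Rightarrow> real) \<Rightarrow> ('a \<Rightarrow> real) \<Rightarrow> real" where
  "l2_form U u v = (LINT x|lebesgue_on U. u x * v x)"

definition a_norm where "a_norm \<kappa> U u = sqrt (a_form \<kappa> U u u)"
definition s_norm where "s_norm \<kappa> H U u = sqrt (s_form \<kappa> H U u u)"

definition square_integrable_on :: "('a::euclidean_space \<Rightarrow> 'b::euclidean_space) \<Rightarrow> 'a set \<Rightarrow> bool"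
    (infix \<open>square'_integrable'_on\<close> 50) where
  "f square_integrable_on U \<longleftrightarrow>
     f \<in> borel_measurable (lebesgue_on U) \<and> integrable (lebesgue_on U) (\<lambda>x. (norm (f x))\<^sup>2)"

text \<open>The function u belongs to $H^1(U)$ and has the weak gradient g. The test functions are
  the continuously differentiable functions with compact support in U.\<close>

definition H1_with_gradient :: "'a::euclidean_space set \<Rightarrow> ('a \<Rightarrow> real) \<Rightarrow> ('a \<Rightarrow> 'a) \<Rightarrow> bool" where
  "H1_with_gradient U u g \<longleftrightarrow>
     u square_integrable_on U \<and> g square_integrable_on U \<and>
     (\<forall>\<phi> d\<phi>. (\<forall>x. GDERIV \<phi> x :> d\<phi> x) \<and> continuous_on UNIV d\<phi> \<and>
        compact (closure {x. \<phi> x \<noteq> 0}) \<and> closure {x. \<phi> x \<noteq> 0} \<subseteq> U \<longrightarrow>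
        (LINT x|lebesgue_on U. u x *\<^sub>R d\<phi> x) = - (LINT x|lebesgue_on U. \<phi> x *\<^sub>R g x))"

definition ess_max :: "'a::euclidean_space set \<Rightarrow> ('a \<Rightarrow> real) \<Rightarrow> ereal" where
  "ess_max U f = esssup (lebesgue_on U) (\<lambda>x. ereal (f x))"

definition ess_min :: "'a::euclidean_space set \<Rightarrow> ('a \<Rightarrow> real) \<Rightarrow> ereal" where
  "ess_min U f = - esssup (lebesgue_on U) (\<lambda>x. - ereal (f x))"

text \<open>Near every boundary point, in suitable orthogonal coordinates, D lies strictly above the graph
  of a Lipschitz function: e is the vertical direction, and g does not depend on the coordinate
  along e.\<close>

definition lipschitz_domain :: "'a::euclidean_space set \<Rightarrow> bool" where
  "lipschitz_domain D \<longleftrightarrow> open D \<and> bounded D \<and>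
     (\<forall>x\<in>frontier D. \<exists>e r L g. norm e = 1 \<and> r > 0 \<and> L-lipschitz_on UNIV g \<and>
        (\<forall>y t. g (y + t *\<^sub>R e) = g y) \<and>
        (\<forall>y\<in>ball x r. y \<in> D \<longleftrightarrow> g y < inner y e))"

section \<open>Meshes and finite element functions\<close>

definition simplicial_mesh :: "'a::euclidean_space set set \<Rightarrow> 'a set \<Rightarrow> bool" where
  "simplicial_mesh T \<Omega> \<longleftrightarrow> triangulation T \<and> (\<forall>S\<in>T. int DIM('a) simplex S) \<and> \<Omega> = interior (\<Union>T)"

definition nodes :: "'a::euclidean_space set set \<Rightarrow> 'a set" where
  "nodes T = {p. \<exists>S\<in>T. p extreme_point_of S}"

text \<open>Finite element functions are continued by zero outside the closed domain, so that each of
  them is represented by exactly one function on the whole space.\<close>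

definition P1 :: "'a::euclidean_space set set \<Rightarrow> ('a \<Rightarrow> real) set" where
  "P1 T = {v. continuous_on (\<Union>T) v \<and> (\<forall>S\<in>T. \<exists>b c. \<forall>x\<in>S. v x = inner b x + c) \<and>
     (\<forall>x. x \<notin> \<Union>T \<longrightarrow> v x = 0)}"

definition P1_zero :: "'a::euclidean_space set set \<Rightarrow> ('a \<Rightarrow> real) set" where
  "P1_zero T = {v \<in> P1 T. \<forall>x\<in>frontier (\<Union>T). v x = 0}"

text \<open>The functions on w that vanish on the boundary of w, continued by zero.\<close>

definition P1_zero_on :: "'a::euclidean_space set set \<Rightarrow> 'a set \<Rightarrow> ('a \<Rightarrow> real) set" where
  "P1_zero_on T w = {v \<in> P1_zero T. \<forall>x. x \<notin> w \<longrightarrow> v x = 0}"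

definition piecewise_quadratic :: "'a::euclidean_space set set \<Rightarrow> ('a \<Rightarrow> real) \<Rightarrow> bool" where
  "piecewise_quadratic T v \<longleftrightarrow> continuous_on (\<Union>T) v \<and>
     (\<forall>S\<in>T. \<exists>Q b c. linear Q \<and> (\<forall>x\<in>S. v x = inner (Q x) x + inner b x + c))"

definition nodal_interp :: "'a::euclidean_space set set \<Rightarrow> ('a \<Rightarrow> real) \<Rightarrow> 'a \<Rightarrow> real" where
  "nodal_interp T v = (THE w. w \<in> P1 T \<and> (\<forall>p\<in>nodes T. w p = v p))"

definition hat :: "'a::euclidean_space set set \<Rightarrow> 'a \<Rightarrow> 'a \<Rightarrow> real" where
  "hat T p = nodal_interp T (indicat_real {p})"

definition add_layer :: "'a set set \<Rightarrow> 'a set set \<Rightarrow> 'a set set" where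
  "add_layer T C = {S \<in> T. \<exists>S'\<in>C. S \<inter> S' \<noteq> {}}"

section \<open>Matrices\<close>

definition form_mat :: "('f \<Rightarrow> 'f \<Rightarrow> real) \<Rightarrow> 'f list \<Rightarrow> real mat" where
  "form_mat b fs = mat (length fs) (length fs) (\<lambda>(r, c). b (fs ! c) (fs ! r))"

text \<open>Matrix of the inclusion of the span of fs into the fine space with nodal basis at ps: the
  coordinates of a fine function are its nodal values.\<close>

definition inclusion_mat :: "'a list \<Rightarrow> ('a \<Rightarrow> real) list \<Rightarrow> real mat" where
  "inclusion_mat ps fs = mat (length ps) (length fs) (\<lambda>(r, c). (fs ! c) (ps ! r))"

definition is_basis_list :: "('a \<Rightarrow> real) list \<Rightarrow> ('a \<Rightarrow> real) set \<Rightarrow> bool" where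
  "is_basis_list fs V \<longleftrightarrow> set fs \<subseteq> V \<and>
     (\<forall>v\<in>V. \<exists>!c::real list. length c = length fs \<and> v = (\<lambda>x. \<Sum>j<length fs. c ! j * (fs ! j) x))"

definition inv_mat :: "real mat \<Rightarrow> real mat" where
  "inv_mat B = the (mat_inverse B)"

text \<open>Ratio of the largest to the smallest eigenvalue.\<close>

definition cond_number :: "real mat \<Rightarrow> real" where
  "cond_number X = Max (spectrum X) / Min (spectrum X)"

section \<open>The two-level discretisation\<close>

text \<open>Coarse elements and the associated objects are indexed by 1, ..., ncells. Each coarse element
  is given by the set of fine elements it consists of.\<close>

record 'a discretisation =
  perm :: "'a \<Rightarrow> real"
  perm_min :: real
  perm_max :: real
  fine_mesh :: "'a set set"
  fine_size :: real
  ncells :: nat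
  cell_mesh :: "nat \<Rightarrow> 'a set set"
  coarse_size :: real
  nhigh :: "nat \<Rightarrow> nat"
  high :: "nat \<Rightarrow> nat \<Rightarrow> 'a set"
  eta0 :: real
  kappa0 :: real
  nlayers :: "nat \<Rightarrow> nat"
  pou :: "nat \<Rightarrow> 'a \<Rightarrow> real"
  time_step :: real
  node_list :: "'a list"
  local_basis :: "nat \<Rightarrow> ('a \<Rightarrow> real) list"

definition region :: "'a::euclidean_space discretisation \<Rightarrow> 'a set" where
  "region P = interior (\<Union>(fine_mesh P))"

definition cell :: "'a::euclidean_space discretisation \<Rightarrow> nat \<Rightarrow> 'a set" where
  "cell P i = interior (\<Union>(cell_mesh P i))"

definition low :: "'a::euclidean_space discretisation \<Rightarrow> nat \<Rightarrow> 'a set" where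
  "low P i = cell P i - (\<Union>j\<in>{1..nhigh P i}. high P i j)"

definition subdomain :: "'a::euclidean_space discretisation \<Rightarrow> nat \<Rightarrow> 'a set" where
  "subdomain P i = interior (\<Union>((add_layer (fine_mesh P) ^^ nlayers P i) (cell_mesh P i)))"

definition coefficient_bounds :: "'a::euclidean_space discretisation \<Rightarrow> bool" where
  "coefficient_bounds P \<longleftrightarrow> perm P \<in> borel_measurable (lebesgue_on (region P)) \<and> 0 < perm_min P \<and>
     (AE x in lebesgue_on (region P). perm_min P \<le> perm P x \<and> perm P x \<le> perm_max P)"

definition meshes :: "'a::euclidean_space discretisation \<Rightarrow> 'a set \<Rightarrow> bool" where
  "meshes P \<Omega> \<longleftrightarrow>
     simplicial_mesh (fine_mesh P) \<Omega> \<and> fine_size P = Max (diameter ` fine_mesh P) \<and>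
     (\<forall>i\<in>{1..ncells P}. cell_mesh P i \<noteq> {} \<and> connected (cell P i)) \<and>
     disjoint_family_on (cell_mesh P) {1..ncells P} \<and>
     (\<Union>i\<in>{1..ncells P}. cell_mesh P i) = fine_mesh P \<and>
     coarse_size P = Max ((\<lambda>i. diameter (cell P i)) ` {1..ncells P})"

subsection \<open>Auxiliary space\<close>

definition high_components :: "'a::euclidean_space discretisation \<Rightarrow> real \<Rightarrow> bool" where
  "high_components P C\<^sub>P \<longleftrightarrow> (\<forall>i\<in>{1..ncells P}.
     (\<forall>j\<in>{1..nhigh P i}.
        high P i j \<noteq> {} \<and> connected (high P i j) \<and> lipschitz_domain (high P i j) \<and>
        high P i j \<subseteq> cell P i \<and>
        ess_max (high P i j) (perm P) / ess_min (high P i j) (perm P) \<le> ereal (eta0 P) \<and>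
        ereal (kappa0 P) \<le> ess_min (high P i j) (perm P) \<and>
        (\<forall>u g. H1_with_gradient (high P i j) u g \<and> (LINT x|lebesgue_on (high P i j). u x) = 0 \<longrightarrow>
           (LINT x|lebesgue_on (high P i j). (u x)\<^sup>2)
             \<le> C\<^sub>P * (coarse_size P)\<^sup>2 * (LINT x|lebesgue_on (high P i j). (norm (g x))\<^sup>2))) \<and>
     disjoint_family_on (high P i) {1..nhigh P i} \<and>
     ess_max (low P i) (perm P) < ereal (kappa0 P))"

definition aux1 :: "'a::euclidean_space discretisation \<Rightarrow> ('a \<Rightarrow> real) set" where
  "aux1 P = {\<psi>. \<exists>c :: nat \<Rightarrow> nat \<Rightarrow> real.
     \<psi> = (\<lambda>x. \<Sum>i=1..ncells P. \<Sum>j=1..nhigh P i. c i j * indicat_real (high P i j) x)}"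

definition aux2 :: "'a::euclidean_space discretisation \<Rightarrow> ('a \<Rightarrow> real) set" where
  "aux2 P = {\<psi>. \<exists>c :: nat \<Rightarrow> real. \<psi> = (\<lambda>x. \<Sum>i=1..ncells P. c i * indicat_real (low P i) x)}"

definition aux :: "'a::euclidean_space discretisation \<Rightarrow> ('a \<Rightarrow> real) set" where
  "aux P = {(\<lambda>x. \<psi>1 x + \<psi>2 x) | \<psi>1 \<psi>2. \<psi>1 \<in> aux1 P \<and> \<psi>2 \<in> aux2 P}"

abbreviation a_glob where "a_glob P \<equiv> a_form (perm P) (region P)"
abbreviation s_glob where "s_glob P \<equiv> s_form (perm P) (coarse_size P) (region P)"

text \<open>The s-orthogonal projection onto the auxiliary space; it is unique almost everywhere.\<close>

definition aux_proj :: "'a::euclidean_space discretisation \<Rightarrow> ('a \<Rightarrow> real) \<Rightarrow> 'a \<Rightarrow> real" where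
  "aux_proj P u = (SOME w. w \<in> aux P \<and> (\<forall>\<psi>\<in>aux P. s_glob P (\<lambda>x. u x - w x) \<psi> = 0))"

text \<open>The projection on one coarse element. The argument only matters on that element and is
  continued by zero.\<close>

definition cell_proj :: "'a::euclidean_space discretisation \<Rightarrow> nat \<Rightarrow> ('a \<Rightarrow> real) \<Rightarrow> 'a \<Rightarrow> real" where
  "cell_proj P i u = aux_proj P (\<lambda>x. indicat_real (cell P i) x * u x)"

definition projection_estimate :: "'a::euclidean_space discretisation \<Rightarrow> real \<Rightarrow> bool" where
  "projection_estimate P C\<^sub>\<pi> \<longleftrightarrow>
     (\<forall>i\<in>{1..ncells P}. \<forall>u g. H1_with_gradient (cell P i) u g \<longrightarrow>
        (s_norm (perm P) (coarse_size P) (cell P i) (\<lambda>x. u x - cell_proj P i u x))\<^sup>2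
          \<le> C\<^sub>\<pi> * (LINT x|lebesgue_on (cell P i). perm P x * (norm (g x))\<^sup>2))"

subsection \<open>Coarse space and subdomain spaces\<close>

text \<open>The function p is the one written $\phi_\psi$, the solution of the variational problem with
  datum q.\<close>

definition solves_coarse_problem ::
    "'a::euclidean_space discretisation \<Rightarrow> ('a \<Rightarrow> real) \<Rightarrow> ('a \<Rightarrow> real) \<Rightarrow> bool" where
  "solves_coarse_problem P q p \<longleftrightarrow> p \<in> P1_zero (fine_mesh P) \<and>
     (\<forall>v\<in>P1_zero (fine_mesh P).
        a_glob P p v + s_glob P (aux_proj P p) (aux_proj P v) = s_glob P q (aux_proj P v))"

definition coarse_space1 :: "'a::euclidean_space discretisation \<Rightarrow> ('a \<Rightarrow> real) set" where
  "coarse_space1 P = {p. \<exists>q\<in>aux1 P. solves_coarse_problem P q p}"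

definition overlapping_cover :: "'a::euclidean_space discretisation \<Rightarrow> nat \<Rightarrow> bool" where
  "overlapping_cover P N\<^sub>o \<longleftrightarrow>
     (\<forall>i\<in>{1..ncells P}. 1 \<le> nlayers P i) \<and>
     region P = (\<Union>i\<in>{1..ncells P}. subdomain P i) \<and>
     (\<forall>x\<in>region P. card {i \<in> {1..ncells P}. x \<in> subdomain P i} \<le> N\<^sub>o)"

definition partition_of_unity :: "'a::euclidean_space discretisation \<Rightarrow> real \<Rightarrow> bool" where
  "partition_of_unity P C\<^sub>\<chi> \<longleftrightarrow>
     (\<forall>i\<in>{1..ncells P}. pou P i \<in> P1 (fine_mesh P) \<and>
        (\<forall>x\<in>region P - subdomain P i. pou P i x = 0) \<and>
        (AE x in lebesgue_on (region P). norm (grad (pou P i) x) \<le> C\<^sub>\<chi> / coarse_size P)) \<and>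
     (\<forall>x\<in>region P. (\<Sum>i=1..ncells P. pou P i x) = 1 \<and> (\<Sum>i=1..ncells P. (pou P i x)\<^sup>2) \<le> 1)"

definition interpolation_stable :: "'a::euclidean_space discretisation \<Rightarrow> real \<Rightarrow> bool" where
  "interpolation_stable P C\<^sub>I \<longleftrightarrow> (\<forall>v. piecewise_quadratic (fine_mesh P) v \<longrightarrow>
     a_norm (perm P) (region P) (nodal_interp (fine_mesh P) v) \<le> C\<^sub>I * a_norm (perm P) (region P) v \<and>
     s_norm (perm P) (coarse_size P) (region P) (nodal_interp (fine_mesh P) v)
       \<le> C\<^sub>I * s_norm (perm P) (coarse_size P) (region P) v)"

definition schwarz_space :: "'a::euclidean_space discretisation \<Rightarrow> nat \<Rightarrow> ('a \<Rightarrow> real) set" where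
  "schwarz_space P i =
     (if i = 0 then coarse_space1 P else P1_zero_on (fine_mesh P) (subdomain P i))"

text \<open>The fine nodal basis may be ordered arbitrarily, and any basis of each of the spaces
  may be used.\<close>

definition matrix_bases :: "'a::euclidean_space discretisation \<Rightarrow> bool" where
  "matrix_bases P \<longleftrightarrow>
     distinct (node_list P) \<and> set (node_list P) = nodes (fine_mesh P) \<inter> region P \<and>
     (\<forall>i\<in>{0..ncells P}. is_basis_list (local_basis P i) (schwarz_space P i))"

subsection \<open>The preconditioned matrix\<close>

definition stiffness :: "'a::euclidean_space discretisation \<Rightarrow> real mat" where
  "stiffness P = form_mat (a_form (perm P) (region P)) (map (hat (fine_mesh P)) (node_list P))"

definition mass :: "'a::euclidean_space discretisation \<Rightarrow> real mat" where
  "mass P = form_mat (l2_form (region P)) (map (hat (fine_mesh P)) (node_list P))"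

definition RT :: "'a::euclidean_space discretisation \<Rightarrow> nat \<Rightarrow> real mat" where
  "RT P i = inclusion_mat (node_list P) (local_basis P i)"

abbreviation Rm where "Rm P i \<equiv> transpose_mat (RT P i)"

definition A_tilde :: "'a::euclidean_space discretisation \<Rightarrow> real mat" where
  "A_tilde P = time_step P \<cdot>\<^sub>m stiffness P + mass P"

definition A_tilde_local :: "'a::euclidean_space discretisation \<Rightarrow> nat \<Rightarrow> real mat" where
  "A_tilde_local P i =
     time_step P \<cdot>\<^sub>m (Rm P i * stiffness P * RT P i) + Rm P i * mass P * RT P i"

text \<open>The sum over i is taken entrywise, since matrices of variable size do not form a monoid.\<close>

definition schwarz_preconditioner :: "'a::euclidean_space discretisation \<Rightarrow> real mat" where
  "schwarz_preconditioner P = mat (length (node_list P)) (length (node_list P))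
     (\<lambda>rc. \<Sum>i=0..ncells P. (RT P i * inv_mat (A_tilde_local P i) * Rm P i) $$ rc)"

end

theory Submission
  imports Defs
begin

text \<open>A real eigenvalue of the preconditioned matrix is bounded above by the overlap of the subdomain
  spaces and below by the reciprocal of the constant of a stable decomposition $v = \sum_i v_i$.
  For the latter let $v_0$ be the coarse function whose datum is the high-permeability part of $\pi v$.
  The error $e = v - v_0$ then solves the coarse problem with data $v$ and the low-permeability part
  of $\pi v$, so that $\|e\|_a^2 + \|\pi e\|_s^2$ is at most $\|v\|_a^2 + H^{-2} \kappa_0 \|v\|_{L^2}^2$,
  which is of the order of $H^{-2}$ times the energy of $v$ because $\Delta t$ is comparable to $H^2$.
  The projection estimate bounds $\|e\|_s$, and $v_i = I_h(\chi_i e)$.\<close>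

section \<open>Eigenvalues of additive Schwarz operators\<close>

text \<open>The stiffness part of the energy carries \<kappa>, the mass part does not, and the
  coarse problem measures everything in the \<kappa>-weighted norm. Bounding the weighted norm of v
  by its mass would cost the contrast. The only means of v estimated in that direction are the low
  ones, since the datum of $v_0$ removes the high ones exactly, and there \<kappa> stays below
  \<open>kappa0\<close>. The opposite direction, mass below weighted norm, is applied to the error
  and its pieces and costs 1 / \<open>perm_min\<close>. So the constant contains
  \<open>perm_min\<close>, which the theorem fixes, and never \<open>perm_max\<close>. The lower
  bound on the time step is spent on v, the upper bound on the error, where H^2 also cancels the
  H^{-2} from the gradients of the partition of unity. The projection estimate speaks of weak
  gradients, the matrices of pointwise ones; the mesh geometry serves in large part to join the two
  and to show that interpolated products vanish outside their subdomains.\<close>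

lemma inv_mat_pos_def:
  fixes S :: "real mat"
  assumes S: "S \<in> carrier_mat n n"
    and pos: "\<And>v. v \<in> carrier_vec n \<Longrightarrow> v \<noteq> 0\<^sub>v n \<Longrightarrow> 0 < v \<bullet> (S *\<^sub>v v)"
  shows "S * inv_mat S = 1\<^sub>m n" "inv_mat S \<in> carrier_mat n n"
proof -
  have "det S \<noteq> 0"
  proof
    assume "det S = 0"
    then obtain v where v: "v \<in> carrier_vec n" "v \<noteq> 0\<^sub>v n" "S *\<^sub>v v = 0\<^sub>v n"
      using det_0_iff_vec_prod_zero[OF S] by blast
    with pos[of v] show False by simp
  qed
  then have unit: "S \<in> Units (ring_mat TYPE(real) n ())" by (rule det_non_zero_imp_unit[OF S])
  obtain T where T: "mat_inverse S = Some T"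
    using mat_inverse(1)[OF S, where b = "()"] unit by (cases "mat_inverse S") auto
  with mat_inverse(2)[OF S T] show "S * inv_mat S = 1\<^sub>m n" "inv_mat S \<in> carrier_mat n n"
    by (auto simp: inv_mat_def)
qed

text \<open>Coefficients are plain functions rather than vectors: sums and multiples of arguments
  then carry no dimension side conditions.\<close>

definition mat_form :: "nat \<Rightarrow> real mat \<Rightarrow> (nat \<Rightarrow> real) \<Rightarrow> (nat \<Rightarrow> real) \<Rightarrow> real" where
  "mat_form n A f g = (\<Sum>r<n. \<Sum>c<n. f r * A $$ (r, c) * g c)"

abbreviation vec_form :: "nat \<Rightarrow> real mat \<Rightarrow> real vec \<Rightarrow> real vec \<Rightarrow> real" where
  "vec_form n A x y \<equiv> mat_form n A (vec_index x) (vec_index y)"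

lemma mat_form_eq_scalar_prod:
  assumes "A \<in> carrier_mat n n" "x \<in> carrier_vec n" "y \<in> carrier_vec n"
  shows "vec_form n A x y = x \<bullet> (A *\<^sub>v y)"
  using assms
  by (auto simp: mat_form_def scalar_prod_def sum_distrib_left mult.assoc lessThan_atLeast0 row_def
      intro!: sum.cong)

lemma mat_form_cong:
  "(\<And>r. r < n \<Longrightarrow> f r = f' r) \<Longrightarrow> (\<And>r. r < n \<Longrightarrow> g r = g' r) \<Longrightarrow> mat_form n A f g = mat_form n A f' g'"
  by (simp add: mat_form_def)

lemma mat_form_sum_left: "mat_form n A (\<lambda>r. \<Sum>i\<in>I. f i r) g = (\<Sum>i\<in>I. mat_form n A (f i) g)"
proof -
  have "mat_form n A (\<lambda>r. \<Sum>i\<in>I. f i r) g = (\<Sum>r<n. \<Sum>c<n. \<Sum>i\<in>I. f i r * A $$ (r, c) * g c)"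
    by (simp add: mat_form_def sum_distrib_right)
  also have "\<dots> = (\<Sum>r<n. \<Sum>i\<in>I. \<Sum>c<n. f i r * A $$ (r, c) * g c)"
    by (intro sum.cong refl sum.swap)
  also have "\<dots> = (\<Sum>i\<in>I. mat_form n A (f i) g)"
    unfolding mat_form_def by (rule sum.swap)
  finally show ?thesis .
qed

lemma mat_form_scale_left: "mat_form n A (\<lambda>r. k * f r) g = k * mat_form n A f g"
  by (simp add: mat_form_def sum_distrib_left mult.assoc)

lemma mat_form_commute:
  assumes "\<And>r c. r < n \<Longrightarrow> c < n \<Longrightarrow> A $$ (r, c) = A $$ (c, r)"
  shows "mat_form n A f g = mat_form n A g f"
proof -
  have "mat_form n A f g = (\<Sum>c<n. \<Sum>r<n. f r * A $$ (r, c) * g c)"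
    unfolding mat_form_def by (rule sum.swap)
  then show ?thesis
    unfolding mat_form_def using assms by (auto intro!: sum.cong)
qed

text \<open>Expand the form at t f - g and divide by t. The two eigenvalue bounds use different
  weights t, one to absorb C and one to absorb M.\<close>

lemma mat_form_young:
  assumes sym: "\<And>r c. r < n \<Longrightarrow> c < n \<Longrightarrow> A $$ (r, c) = A $$ (c, r)"
    and nonneg: "\<And>f. 0 \<le> mat_form n A f f" and "0 < t"
  shows "2 * mat_form n A f g \<le> t * mat_form n A f f + mat_form n A g g / t"
proof -
  let ?h = "\<lambda>r. t * f r - g r"
  have "mat_form n A ?h ?h
      = t\<^sup>2 * mat_form n A f f - t * mat_form n A f g - t * mat_form n A g f + mat_form n A g g"
    by (simp add: mat_form_def algebra_simps sum.distrib sum_subtractf sum_distrib_left power2_eq_square)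
  also have "\<dots> = t\<^sup>2 * mat_form n A f f - 2 * t * mat_form n A f g + mat_form n A g g"
    using mat_form_commute[of n A g f] sym by simp
  finally have "0 \<le> t\<^sup>2 * mat_form n A f f - 2 * t * mat_form n A f g + mat_form n A g g"
    using nonneg[of ?h] by simp
  then have "0 \<le> (t\<^sup>2 * mat_form n A f f - 2 * t * mat_form n A f g + mat_form n A g g) / t"
    using \<open>0 < t\<close> by simp
  then show ?thesis
    using \<open>0 < t\<close> by (simp add: field_simps power2_eq_square)
qed

text \<open>Works on a single eigenvector x. Each local solve yields the A-orthogonal projection p_i
  of x onto the range of \<open>R i\<close>, so that \<mu> x is the sum of the p_i and \<mu> (x, x)
  is the sum of the (p_i, p_i). \<open>decomposition\<close> bounds this sum below and
  \<open>overlap\<close> bounds it above; \<open>inj\<close> makes the local matrices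
  invertible.\<close>

lemma schwarz_eigenvalue_bounds:
  fixes A B :: "real mat" and R :: "nat \<Rightarrow> real mat"
  assumes A: "A \<in> carrier_mat n n"
    and sym: "\<And>r c. r < n \<Longrightarrow> c < n \<Longrightarrow> A $$ (r, c) = A $$ (c, r)"
    and pos: "\<And>x. x \<in> carrier_vec n \<Longrightarrow> x \<noteq> 0\<^sub>v n \<Longrightarrow> 0 < vec_form n A x x"
    and R: "\<And>i. i \<le> N \<Longrightarrow> R i \<in> carrier_mat n (k i)"
    and inj: "\<And>i c. i \<le> N \<Longrightarrow> c \<in> carrier_vec (k i) \<Longrightarrow> R i *\<^sub>v c = 0\<^sub>v n \<Longrightarrow> c = 0\<^sub>v (k i)"
    and B: "B = mat n n (\<lambda>rc. \<Sum>i=0..N.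
          (R i * inv_mat (transpose_mat (R i) * A * R i) * transpose_mat (R i)) $$ rc)"
    and M: "0 < M"
    and overlap: "\<And>c. (\<And>i. i \<le> N \<Longrightarrow> c i \<in> carrier_vec (k i)) \<Longrightarrow>
        mat_form n A (\<lambda>r. \<Sum>i=1..N. (R i *\<^sub>v c i) $ r) (\<lambda>r. \<Sum>i=1..N. (R i *\<^sub>v c i) $ r)
          \<le> M * (\<Sum>i=1..N. vec_form n A (R i *\<^sub>v c i) (R i *\<^sub>v c i))"
    and C: "0 < C"
    and decomposition: "\<And>x. x \<in> carrier_vec n \<Longrightarrow> \<exists>c. (\<forall>i\<le>N. c i \<in> carrier_vec (k i)) \<and>
        (\<forall>r<n. x $ r = (\<Sum>i=0..N. (R i *\<^sub>v c i) $ r)) \<and>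
        (\<Sum>i=0..N. vec_form n A (R i *\<^sub>v c i) (R i *\<^sub>v c i))
          \<le> C * vec_form n A x x"
    and ev: "eigenvalue (B * A) \<mu>"
  shows "1 \<le> C * \<mu>" "\<mu> \<le> M + 1"
proof -
  have nonneg: "0 \<le> mat_form n A f f" for f
  proof -
    have "mat_form n A f f = vec_form n A (vec n f) (vec n f)"
      by (rule mat_form_cong) auto
    also have "0 \<le> \<dots>"
    proof (cases "vec n f = 0\<^sub>v n")
      case True
      then show ?thesis by (simp add: mat_form_def)
    next
      case False
      then show ?thesis using pos[of "vec n f"] by simp
    qed
    finally show ?thesis .
  qed
  note young = mat_form_young[OF sym nonneg]
  have Bc: "B \<in> carrier_mat n n" by (simp add: B)
  obtain x where x: "x \<in> carrier_vec n" "x \<noteq> 0\<^sub>v n" "(B * A) *\<^sub>v x = \<mu> \<cdot>\<^sub>v x"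
    using ev A Bc by (auto simp: eigenvalue_def eigenvector_def)
  define X where "X = vec_form n A x x"
  have X: "0 < X" using pos x by (simp add: X_def)
  define y where "y = A *\<^sub>v x"
  have y: "y \<in> carrier_vec n" using A x by (simp add: y_def)
  define L where "L i = transpose_mat (R i) * A * R i" for i
  \<comment> \<open>Coefficients of the local solve. \<open>p i\<close> is the resulting fine
    vector, and \<open>galerkin\<close> below makes it the A-orthogonal projection of x.\<close>
  define d where "d i = inv_mat (L i) *\<^sub>v (transpose_mat (R i) *\<^sub>v y)" for i
  define p where "p i = R i *\<^sub>v d i" for i
  have form_R: "vec_form n A (R i *\<^sub>v c) v = c \<bullet> (transpose_mat (R i) *\<^sub>v (A *\<^sub>v v))"
    if "i \<le> N" "c \<in> carrier_vec (k i)" "v \<in> carrier_vec n" for i c v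
  proof -
    note [simp] = R[OF that(1)] A that
    have "vec_form n A (R i *\<^sub>v c) v = (R i *\<^sub>v c) \<bullet> (A *\<^sub>v v)"
      by (rule mat_form_eq_scalar_prod) (auto intro: mult_mat_vec_carrier[OF R[OF that(1)]])
    also have "\<dots> = (A *\<^sub>v v) \<bullet> (R i *\<^sub>v c)"
      by (rule comm_scalar_prod[of _ n]) (auto intro: mult_mat_vec_carrier[OF A] mult_mat_vec_carrier[OF R[OF that(1)]])
    also have "\<dots> = (transpose_mat (R i) *\<^sub>v (A *\<^sub>v v)) \<bullet> c"
      by (rule transpose_vec_mult_scalar[OF R[OF that(1)] that(2), symmetric])
        (auto intro: mult_mat_vec_carrier[OF A])
    also have "\<dots> = c \<bullet> (transpose_mat (R i) *\<^sub>v (A *\<^sub>v v))"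
      by (rule comm_scalar_prod[of _ "k i"])
       (use R[OF that(1)] A that in \<open>auto intro!: mult_mat_vec_carrier[of _ _ n] mult_mat_vec_carrier[OF A]\<close>)
    finally show ?thesis .
  qed
  have Lc: "L i \<in> carrier_mat (k i) (k i)" if "i \<le> N" for i
    using R[OF that] A by (auto simp: L_def)
  have L_mult: "L i *\<^sub>v c = transpose_mat (R i) *\<^sub>v (A *\<^sub>v (R i *\<^sub>v c))"
    if "i \<le> N" "c \<in> carrier_vec (k i)" for i c
  proof -
    note Ri = R[OF that(1)]
    have RT: "transpose_mat (R i) \<in> carrier_mat (k i) n" using Ri by simp
    have "L i *\<^sub>v c = (transpose_mat (R i) * A) *\<^sub>v (R i *\<^sub>v c)"
      unfolding L_def by (rule assoc_mult_mat_vec[OF mult_carrier_mat[OF RT A] Ri that(2)])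
    also have "\<dots> = transpose_mat (R i) *\<^sub>v (A *\<^sub>v (R i *\<^sub>v c))"
      by (rule assoc_mult_mat_vec[OF RT A]) (rule mult_mat_vec_carrier[OF Ri that(2)])
    finally show ?thesis .
  qed
  have Lpos: "0 < c \<bullet> (L i *\<^sub>v c)" if "i \<le> N" "c \<in> carrier_vec (k i)" "c \<noteq> 0\<^sub>v (k i)" for i c
  proof -
    have Rc: "R i *\<^sub>v c \<in> carrier_vec n" using R[OF that(1)] that by auto
    have "R i *\<^sub>v c \<noteq> 0\<^sub>v n" using inj that by blast
    from pos[OF Rc this] show ?thesis
      using form_R[OF that(1,2) Rc] L_mult[OF that(1,2)] by simp
  qed
  note Linv = inv_mat_pos_def[OF Lc Lpos]
  have dc: "d i \<in> carrier_vec (k i)" and Ld: "L i *\<^sub>v d i = transpose_mat (R i) *\<^sub>v y" if "i \<le> N" for i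
  proof -
    have Ry: "transpose_mat (R i) *\<^sub>v y \<in> carrier_vec (k i)" using R[OF that] y by auto
    show "d i \<in> carrier_vec (k i)"
      unfolding d_def using Linv(2)[OF that that] Ry by auto
    have "L i *\<^sub>v d i = (L i * inv_mat (L i)) *\<^sub>v (transpose_mat (R i) *\<^sub>v y)"
      unfolding d_def using assoc_mult_mat_vec[OF Lc[OF that] Linv(2)[OF that that] Ry] by simp
    then show "L i *\<^sub>v d i = transpose_mat (R i) *\<^sub>v y"
      using Linv(1)[OF that that] Ry by simp
  qed
  have pc: "p i \<in> carrier_vec n" if "i \<le> N" for i
    unfolding p_def using R[OF that] dc[OF that] by auto
  have galerkin: "vec_form n A (R i *\<^sub>v c) (p i)
      = vec_form n A (R i *\<^sub>v c) x"
    if "i \<le> N" "c \<in> carrier_vec (k i)" for i c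
    using form_R[OF that pc[OF that(1)]] form_R[OF that x(1)] L_mult[OF that(1) dc[OF that(1)]] Ld[OF that(1)]
    by (simp add: p_def y_def)
  have pp: "vec_form n A (p i) (p i) = vec_form n A (p i) x"
    if "i \<le> N" for i
    using galerkin[OF that dc[OF that]] by (simp add: p_def)
  have \<mu>x: "\<mu> * x $ r = (\<Sum>i=0..N. p i $ r)" if r: "r < n" for r
  proof -
    let ?K = "\<lambda>i. R i * inv_mat (L i) * transpose_mat (R i)"
    have Kc: "?K i \<in> carrier_mat n n" if "i \<le> N" for i
    proof (rule mult_carrier_mat)
      show "R i * inv_mat (L i) \<in> carrier_mat n (k i)"
        using R[OF that] Linv(2)[OF that that] by (rule mult_carrier_mat)
    qed (use R[OF that] in simp)
    have "(B * A) *\<^sub>v x = B *\<^sub>v y"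
      unfolding y_def by (rule assoc_mult_mat_vec[OF Bc A x(1)])
    then have "(B *\<^sub>v y) $ r = (\<mu> \<cdot>\<^sub>v x) $ r" using x(3) by simp
    then have "\<mu> * x $ r = (B *\<^sub>v y) $ r" using carrier_vecD[OF x(1)] r by simp
    also have "\<dots> = (\<Sum>c<n. (\<Sum>i=0..N. ?K i $$ (r, c)) * y $ c)"
      using r Bc y by (simp add: B L_def scalar_prod_def lessThan_atLeast0)
    also have "\<dots> = (\<Sum>i=0..N. \<Sum>c<n. ?K i $$ (r, c) * y $ c)"
      by (subst sum.swap) (simp add: sum_distrib_right)
    also have "\<dots> = (\<Sum>i=0..N. (?K i *\<^sub>v y) $ r)"
    proof (rule sum.cong[OF refl])
      fix i assume "i \<in> {0..N}"
      then have "?K i \<in> carrier_mat n n" using Kc by simp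
      then have "dim_row (?K i) = n" "dim_col (?K i) = n" by (simp_all only: carrier_matD)
      then show "(\<Sum>c<n. ?K i $$ (r, c) * y $ c) = (?K i *\<^sub>v y) $ r"
        using r y by (simp add: index_mult_mat_vec scalar_prod_def lessThan_atLeast0 del: index_mult_mat)
    qed
    also have "\<dots> = (\<Sum>i=0..N. p i $ r)"
    proof (rule sum.cong[OF refl])
      fix i assume "i \<in> {0..N}"
      then have i: "i \<le> N" by simp
      note Ri = R[OF i] and Li = Linv(2)[OF i i]
      have RT: "transpose_mat (R i) \<in> carrier_mat (k i) n" using Ri by simp
      have Ry: "transpose_mat (R i) *\<^sub>v y \<in> carrier_vec (k i)" using RT y by auto
      have "?K i *\<^sub>v y = (R i * inv_mat (L i)) *\<^sub>v (transpose_mat (R i) *\<^sub>v y)"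
        by (rule assoc_mult_mat_vec[OF mult_carrier_mat[OF Ri Li] RT y])
      also have "\<dots> = p i"
        unfolding p_def d_def by (rule assoc_mult_mat_vec[OF Ri Li Ry])
      finally show "(?K i *\<^sub>v y) $ r = p i $ r" by simp
    qed
    finally show ?thesis .
  qed
  have \<mu>X: "\<mu> * X = (\<Sum>i=0..N. vec_form n A (p i) (p i))"
  proof -
    have "\<mu> * X = mat_form n A (\<lambda>r. \<mu> * x $ r) (vec_index x)"
      by (simp add: X_def mat_form_scale_left)
    also have "\<dots> = mat_form n A (\<lambda>r. \<Sum>i=0..N. p i $ r) (vec_index x)"
      by (rule mat_form_cong) (use \<mu>x in auto)
    also have "\<dots> = (\<Sum>i=0..N. vec_form n A (p i) x)"
      by (rule mat_form_sum_left)
    also have "\<dots> = (\<Sum>i=0..N. vec_form n A (p i) (p i))"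
      by (rule sum.cong) (use pp in auto)
    finally show ?thesis .
  qed
  show "1 \<le> C * \<mu>"
  proof -
    obtain c where c: "\<And>i. i \<le> N \<Longrightarrow> c i \<in> carrier_vec (k i)"
      "\<And>r. r < n \<Longrightarrow> x $ r = (\<Sum>i=0..N. (R i *\<^sub>v c i) $ r)"
      "(\<Sum>i=0..N. vec_form n A (R i *\<^sub>v c i) (R i *\<^sub>v c i)) \<le> C * X"
      using decomposition[OF x(1)] unfolding X_def by blast
    let ?v = "\<lambda>i. R i *\<^sub>v c i"
    have "X = mat_form n A (\<lambda>r. \<Sum>i=0..N. ?v i $ r) (vec_index x)"
      unfolding X_def by (rule mat_form_cong) (use c in auto)
    also have "\<dots> = (\<Sum>i=0..N. vec_form n A (?v i) x)"
      by (rule mat_form_sum_left)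
    also have "\<dots> = (\<Sum>i=0..N. vec_form n A (?v i) (p i))"
      by (rule sum.cong) (use galerkin c(1) in auto)
    finally have "2 * X = (\<Sum>i=0..N. 2 * vec_form n A (?v i) (p i))"
      by (simp add: sum_distrib_left)
    \<comment> \<open>Weight 1 / C: by stability of the decomposition the first sum then costs one X
      out of the two on the left.\<close>
    also have "\<dots> \<le> (\<Sum>i=0..N. (1 / C) * vec_form n A (?v i) (?v i)
        + vec_form n A (p i) (p i) / (1 / C))"
      by (intro sum_mono young) (use C in auto)
    also have "\<dots> = (\<Sum>i=0..N. vec_form n A (?v i) (?v i)) / C + C * (\<mu> * X)"
      unfolding \<mu>X by (simp add: sum.distrib sum_distrib_left sum_divide_distrib mult.commute)
    also have "\<dots> \<le> X + C * (\<mu> * X)"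
      using c(3) C by (simp add: field_simps)
    finally have "1 * X \<le> (C * \<mu>) * X" by simp
    then show ?thesis using X by (simp only: mult_le_cancel_right_pos)
  qed
  show "\<mu> \<le> M + 1"
  proof -
    let ?S = "\<Sum>i=1..N. vec_form n A (p i) (p i)"
    let ?w = "\<lambda>r. \<Sum>i=1..N. p i $ r"
    \<comment> \<open>Index 0 is split off because coarse functions have global support and take no
      part in \<open>overlap\<close>; an orthogonal projection has energy at most X, hence the
      summand 1 in M + 1.\<close>
    have "2 * vec_form n A (p 0) x \<le> 1 * vec_form n A (p 0) (p 0) + X / 1"
      unfolding X_def by (rule young) auto
    then have p0: "vec_form n A (p 0) (p 0) \<le> X" using pp[of 0] by simp
    have "?S = mat_form n A ?w (vec_index x)"
      unfolding mat_form_sum_left by (rule sum.cong) (use pp in auto)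
    \<comment> \<open>With weight 1 / M the overlap bound turns the first term into a single
      \<open>?S\<close>, which is absorbed on the left.\<close>
    then have "2 * ?S \<le> (1 / M) * mat_form n A ?w ?w + X / (1 / M)"
      unfolding X_def using young[of "1 / M" ?w "vec_index x"] M by simp
    also have "\<dots> \<le> (1 / M) * (M * ?S) + X / (1 / M)"
    proof -
      have "mat_form n A ?w ?w \<le> M * ?S" unfolding p_def by (rule overlap) (rule dc)
      from mult_left_mono[OF this, of "1 / M"] M show ?thesis by simp
    qed
    also have "\<dots> = ?S + M * X" using M by simp
    finally have "?S \<le> M * X" by simp
    moreover have "\<mu> * X = vec_form n A (p 0) (p 0) + ?S"
      unfolding \<mu>X by (simp add: sum.atLeast_Suc_atMost)
    ultimately have "\<mu> * X \<le> (M + 1) * X" using p0 by (simp add: algebra_simps)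
    then show ?thesis using X by (simp only: mult_le_cancel_right_pos)
  qed
qed

section \<open>Simplicial meshes\<close>

text \<open>Moving one point to the origin turns affine independence into linear independence; a
  linear extension is an inner product with \<open>adjoint g 1\<close>.\<close>

lemma affine_interpolation:
  fixes C :: "'a::euclidean_space set" and f :: "'a \<Rightarrow> real"
  assumes "\<not> affine_dependent C"
  obtains b c where "\<And>q. q \<in> C \<Longrightarrow> inner b q + c = f q"
proof (cases "C = {}")
  case True
  then show thesis using that by blast
next
  case False
  then obtain a where a: "a \<in> C" by blast
  let ?B = "(\<lambda>x. - a + x) ` (C - {a})"
  have "independent ?B" using assms affine_dependent_iff_dependent2[OF a] by simp
  from linear_independent_extend[OF this, of "\<lambda>y. f (a + y) - f a"]
  obtain g :: "'a \<Rightarrow> real" where g: "linear g" "\<And>y. y \<in> ?B \<Longrightarrow> g y = f (a + y) - f a"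
    by blast
  have gb: "g x = inner (adjoint g 1) x" for x
    using adjoint_works[OF g(1), of x 1] by (simp add: inner_commute)
  show thesis
  proof (rule that)
    fix q assume q: "q \<in> C"
    have "g (- a + q) = f q - f a"
    proof (cases "q = a")
      case True
      then show ?thesis using linear_0[OF g(1)] by simp
    next
      case False
      then show ?thesis using g(2)[of "- a + q"] q by auto
    qed
    then show "inner (adjoint g 1) q + (f a - inner (adjoint g 1) a) = f q"
      by (simp add: gb inner_add_right inner_diff_right)
  qed
qed

lemma affine_eq_on_convex_hull:
  fixes b b' :: "'a::euclidean_space"
  assumes "\<And>q. q \<in> C \<Longrightarrow> inner b q + c = inner b' q + c'" and "x \<in> convex hull C"
  shows "inner b x + c = inner b' x + c'"
proof -
  have "convex {x. inner (b - b') x = c' - c}" by (rule convex_hyperplane)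
  moreover have "C \<subseteq> {x. inner (b - b') x = c' - c}"
    using assms(1) by (auto simp: inner_diff_left algebra_simps)
  ultimately have "convex hull C \<subseteq> {x. inner (b - b') x = c' - c}" by (rule hull_minimal[rotated])
  then show ?thesis using assms(2) by (auto simp: inner_diff_left algebra_simps)
qed

abbreviation verts :: "'a::euclidean_space set \<Rightarrow> 'a set" where "verts S \<equiv> {p. p extreme_point_of S}"

locale simplicial =
  fixes T :: "'a::euclidean_space set set"
  assumes tri: "triangulation T" and full: "\<And>S. S \<in> T \<Longrightarrow> int DIM('a) simplex S"
begin

lemma finite_T: "finite T"
  using tri by (simp add: triangulation_def)

lemma face: "S \<in> T \<Longrightarrow> S' \<in> T \<Longrightarrow> S \<inter> S' face_of S"
  using tri by (simp add: triangulation_def)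

lemma face': "S \<in> T \<Longrightarrow> S' \<in> T \<Longrightarrow> S \<inter> S' face_of S'"
  using face[of S' S] by (simp add: Int_commute)

lemma simplex_hull:
  assumes "S \<in> T"
  shows "\<not> affine_dependent (verts S)" "finite (verts S)"
    "S = convex hull (verts S)"
proof -
  obtain C where C: "\<not> affine_dependent C" "S = convex hull C"
    using full[OF assms] unfolding simplex_def by blast
  then have "(verts S) = C"
    using extreme_point_of_convex_hull_affine_independent[OF C(1)] by auto
  with C show "\<not> affine_dependent (verts S)"
    "finite (verts S)" "S = convex hull (verts S)"
    using aff_independent_finite by auto
qed

lemma simplex_convex: "S \<in> T \<Longrightarrow> convex S"
  by (metis simplex_hull(3) convex_convex_hull)

lemma simplex_compact: "S \<in> T \<Longrightarrow> compact S"
  by (metis simplex_hull(2,3) finite_imp_compact_convex_hull)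

lemma simplex_closed: "S \<in> T \<Longrightarrow> closed S"
  by (simp add: simplex_compact compact_imp_closed)

lemma simplex_interior: "S \<in> T \<Longrightarrow> interior S \<noteq> {}"
proof -
  assume S: "S \<in> T"
  have "aff_dim S = DIM('a)" using aff_dim_simplex[OF full[OF S]] by simp
  then have "interior S = rel_interior S" "S \<noteq> {}"
    by (auto simp: interior_rel_interior_gen aff_dim_empty)
  then show ?thesis using rel_interior_eq_empty[OF simplex_convex[OF S]] by simp
qed

lemma compact_Union: "T' \<subseteq> T \<Longrightarrow> compact (\<Union>T')"
  using finite_T simplex_compact by (auto intro!: compact_Union intro: finite_subset)

text \<open>A proper face misses the interior, so the common face \<open>S \<inter> S'\<close> is
  all of S; hence x is interior to S' as well, and the same argument applies there.\<close>

lemma interior_unique: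
  assumes "S \<in> T" "S' \<in> T" "x \<in> interior S" "x \<in> S'"
  shows "S = S'"
proof -
  have x: "x \<in> S" using assms interior_subset by blast
  have "S \<inter> S' = S"
    using face_of_disjoint_interior[OF face[OF assms(1,2)]] assms x by blast
  then have "S \<subseteq> S'" by blast
  then have "interior S \<subseteq> interior S'" by (rule interior_mono)
  then show ?thesis
    using face_of_disjoint_interior[OF face'[OF assms(1,2)]] assms x \<open>S \<subseteq> S'\<close> by blast
qed

lemma interior_in_subset:
  assumes "T' \<subseteq> T" "S \<in> T" "x \<in> interior S" "x \<in> interior (\<Union>T')"
  shows "S \<in> T'"
proof -
  obtain S' where "S' \<in> T'" "x \<in> S'" using assms(4) interior_subset by blast
  then show ?thesis using interior_unique[of S S' x] assms by blast
qed

text \<open>The domain up to its mesh skeleton: finite element functions are differentiable here,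
  and what is missing is a null set.\<close>

definition open_cells :: "'a set" where
  "open_cells = (\<Union>S\<in>T. interior S)"

lemma open_open_cells: "open open_cells"
  by (auto simp: open_cells_def)

lemma open_cells_subset: "open_cells \<subseteq> interior (\<Union>T)"
  unfolding open_cells_def by (intro UN_least interior_mono) blast

lemma negligible_skeleton: "negligible (\<Union>T - open_cells)"
proof (rule negligible_subset)
  show "negligible (\<Union>S\<in>T. frontier S)"
    by (rule negligible_Union) (auto simp: finite_T intro!: negligible_convex_frontier simplex_convex)
  show "\<Union>T - open_cells \<subseteq> (\<Union>S\<in>T. frontier S)"
    using simplex_closed by (auto simp: open_cells_def frontier_def)
qed

lemma finite_nodes: "finite (nodes T)"
proof -
  have "nodes T = (\<Union>S\<in>T. (verts S))" by (auto simp: nodes_def)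
  then show ?thesis using finite_T simplex_hull(2) by simp
qed

text \<open>Conformity of the mesh, that is, absence of hanging nodes: extremeness passes through
  the common face of two simplices.\<close>

lemma node_extreme: "p \<in> nodes T \<Longrightarrow> S \<in> T \<Longrightarrow> p \<in> S \<Longrightarrow> p extreme_point_of S"
proof -
  assume p: "p \<in> nodes T" "S \<in> T" "p \<in> S"
  then obtain S' where S': "S' \<in> T" "p extreme_point_of S'" by (auto simp: nodes_def)
  then have "p extreme_point_of (S \<inter> S')"
    using p extreme_point_of_face[OF face'[of S S']] by (auto simp: extreme_point_of_def)
  then show ?thesis using extreme_point_of_face[OF face[of S S']] p S' by blast
qed

lemma extreme_node: "S \<in> T \<Longrightarrow> p extreme_point_of S \<Longrightarrow> p \<in> nodes T \<and> p \<in> S"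
  by (auto simp: nodes_def extreme_point_of_def)

section \<open>Piecewise affine functions and the nodal basis\<close>

lemma P1_affine: "v \<in> P1 T \<Longrightarrow> S \<in> T \<Longrightarrow> \<exists>b c. \<forall>x\<in>S. v x = inner b x + c"
  by (simp add: P1_def)

lemma P1_pieces:
  assumes "u \<in> P1 T"
  obtains b c where "\<forall>S\<in>T. \<forall>x\<in>S. u x = inner (b S) x + c S"
proof -
  have "\<forall>S\<in>T. \<exists>b c. \<forall>x\<in>S. u x = inner b x + c" using P1_affine[OF assms] by blast
  from bchoice[OF this] obtain b where "\<forall>S\<in>T. \<exists>c. \<forall>x\<in>S. u x = inner (b S) x + c" by blast
  from bchoice[OF this] obtain c where "\<forall>S\<in>T. \<forall>x\<in>S. u x = inner (b S) x + c S" by blast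
  then show thesis by (rule that)
qed

lemma P1_outside: "v \<in> P1 T \<Longrightarrow> x \<notin> \<Union>T \<Longrightarrow> v x = 0"
  by (simp add: P1_def)

lemma P1_eqI:
  assumes "u \<in> P1 T" "v \<in> P1 T" "\<And>p. p \<in> nodes T \<Longrightarrow> u p = v p"
  shows "u = v"
proof
  fix x
  show "u x = v x"
  proof (cases "x \<in> \<Union>T")
    case False
    then show ?thesis using P1_outside[OF assms(1)] P1_outside[OF assms(2)] by simp
  next
    case True
    then obtain S where S: "S \<in> T" "x \<in> S" by blast
    obtain b c where u: "\<And>y. y \<in> S \<Longrightarrow> u y = inner b y + c" using P1_affine assms S by blast
    obtain b' c' where v: "\<And>y. y \<in> S \<Longrightarrow> v y = inner b' y + c'" using P1_affine assms S by blast
    have "inner b x + c = inner b' x + c'"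
    proof (rule affine_eq_on_convex_hull)
      show "x \<in> convex hull (verts S)" using simplex_hull(3) S by blast
      show "inner b q + c = inner b' q + c'" if "q \<in> (verts S)" for q
      proof -
        have "q \<in> nodes T" "q \<in> S" using that extreme_node[OF S(1)] by auto
        then show ?thesis using u[of q] v[of q] assms(3)[of q] by simp
      qed
    qed
    then show ?thesis using u[OF S(2)] v[OF S(2)] by simp
  qed
qed

text \<open>Interpolate on each simplex separately. Two pieces agree on an intersection because it
  is a face of both simplices and, by Krein-Milman, the hull of its extreme points, which are
  vertices of both.\<close>

lemma P1_exists: "\<exists>w. w \<in> P1 T \<and> (\<forall>p\<in>nodes T. w p = f p)"
proof -
  have "\<exists>b c. \<forall>q. q extreme_point_of S \<longrightarrow> inner b q + c = f q" if S: "S \<in> T" for S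
  proof -
    obtain b c where "\<And>q. q \<in> (verts S) \<Longrightarrow> inner b q + c = f q"
      using affine_interpolation[OF simplex_hull(1)[OF S], of f] by blast
    then show ?thesis by (intro exI[of _ b] exI[of _ c]) simp
  qed
  then have "\<forall>S\<in>T. \<exists>b c. \<forall>q. q extreme_point_of S \<longrightarrow> inner b q + c = f q" by blast
  from bchoice[OF this] obtain b where "\<forall>S\<in>T. \<exists>c. \<forall>q. q extreme_point_of S \<longrightarrow> inner (b S) q + c = f q"
    by blast
  from bchoice[OF this] obtain c where "\<forall>S\<in>T. \<forall>q. q extreme_point_of S \<longrightarrow> inner (b S) q + c S = f q"
    by blast
  then have bc: "\<And>S q. S \<in> T \<Longrightarrow> q extreme_point_of S \<Longrightarrow> inner (b S) q + c S = f q"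
    by blast
  have eq: "inner (b S) x + c S = inner (b S') x + c S'"
    if S: "S \<in> T" "S' \<in> T" "x \<in> S" "x \<in> S'" for S S' x
  proof (rule affine_eq_on_convex_hull)
    have "compact (S \<inter> S')" "convex (S \<inter> S')"
      using S simplex_compact simplex_convex simplex_closed by (auto intro: convex_Int compact_Int_closed)
    from Krein_Milman_Minkowski[OF this] show "x \<in> convex hull (verts (S \<inter> S'))"
      using S by blast
    show "inner (b S) q + c S = inner (b S') q + c S'" if "q \<in> (verts (S \<inter> S'))" for q
    proof -
      have "q extreme_point_of S" "q extreme_point_of S'"
        using that extreme_point_of_face[OF face[OF S(1,2)]] extreme_point_of_face[OF face'[OF S(1,2)]]
        by blast+
      then show ?thesis using bc[of S q] bc[of S' q] S by simp
    qed
  qed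
  define w where "w x = (if x \<in> \<Union>T then let S = (SOME S. S \<in> T \<and> x \<in> S) in inner (b S) x + c S else 0)" for x
  have w: "w x = inner (b S) x + c S" if "S \<in> T" "x \<in> S" for S x
  proof -
    define S' where "S' = (SOME S. S \<in> T \<and> x \<in> S)"
    have S': "S' \<in> T \<and> x \<in> S'"
      unfolding S'_def by (rule someI[where x = S]) (use that in blast)
    have "w x = inner (b S') x + c S'"
      unfolding w_def Let_def S'_def[symmetric] using UnionI[of S' T x] S' by simp
    also have "\<dots> = inner (b S) x + c S" by (rule eq) (use that S' in auto)
    finally show ?thesis .
  qed
  have "continuous_on (\<Union>S\<in>T. S) w"
  proof (rule continuous_on_closed_Union)
    show "continuous_on S w" if "S \<in> T" for S
    proof -
      have "continuous_on S (\<lambda>x. inner (b S) x + c S)" by (intro continuous_intros)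
      then show ?thesis by (rule continuous_on_eq) (simp add: w[OF that])
    qed
  qed (auto simp: finite_T simplex_closed)
  then have "w \<in> P1 T" using w unfolding P1_def by (auto simp: w_def)
  moreover have "w p = f p" if p: "p \<in> nodes T" for p
  proof -
    obtain S where S: "S \<in> T" "p extreme_point_of S" using p by (auto simp: nodes_def)
    then show ?thesis using w[OF S(1), of p] bc[OF S] extreme_node[OF S] by simp
  qed
  ultimately show ?thesis by blast
qed

lemma nodal_interp: "nodal_interp T f \<in> P1 T" "p \<in> nodes T \<Longrightarrow> nodal_interp T f p = f p"
proof -
  have ex1: "\<exists>!w. w \<in> P1 T \<and> (\<forall>p\<in>nodes T. w p = f p)"
  proof (rule ex_ex1I)
    show "\<exists>w. w \<in> P1 T \<and> (\<forall>p\<in>nodes T. w p = f p)" by (rule P1_exists)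
    show "w = w'" if "w \<in> P1 T \<and> (\<forall>p\<in>nodes T. w p = f p)" "w' \<in> P1 T \<and> (\<forall>p\<in>nodes T. w' p = f p)"
      for w w' by (rule P1_eqI) (use that in auto)
  qed
  have "nodal_interp T f \<in> P1 T \<and> (\<forall>p\<in>nodes T. nodal_interp T f p = f p)"
    unfolding nodal_interp_def by (rule theI'[OF ex1])
  then show "nodal_interp T f \<in> P1 T" "p \<in> nodes T \<Longrightarrow> nodal_interp T f p = f p" by auto
qed

lemma hat_P1: "hat T p \<in> P1 T"
  and hat_node: "q \<in> nodes T \<Longrightarrow> hat T p q = (if q = p then 1 else 0)"
  by (simp_all add: hat_def nodal_interp)

lemma P1_sum:
  assumes "\<And>i. i \<in> I \<Longrightarrow> f i \<in> P1 T"
  shows "(\<lambda>x. \<Sum>i\<in>I. k i * f i x) \<in> P1 T"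
proof -
  have "\<exists>b c. \<forall>x\<in>S. (\<Sum>i\<in>I. k i * f i x) = inner b x + c" if S: "S \<in> T" for S
  proof -
    have "\<forall>i\<in>I. \<exists>b c. \<forall>x\<in>S. f i x = inner b x + c" using assms P1_affine S by blast
    from bchoice[OF this] obtain b where "\<forall>i\<in>I. \<exists>c. \<forall>x\<in>S. f i x = inner (b i) x + c" by blast
    from bchoice[OF this] obtain c where bc: "\<forall>i\<in>I. \<forall>x\<in>S. f i x = inner (b i) x + c i" by blast
    have "(\<Sum>i\<in>I. k i * f i x) = inner (\<Sum>i\<in>I. k i *\<^sub>R b i) x + (\<Sum>i\<in>I. k i * c i)" if "x \<in> S" for x
      using bc that by (simp add: inner_sum_left sum.distrib algebra_simps)
    then show ?thesis by blast
  qed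
  moreover have "continuous_on (\<Union>T) (\<lambda>x. \<Sum>i\<in>I. k i * f i x)"
    using assms by (intro continuous_intros) (simp add: P1_def)
  ultimately show ?thesis using assms by (simp add: P1_def)
qed

lemma P1_nodal_expansion:
  assumes "v \<in> P1 T"
  shows "v = (\<lambda>x. \<Sum>p\<in>nodes T. v p * hat T p x)"
proof (rule P1_eqI[OF assms P1_sum[OF hat_P1]])
  fix q assume q: "q \<in> nodes T"
  then have "(\<Sum>p\<in>nodes T. v p * hat T p q) = (\<Sum>p\<in>nodes T. if p = q then v p else 0)"
    by (intro sum.cong) (auto simp: hat_node)
  then show "v q = (\<Sum>p\<in>nodes T. v p * hat T p q)" using q finite_nodes by simp
qed

lemma hat_zero:
  assumes p: "p \<in> nodes T" and S: "S \<in> T" "x \<in> S" "p \<notin> S"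
  shows "hat T p x = 0"
proof -
  obtain b c where bc: "\<And>y. y \<in> S \<Longrightarrow> hat T p y = inner b y + c" using P1_affine[OF hat_P1 S(1)] by blast
  have "inner b x + c = inner 0 x + 0"
  proof (rule affine_eq_on_convex_hull)
    show "x \<in> convex hull (verts S)" using simplex_hull(3) S by blast
    fix q assume "q \<in> (verts S)"
    then have "q \<in> nodes T" "q \<in> S" using extreme_node S by auto
    then show "inner b q + c = inner 0 q + 0" using bc[of q] hat_node[of q p] S(3) by (cases "q = p") auto
  qed
  then show ?thesis using bc S by simp
qed

lemma hat_nonneg:
  assumes p: "p \<in> nodes T"
  shows "0 \<le> hat T p x"
proof (cases "x \<in> \<Union>T")
  case False
  then show ?thesis using P1_outside[OF hat_P1, of x p] by simp
next
  case True
  then obtain S where S: "S \<in> T" "x \<in> S" by blast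
  obtain b c where bc: "\<And>y. y \<in> S \<Longrightarrow> hat T p y = inner b y + c" using P1_affine[OF hat_P1 S(1)] by blast
  have "convex {y. inner b y \<ge> - c}" by (rule convex_halfspace_ge)
  moreover have "(verts S) \<subseteq> {y. inner b y \<ge> - c}"
  proof
    fix q assume "q \<in> (verts S)"
    then have "q \<in> nodes T" "q \<in> S" using extreme_node S by auto
    then show "q \<in> {y. inner b y \<ge> - c}" using bc[of q] hat_node[of q p] by (auto split: if_splits)
  qed
  ultimately have "convex hull (verts S) \<subseteq> {y. inner b y \<ge> - c}"
    by (rule hull_minimal[rotated])
  then have "inner b x \<ge> - c" using simplex_hull(3)[OF S(1)] S(2) by blast
  then show ?thesis using bc S by simp
qed

text \<open>A homothety centred at the node p moves a neighbourhood of x into a ball around p that is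
  covered by T'; a point near x can only leave a simplex of T' at p through the facet opposite
  to p, where the hat function vanishes.\<close>

lemma hat_support:
  assumes T': "T' \<subseteq> T" and p: "p \<in> nodes T" "p \<in> interior (\<Union>T')"
    and x: "x \<notin> interior (\<Union>T')"
  shows "hat T p x = 0"
proof (rule ccontr)
  assume "hat T p x \<noteq> 0"
  then have pos: "0 < hat T p x" using hat_nonneg[OF p(1), of x] by simp
  then obtain S where S: "S \<in> T" "x \<in> S" using P1_outside[OF hat_P1, of x p] by auto
  have pS: "p \<in> S" using hat_zero[OF p(1) S] pos by auto
  obtain b c where bc: "\<And>y. y \<in> S \<Longrightarrow> hat T p y = inner b y + c" using P1_affine[OF hat_P1 S(1)] by blast
  obtain \<epsilon> where \<epsilon>: "\<epsilon> > 0" "ball p \<epsilon> \<subseteq> \<Union>T'" using p(2) by (auto simp: mem_interior)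
  \<comment> \<open>Small enough for \<open>h x\<close> to land in the ball around p; the minimum
    with 1 keeps \<open>h x\<close> on the segment from p to x, hence in S.\<close>
  define t where "t = min 1 (\<epsilon> / (2 * (1 + norm (x - p))))"
  have np: "0 < 1 + norm (x - p)" by (simp add: add_pos_nonneg)
  have t: "0 < t" "t \<le> 1" using \<epsilon>(1) np by (auto simp: t_def)
  have "t * norm (x - p) \<le> \<epsilon> / (2 * (1 + norm (x - p))) * norm (x - p)"
    by (rule mult_right_mono) (auto simp: t_def)
  also have "\<dots> < \<epsilon>"
  proof -
    have "norm (x - p) < 2 * (1 + norm (x - p))" using norm_ge_zero[of "x - p"] unfolding distrib_left by linarith
    then have "\<epsilon> * norm (x - p) < \<epsilon> * (2 * (1 + norm (x - p)))"
      using \<epsilon>(1) by (rule mult_strict_left_mono)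
    then show ?thesis using np by (simp add: divide_simps)
  qed
  finally have tx: "t * norm (x - p) < \<epsilon>" .
  define h where "h z = p + t *\<^sub>R (z - p)" for z
  have h_cont: "isCont h z" for z unfolding h_def by (intro continuous_intros)
  have h_affine: "inner d (h y) + e = (1 - t) * (inner d p + e) + t * (inner d y + e)" for d e y
    by (simp add: h_def inner_simps algebra_simps)
  have hx: "h x \<in> ball p \<epsilon>" using tx t by (simp add: h_def dist_norm)
  have hxS: "h x \<in> S"
  proof -
    have "h x = (1 - t) *\<^sub>R p + t *\<^sub>R x" by (simp add: h_def algebra_simps)
    then show ?thesis using convexD[OF simplex_convex[OF S(1)] pS S(2), of "1 - t" t] t by simp
  qed
  have "eventually (\<lambda>z. h z \<in> ball p \<epsilon>) (nhds x)"
    using h_cont[of x] hx by (intro topological_tendstoD[where f = h]) (auto simp: isCont_def tendsto_at_iff_tendsto_nhds)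
  moreover have "eventually (\<lambda>z. \<forall>S'\<in>T'. h z \<in> S' \<longrightarrow> z \<in> S') (nhds x)"
  proof (rule eventually_ball_finite)
    show "finite T'" using T' finite_T finite_subset by blast
    show "\<forall>S'\<in>T'. eventually (\<lambda>z. h z \<in> S' \<longrightarrow> z \<in> S') (nhds x)"
    proof
      fix S' assume "S' \<in> T'"
      then have S': "S' \<in> T" using T' by blast
      show "eventually (\<lambda>z. h z \<in> S' \<longrightarrow> z \<in> S') (nhds x)"
      proof (cases "h x \<in> S'")
        case False
        then have "eventually (\<lambda>z. h z \<in> - S') (nhds x)"
          using h_cont[of x] simplex_closed[OF S']
          by (intro topological_tendstoD[where f = h]) (auto simp: isCont_def tendsto_at_iff_tendsto_nhds)
        then show ?thesis by eventually_elim auto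
      next
        case True
        obtain b' c' where bc': "\<And>y. y \<in> S' \<Longrightarrow> hat T p y = inner b' y + c'"
          using P1_affine[OF hat_P1 S'] by blast
        have pS': "p \<in> S'"
        proof (rule ccontr)
          assume "p \<notin> S'"
          then have "hat T p (h x) = 0" using hat_zero[OF p(1) S' True] by blast
          moreover have "hat T p (h x) = (1 - t) * hat T p p + t * hat T p x"
            using bc[OF hxS] bc[OF pS] bc[OF S(2)] by (simp add: h_def inner_simps algebra_simps)
          ultimately show False using t pos hat_node[OF p(1), of p] mult_pos_pos[OF t(1) pos] by simp
        qed
        \<comment> \<open>x is not known to lie in S'. The affine pieces on S and S' agree at p and
          at \<open>h x\<close>, hence along the whole line through these points, which contains
          x.\<close>
        have "inner b' x + c' = hat T p x"
        proof -
          have "inner b (h x) + c = inner b' (h x) + c'" using bc[OF hxS] bc'[OF True] by simp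
          moreover have "inner b p + c = inner b' p + c'" using bc[OF pS] bc'[OF pS'] by simp
          ultimately have "t * (inner b x + c) = t * (inner b' x + c')"
            by (simp add: h_affine)
          then show ?thesis using t bc[OF S(2)] by simp
        qed
        then have "eventually (\<lambda>z. inner b' z + c' > 0) (nhds x)"
          using pos by (intro order_tendstoD(1)[where y = "hat T p x"])
            (auto intro!: tendsto_eq_intros simp: filterlim_ident)
        then show ?thesis
        proof eventually_elim
          case (elim z)
          show ?case
          proof
            assume "h z \<in> S'"
            let ?E = "(verts S')"
            note E = simplex_hull[OF S']
            have pE: "p \<in> ?E" using node_extreme p S' pS' by blast
            have "h z \<in> convex hull ?E" using E(3) \<open>h z \<in> S'\<close> by blast
            then obtain l where l: "\<And>q. q \<in> ?E \<Longrightarrow> 0 \<le> l q" "sum l ?E = 1" "(\<Sum>q\<in>?E. l q *\<^sub>R q) = h z"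
              by (auto simp: convex_hull_finite[OF E(2)])
            have hat_hz: "inner b' (h z) + c' = l p"
            proof -
              have "inner b' (h z) + c' = (\<Sum>q\<in>?E. l q * (inner b' q + c'))"
                using l(2) by (simp add: l(3)[symmetric] inner_sum_right sum.distrib algebra_simps flip: sum_distrib_left)
              also have "\<dots> = (\<Sum>q\<in>?E. if q = p then l q else 0)"
              proof (rule sum.cong[OF refl])
                fix q assume "q \<in> ?E"
                then have "q \<in> nodes T" "q \<in> S'" using extreme_node S' by auto
                then show "l q * (inner b' q + c') = (if q = p then l q else 0)"
                  using bc'[of q] hat_node[of q p] by (auto split: if_splits)
              qed
              finally show ?thesis using pE E(2) by simp
            qed
            \<comment> \<open>Barycentric coordinates of z in S', obtained by inverting the
              homothety: those of \<open>h z\<close> are divided by t and the deficit goes to p.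
              Only the weight at p could be negative, and it equals the affine piece of the hat at
              z, which is positive near x.\<close>
            define m where "m q = l q / t + (if q = p then 1 - 1 / t else 0)" for q
            have bp: "inner b' p + c' = 1" using bc'[OF pS'] hat_node[OF p(1), of p] by simp
            have "m p = inner b' z + c'"
            proof -
              have "l p = (inner b' p + c') + t * ((inner b' z + c') - (inner b' p + c'))"
                using hat_hz by (simp add: h_def inner_simps algebra_simps)
              then have "l p = 1 + t * ((inner b' z + c') - 1)" using bp by simp
              then show ?thesis using t by (simp add: m_def field_simps)
            qed
            then have m0: "0 \<le> m q" if "q \<in> ?E" for q
              using l(1)[OF that] elim t by (cases "q = p") (auto simp: m_def)
            have m1: "sum m ?E = 1"
              unfolding m_def using E(2) pE l(2) by (simp add: sum.distrib sum_divide_distrib[symmetric])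
            have "(\<Sum>q\<in>?E. m q *\<^sub>R q) = (1 / t) *\<^sub>R (\<Sum>q\<in>?E. l q *\<^sub>R q) + (\<Sum>q\<in>?E. if q = p then (1 - 1 / t) *\<^sub>R p else 0)"
              unfolding m_def
              by (auto simp: scaleR_add_left sum.distrib scaleR_sum_right intro!: sum.cong)
            also have "\<dots> = (1 / t) *\<^sub>R h z + (1 - 1 / t) *\<^sub>R p"
              using E(2) pE l(3) by simp
            also have "\<dots> = z" using t by (simp add: h_def algebra_simps)
            finally have "z \<in> convex hull ?E"
              using m0 m1 unfolding convex_hull_finite[OF E(2)] by blast
            then show "z \<in> S'" using E(3) by blast
          qed
        qed
      qed
    qed
  qed
  ultimately have "eventually (\<lambda>z. z \<in> \<Union>T') (nhds x)"
  proof eventually_elim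
    case (elim z)
    then show ?case using \<epsilon>(2) by blast
  qed
  then have "x \<in> interior (\<Union>T')" by (auto simp: eventually_nhds interior_def)
  with x show False by blast
qed

text \<open>By the nodal expansion and \<open>hat_support\<close>, nodal values alone decide where a
  function vanishes. This serves both the boundary condition on the whole domain and the local
  spaces on the subdomains.\<close>

lemma P1_vanish:
  assumes T': "T' \<subseteq> T" and v: "v \<in> P1 T"
    and zero: "\<And>p. p \<in> nodes T \<Longrightarrow> p \<notin> interior (\<Union>T') \<Longrightarrow> v p = 0"
    and x: "x \<notin> interior (\<Union>T')"
  shows "v x = 0"
proof -
  have "v x = (\<Sum>p\<in>nodes T. v p * hat T p x)" by (rule fun_cong[OF P1_nodal_expansion[OF v]])
  also have "\<dots> = 0"
    by (intro sum.neutral) (metis hat_support[OF T' _ _ x] mult_eq_0_iff zero)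
  finally show ?thesis .
qed

lemma P1_zero_iff: "v \<in> P1_zero T \<longleftrightarrow> v \<in> P1 T \<and> (\<forall>p\<in>nodes T. p \<notin> interior (\<Union>T) \<longrightarrow> v p = 0)"
proof
  assume v: "v \<in> P1_zero T"
  have "p \<in> frontier (\<Union>T)" if "p \<in> nodes T" "p \<notin> interior (\<Union>T)" for p
    using that closure_subset[of "\<Union>T"] by (auto simp: frontier_def nodes_def extreme_point_of_def)
  then show "v \<in> P1 T \<and> (\<forall>p\<in>nodes T. p \<notin> interior (\<Union>T) \<longrightarrow> v p = 0)"
    using v by (auto simp: P1_zero_def)
next
  assume v: "v \<in> P1 T \<and> (\<forall>p\<in>nodes T. p \<notin> interior (\<Union>T) \<longrightarrow> v p = 0)"
  then have "v x = 0" if "x \<in> frontier (\<Union>T)" for x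
    using that P1_vanish[OF order_refl, of v x] by (auto simp: frontier_def)
  then show "v \<in> P1_zero T" using v by (auto simp: P1_zero_def)
qed

lemma P1_zero_outside: "v \<in> P1_zero T \<Longrightarrow> x \<notin> interior (\<Union>T) \<Longrightarrow> v x = 0"
  using P1_vanish[OF order_refl, of v x] by (auto simp: P1_zero_iff)

lemma P1_zero_sum: "(\<And>i. i \<in> I \<Longrightarrow> f i \<in> P1_zero T) \<Longrightarrow> (\<lambda>x. \<Sum>i\<in>I. k i * f i x) \<in> P1_zero T"
  using P1_sum[of I f k] by (auto simp: P1_zero_def)

lemma hat_P1_zero: "p \<in> interior (\<Union>T) \<Longrightarrow> hat T p \<in> P1_zero T"
  using hat_P1 hat_node by (auto simp: P1_zero_iff)

lemma P1_zero_continuous: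
  assumes "v \<in> P1_zero T"
  shows "continuous_on UNIV v"
proof -
  have "continuous_on (\<Union>T \<union> - interior (\<Union>T)) v"
  proof (rule continuous_on_closed_Un)
    show "closed (\<Union>T)" using compact_Union by (simp add: compact_imp_closed)
    show "continuous_on (\<Union>T) v" using assms by (simp add: P1_zero_def P1_def)
    have "continuous_on (- interior (\<Union>T)) (\<lambda>x. 0::real)" by simp
    then show "continuous_on (- interior (\<Union>T)) v"
      by (rule continuous_on_eq) (use P1_zero_outside[OF assms] in auto)
  qed auto
  moreover have "\<Union>T \<union> - interior (\<Union>T) = UNIV" using interior_subset by auto
  ultimately show ?thesis by simp
qed

end

section \<open>Forms on piecewise smooth functions\<close>

lemma grad_eqI:
  assumes "GDERIV u x :> D"
  shows "grad u x = D"
proof -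
  have "GDERIV u x :> grad u x" unfolding grad_def by (rule someI[of _ D]) (rule assms)
  then have "(\<lambda>h. inner h (grad u x)) = (\<lambda>h. inner h D)"
    using assms unfolding gderiv_def by (rule has_derivative_unique)
  then have "inner (grad u x - D) (grad u x) = inner (grad u x - D) D" by (rule fun_cong)
  then have "inner (grad u x - D) (grad u x - D) = 0" by (simp add: inner_diff_right)
  then show ?thesis by simp
qed

lemma GDERIV_local_affine:
  assumes "open U" "x \<in> U" "\<And>y. y \<in> U \<Longrightarrow> u y = inner b y + c"
  shows "GDERIV u x :> b"
proof -
  have "((\<lambda>y. inner b y + c) has_derivative (\<lambda>h. inner h b)) (at x)"
    by (auto intro!: derivative_eq_intros simp: inner_commute)
  then show ?thesis
    unfolding gderiv_def
    by (rule has_derivative_transform_within_open[OF _ assms(1,2)]) (use assms(3) in simp)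
qed

section \<open>Essentially bounded and piecewise smooth functions on the domain\<close>

locale mesh_measure = simplicial
begin

abbreviation \<Omega> :: "'a set" where "\<Omega> \<equiv> interior (\<Union>T)"
abbreviation M :: "'a measure" where "M \<equiv> lebesgue_on \<Omega>"

lemma bounded_\<Omega>: "bounded \<Omega>"
  using compact_Union[OF order_refl] by (simp add: bounded_interior compact_imp_bounded)

lemma \<Omega>_sets [simp]: "\<Omega> \<in> sets lebesgue"
  by simp

lemma finite_M: "finite_measure M"
  by (rule finite_measure_lebesgue_on) (simp add: lmeasurable_open bounded_\<Omega>)

lemma space_M [simp]: "space M = \<Omega>"
  by (simp add: space_restrict_space)

lemma AE_M_iff: "(AE x in M. Q x) \<longleftrightarrow> (AE x in lebesgue. x \<in> \<Omega> \<longrightarrow> Q x)"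
  by (rule AE_restrict_space_iff) simp

lemma AE_open_cells: "AE x in M. x \<in> open_cells"
proof -
  have "AE x in lebesgue. x \<notin> \<Union>T - open_cells"
    using negligible_skeleton by (intro AE_not_in) (simp add: negligible_iff_null_sets)
  then show ?thesis
    unfolding AE_M_iff by eventually_elim (use interior_subset in blast)
qed

text \<open>\<open>grad\<close> is arbitrary on the skeleton. Completeness of Lebesgue measure makes
  every subset of that null set measurable, so such values do no harm.\<close>

lemma measurable_open_cells_cong:
  fixes f g :: "'a \<Rightarrow> 'b::euclidean_space"
  assumes f: "f \<in> borel_measurable M" and eq: "\<And>x. x \<in> open_cells \<Longrightarrow> g x = f x"
  shows "g \<in> borel_measurable M"
proof (rule measurableI)
  fix A :: "'b set" assume A: "A \<in> sets borel"
  have "f -` A \<inter> \<Omega> \<in> sets lebesgue"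
    using measurable_sets[OF f A] by (simp add: sets_restrict_space_iff)
  moreover have "open_cells \<in> sets lebesgue" using open_open_cells by simp
  ultimately have 1: "(f -` A \<inter> \<Omega>) \<inter> open_cells \<in> sets lebesgue" by (rule sets.Int)
  have "negligible (g -` A \<inter> \<Omega> - open_cells)"
    by (rule negligible_subset[OF negligible_skeleton]) (use interior_subset in auto)
  then have 2: "g -` A \<inter> \<Omega> - open_cells \<in> sets lebesgue"
    by (rule negligible_imp_sets)
  have "g -` A \<inter> \<Omega> = ((f -` A \<inter> \<Omega>) \<inter> open_cells) \<union> (g -` A \<inter> \<Omega> - open_cells)"
    using eq by auto
  then have "g -` A \<inter> \<Omega> \<in> sets lebesgue" using sets.Un[OF 1 2] by simp
  then show "g -` A \<inter> space M \<in> sets M" by (simp add: sets_restrict_space_iff)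
qed simp

text \<open>A class closed under the algebraic operations and, since the domain has finite measure,
  contained in the integrable functions: integrability side conditions reduce to closure
  rules.\<close>

definition ess_bdd :: "('a \<Rightarrow> 'b::euclidean_space) \<Rightarrow> bool" where
  "ess_bdd f \<longleftrightarrow> f \<in> borel_measurable M \<and> (\<exists>B. AE x in M. norm (f x) \<le> B)"

lemma ess_bddI: "f \<in> borel_measurable M \<Longrightarrow> (AE x in M. norm (f x) \<le> B) \<Longrightarrow> ess_bdd f"
  by (auto simp: ess_bdd_def)

lemma ess_bdd_integrable: "ess_bdd f \<Longrightarrow> integrable M f"
  using finite_measure.integrable_const_bound[OF finite_M] by (auto simp: ess_bdd_def)

lemma ess_bdd_const: "ess_bdd (\<lambda>_. c)"
  by (auto simp: ess_bdd_def)

lemma ess_bdd_add: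
  assumes "ess_bdd f" "ess_bdd g"
  shows "ess_bdd (\<lambda>x. f x + g x)"
proof -
  obtain B B' where "AE x in M. norm (f x) \<le> B" "AE x in M. norm (g x) \<le> B'"
    using assms by (auto simp: ess_bdd_def)
  then have "AE x in M. norm (f x + g x) \<le> B + B'"
    by eventually_elim (rule norm_triangle_le, simp)
  then show ?thesis using assms by (auto simp: ess_bdd_def)
qed

lemma ess_bdd_scaleR:
  fixes f :: "'a \<Rightarrow> real" and g :: "'a \<Rightarrow> 'b::euclidean_space"
  assumes "ess_bdd f" "ess_bdd g"
  shows "ess_bdd (\<lambda>x. f x *\<^sub>R g x)"
proof -
  obtain B B' where "AE x in M. norm (f x) \<le> B" "AE x in M. norm (g x) \<le> B'"
    using assms by (auto simp: ess_bdd_def)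
  then have "AE x in M. norm (f x *\<^sub>R g x) \<le> \<bar>B\<bar> * \<bar>B'\<bar>"
    by eventually_elim (auto intro!: mult_mono)
  then show ?thesis using assms by (auto simp: ess_bdd_def)
qed

lemma ess_bdd_mult:
  fixes f g :: "'a \<Rightarrow> real"
  shows "ess_bdd f \<Longrightarrow> ess_bdd g \<Longrightarrow> ess_bdd (\<lambda>x. f x * g x)"
  using ess_bdd_scaleR[of f g] by simp

lemma ess_bdd_inner:
  assumes "ess_bdd f" "ess_bdd g"
  shows "ess_bdd (\<lambda>x. inner (f x) (g x))"
proof -
  obtain B B' where "AE x in M. norm (f x) \<le> B" "AE x in M. norm (g x) \<le> B'"
    using assms by (auto simp: ess_bdd_def)
  then have "AE x in M. norm (inner (f x) (g x)) \<le> \<bar>B\<bar> * \<bar>B'\<bar>"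
  proof eventually_elim
    case (elim x)
    have "norm (inner (f x) (g x)) \<le> norm (f x) * norm (g x)" by (simp add: Cauchy_Schwarz_ineq2)
    also have "\<dots> \<le> \<bar>B\<bar> * \<bar>B'\<bar>" using elim by (intro mult_mono) auto
    finally show ?case .
  qed
  then show ?thesis using assms by (auto simp: ess_bdd_def)
qed

lemma ess_bdd_diff:
  fixes f g :: "'a \<Rightarrow> 'b::euclidean_space"
  shows "ess_bdd f \<Longrightarrow> ess_bdd g \<Longrightarrow> ess_bdd (\<lambda>x. f x - g x)"
  using ess_bdd_add[OF _ ess_bdd_scaleR[OF ess_bdd_const[of "-1"]], of f g] by simp

lemma ess_bdd_norm2:
  fixes f :: "'a \<Rightarrow> 'b::euclidean_space"
  shows "ess_bdd f \<Longrightarrow> ess_bdd (\<lambda>x. (norm (f x))\<^sup>2)"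
  unfolding power2_norm_eq_inner by (rule ess_bdd_inner)

lemma ess_bdd_sum:
  "(\<And>i. i \<in> I \<Longrightarrow> ess_bdd (f i)) \<Longrightarrow> ess_bdd (\<lambda>x. \<Sum>i\<in>I. f i x)"
  by (induction I rule: infinite_finite_induct) (auto intro: ess_bdd_add ess_bdd_const)

lemma ess_bdd_indicator: "D \<in> sets lebesgue \<Longrightarrow> ess_bdd (indicat_real D)"
  by (rule ess_bddI[where B = 1])
    (auto simp: indicator_def intro!: borel_measurable_indicator' measurable_restrict_space1)

lemmas ess_bdd_intros = ess_bdd_const ess_bdd_add ess_bdd_diff ess_bdd_scaleR ess_bdd_mult
  ess_bdd_inner ess_bdd_sum ess_bdd_norm2

text \<open>Moves integrals over cells to the fixed measure M. Both sides unfold to the same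
  integral over the whole space, so the identity also covers nonintegrable f.\<close>

lemma integral_sub:
  fixes f :: "'a \<Rightarrow> real"
  assumes "D \<in> sets lebesgue" "D \<subseteq> \<Omega>"
  shows "(LINT x|lebesgue_on D. f x) = (LINT x|M. indicat_real D x * f x)"
proof -
  have "(LINT x|M. indicat_real D x * f x) = (LINT x|lebesgue. indicator \<Omega> x *\<^sub>R (indicat_real D x * f x))"
    by (rule integral_restrict_space) simp
  also have "\<dots> = (LINT x|lebesgue. indicator D x *\<^sub>R f x)"
    by (rule Bochner_Integration.integral_cong) (use assms(2) in \<open>auto simp: indicator_def\<close>)
  also have "\<dots> = (LINT x|lebesgue_on D. f x)"
    by (rule integral_restrict_space[symmetric]) (use assms in simp)
  finally show ?thesis by simp
qed

text \<open>Wide enough for the products of finite element functions with the partition of unity,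
  which are no longer piecewise affine.\<close>

definition pw_smooth :: "('a \<Rightarrow> real) \<Rightarrow> bool" where
  "pw_smooth u \<longleftrightarrow> ess_bdd u \<and> ess_bdd (grad u) \<and> (\<forall>x\<in>open_cells. GDERIV u x :> grad u x)"

lemma pw_smoothD: "pw_smooth u \<Longrightarrow> ess_bdd u" "pw_smooth u \<Longrightarrow> ess_bdd (grad u)"
  "pw_smooth u \<Longrightarrow> x \<in> open_cells \<Longrightarrow> GDERIV u x :> grad u x"
  by (auto simp: pw_smooth_def)

lemma pw_smoothI:
  assumes u: "ess_bdd u" and g: "ess_bdd g" and D: "\<And>x. x \<in> open_cells \<Longrightarrow> GDERIV u x :> g x"
  shows "pw_smooth u" "\<And>x. x \<in> open_cells \<Longrightarrow> grad u x = g x"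
proof -
  show eq: "grad u x = g x" if "x \<in> open_cells" for x using grad_eqI[OF D[OF that]] .
  obtain B where "AE x in M. norm (g x) \<le> B" using g by (auto simp: ess_bdd_def)
  then have "AE x in M. norm (grad u x) \<le> B"
    using AE_open_cells by eventually_elim (simp add: eq)
  moreover have "grad u \<in> borel_measurable M"
    by (rule measurable_open_cells_cong[of g]) (use g eq in \<open>simp_all add: ess_bdd_def\<close>)
  ultimately have "ess_bdd (grad u)" by (rule ess_bddI[rotated])
  then show "pw_smooth u" unfolding pw_smooth_def using u D eq by simp
qed

lemma pw_smooth_mult:
  assumes "pw_smooth u" "pw_smooth v"
  shows "pw_smooth (\<lambda>x. u x * v x)"
    "\<And>x. x \<in> open_cells \<Longrightarrow> grad (\<lambda>x. u x * v x) x = u x *\<^sub>R grad v x + v x *\<^sub>R grad u x"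
proof -
  let ?g = "\<lambda>x. u x *\<^sub>R grad v x + v x *\<^sub>R grad u x"
  have 1: "ess_bdd (\<lambda>x. u x * v x)" by (intro ess_bdd_mult pw_smoothD(1) assms)
  have 2: "ess_bdd ?g" by (intro ess_bdd_intros pw_smoothD(1,2) assms)
  have 3: "GDERIV (\<lambda>x. u x * v x) x :> ?g x" if "x \<in> open_cells" for x
    by (intro GDERIV_mult pw_smoothD(3) assms that)
  show "pw_smooth (\<lambda>x. u x * v x)" by (rule pw_smoothI(1)[OF 1 2 3])
  show "grad (\<lambda>x. u x * v x) x = ?g x" if "x \<in> open_cells" for x
    by (rule pw_smoothI(2)[OF 1 2 3 that])
qed

lemma pw_smooth_sum:
  assumes "\<And>i. i \<in> I \<Longrightarrow> pw_smooth (f i)"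
  shows "pw_smooth (\<lambda>x. \<Sum>i\<in>I. k i * f i x)"
    "\<And>x. x \<in> open_cells \<Longrightarrow> grad (\<lambda>x. \<Sum>i\<in>I. k i * f i x) x = (\<Sum>i\<in>I. k i *\<^sub>R grad (f i) x)"
proof -
  have D: "GDERIV (\<lambda>x. \<Sum>i\<in>I. k i * f i x) x :> (\<Sum>i\<in>I. k i *\<^sub>R grad (f i) x)" if x: "x \<in> open_cells" for x
  proof -
    have "((\<lambda>x. \<Sum>i\<in>I. k i * f i x) has_derivative (\<lambda>h. \<Sum>i\<in>I. k i * inner h (grad (f i) x))) (at x)"
      using pw_smoothD(3)[OF assms x] unfolding gderiv_def
      by (intro has_derivative_sum has_derivative_mult_right) auto
    then show ?thesis by (simp add: gderiv_def inner_sum_right)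
  qed
  have B: "ess_bdd (\<lambda>x. \<Sum>i\<in>I. k i * f i x)" "ess_bdd (\<lambda>x. \<Sum>i\<in>I. k i *\<^sub>R grad (f i) x)"
    by (intro ess_bdd_intros pw_smoothD(1,2) assms; assumption)+
  show "pw_smooth (\<lambda>x. \<Sum>i\<in>I. k i * f i x)" by (rule pw_smoothI(1)[OF B D])
  show "grad (\<lambda>x. \<Sum>i\<in>I. k i * f i x) x = (\<Sum>i\<in>I. k i *\<^sub>R grad (f i) x)" if "x \<in> open_cells" for x
    by (rule pw_smoothI(2)[OF B D that])
qed

lemma P1_GDERIV:
  assumes "S \<in> T" "x \<in> interior S" "\<And>y. y \<in> S \<Longrightarrow> u y = inner b y + c"
  shows "GDERIV u x :> b"
  by (rule GDERIV_local_affine[of "interior S"]) (use assms interior_subset in auto)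

lemma P1_pw_smooth:
  assumes u: "u \<in> P1 T"
  shows "pw_smooth u"
proof -
  obtain b c where bc: "\<forall>S\<in>T. \<forall>x\<in>S. u x = inner (b S) x + c S" using P1_pieces[OF u] by blast
  define g where "g x = (\<Sum>S\<in>T. indicat_real (interior S) x *\<^sub>R b S)" for x
  have g: "g x = b S" if "S \<in> T" "x \<in> interior S" for S x
  proof -
    have "indicat_real (interior S') x *\<^sub>R b S' = (if S' = S then b S' else 0)" if "S' \<in> T" for S'
    proof (cases "x \<in> interior S'")
      case True
      then have "S' = S"
        using interior_unique[OF \<open>S' \<in> T\<close> \<open>S \<in> T\<close>, of x] \<open>x \<in> interior S\<close> interior_subset by blast
      then show ?thesis using True by simp
    next
      case False
      then show ?thesis using \<open>x \<in> interior S\<close> by auto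
    qed
    then have "g x = (\<Sum>S'\<in>T. if S' = S then b S' else 0)"
      unfolding g_def by (intro sum.cong) auto
    then show ?thesis using that finite_T by simp
  qed
  have "ess_bdd g"
    unfolding g_def by (intro ess_bdd_intros ess_bdd_indicator) simp
  moreover have "ess_bdd u"
  proof -
    have cont: "continuous_on (\<Union>T) u" using u by (simp add: P1_def)
    have "compact (u ` \<Union>T)" using cont compact_Union[OF order_refl] by (rule compact_continuous_image)
    then obtain B where B: "\<And>x. x \<in> \<Union>T \<Longrightarrow> norm (u x) \<le> B"
      using compact_imp_bounded bounded_iff by (metis imageI)
    have "u \<in> borel_measurable M"
      by (rule continuous_imp_measurable_on_sets_lebesgue) (auto intro: continuous_on_subset[OF cont interior_subset])
    moreover have "AE x in M. norm (u x) \<le> B"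
      using B subsetD[OF interior_subset, of _ "\<Union>T"] by (intro AE_I2) simp
    ultimately show ?thesis by (rule ess_bddI)
  qed
  moreover have "GDERIV u x :> g x" if "x \<in> open_cells" for x
  proof -
    obtain S where S: "S \<in> T" "x \<in> interior S" using \<open>x \<in> open_cells\<close> by (auto simp: open_cells_def)
    have "GDERIV u x :> b S" by (rule P1_GDERIV[OF S, of _ _ "c S"]) (use bc S in simp)
    then show ?thesis using g[OF S] by simp
  qed
  ultimately show ?thesis by (intro pw_smoothI(1)[of u g])
qed

lemma P1_zero_pw_smooth: "u \<in> P1_zero T \<Longrightarrow> pw_smooth u"
  by (auto simp: P1_zero_def intro: P1_pw_smooth)

lemma P1_grad_zero:
  assumes "u \<in> P1 T" "S \<in> T" "x \<in> interior S" "\<And>y. y \<in> interior S \<Longrightarrow> u y = 0"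
  shows "grad u x = 0"
  by (rule grad_eqI, rule GDERIV_local_affine[of "interior S" _ _ _ 0]) (use assms in auto)

end

section \<open>Forms weighted by the coefficient\<close>

locale weighted_mesh = mesh_measure +
  fixes \<kappa> :: "'a \<Rightarrow> real" and k0 k1 :: real
  assumes \<kappa>_measurable: "\<kappa> \<in> borel_measurable (lebesgue_on (interior (\<Union>T)))"
    and k0: "0 < k0"
    and \<kappa>_bounds: "AE x in lebesgue_on (interior (\<Union>T)). k0 \<le> \<kappa> x \<and> \<kappa> x \<le> k1"
begin

text \<open>The upper bound k1 enters here, for integrability; the estimates below are expressed
  through k0.\<close>

lemma ess_bdd_\<kappa>: "ess_bdd \<kappa>"
proof (rule ess_bddI[OF \<kappa>_measurable])
  show "AE x in M. norm (\<kappa> x) \<le> k1"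
    using \<kappa>_bounds by eventually_elim (use k0 in simp)
qed

lemma AE_\<kappa>: "AE x in M. k0 \<le> \<kappa> x"
  using \<kappa>_bounds by eventually_elim simp

lemma AE_\<kappa>_nonneg: "AE x in M. 0 \<le> \<kappa> x"
  using AE_\<kappa> by eventually_elim (use k0 in simp)

lemma weighted_integrable: "ess_bdd f \<Longrightarrow> integrable M (\<lambda>x. \<kappa> x * f x)"
  by (intro ess_bdd_integrable ess_bdd_mult ess_bdd_\<kappa>)

lemma weighted_mono:
  assumes "ess_bdd f" "ess_bdd g" "AE x in M. f x \<le> g x"
  shows "(LINT x|M. \<kappa> x * f x) \<le> (LINT x|M. \<kappa> x * g x)"
proof (rule integral_mono_AE)
  show "AE x in M. \<kappa> x * f x \<le> \<kappa> x * g x"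
    using assms(3) AE_\<kappa>_nonneg by eventually_elim (rule mult_left_mono)
qed (use assms weighted_integrable in auto)

lemma weighted_nonneg:
  assumes "AE x in M. 0 \<le> f x"
  shows "0 \<le> (LINT x|M. \<kappa> x * f x)"
  by (rule integral_nonneg_AE) (use assms AE_\<kappa>_nonneg in \<open>eventually_elim, simp\<close>)

lemma weighted_add:
  "ess_bdd f \<Longrightarrow> ess_bdd g \<Longrightarrow>
    (LINT x|M. \<kappa> x * (f x + g x)) = (LINT x|M. \<kappa> x * f x) + (LINT x|M. \<kappa> x * g x)"
  by (simp add: distrib_left weighted_integrable)

lemma weighted_scale: "(LINT x|M. \<kappa> x * (c * f x)) = c * (LINT x|M. \<kappa> x * f x)"
proof -
  have "(LINT x|M. \<kappa> x * (c * f x)) = (LINT x|M. c * (\<kappa> x * f x))"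
    by (rule Bochner_Integration.integral_cong) auto
  then show ?thesis by simp
qed

lemma weighted_sum:
  assumes "\<And>i. i \<in> I \<Longrightarrow> ess_bdd (f i)"
  shows "(LINT x|M. \<kappa> x * (\<Sum>i\<in>I. f i x)) = (\<Sum>i\<in>I. LINT x|M. \<kappa> x * f i x)"
  unfolding sum_distrib_left
  by (rule Bochner_Integration.integral_sum) (use assms weighted_integrable in auto)

abbreviation a :: "('a \<Rightarrow> real) \<Rightarrow> ('a \<Rightarrow> real) \<Rightarrow> real" where "a \<equiv> a_form \<kappa> \<Omega>"
abbreviation m :: "('a \<Rightarrow> real) \<Rightarrow> ('a \<Rightarrow> real) \<Rightarrow> real" where "m \<equiv> l2_form \<Omega>"

text \<open>The s-form freed of its factor H^{-2}, which keeps the mesh size out of the algebra of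
  the projection.\<close>

definition w :: "('a \<Rightarrow> real) \<Rightarrow> ('a \<Rightarrow> real) \<Rightarrow> real" where
  "w u v = (LINT x|M. \<kappa> x * (u x * v x))"

lemma s_form_eq: "s_form \<kappa> H \<Omega> u v = w u v / H\<^sup>2"
  by (simp add: s_form_def w_def mult.assoc)

lemma a_commute: "a u v = a v u"
  by (simp add: a_form_def inner_commute)

lemma m_commute: "m u v = m v u"
  by (simp add: l2_form_def mult.commute)

lemma w_commute: "w u v = w v u"
  by (simp add: w_def mult.commute)

lemma ess_bdd_grad_inner: "pw_smooth u \<Longrightarrow> pw_smooth v \<Longrightarrow> ess_bdd (\<lambda>x. inner (grad u x) (grad v x))"
  by (intro ess_bdd_inner pw_smoothD(2))

lemma a_sum:
  assumes "\<And>i. i \<in> I \<Longrightarrow> pw_smooth (f i)" "pw_smooth g"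
  shows "a (\<lambda>x. \<Sum>i\<in>I. k i * f i x) g = (\<Sum>i\<in>I. k i * a (f i) g)"
proof -
  let ?h = "\<lambda>i x. k i * inner (grad (f i) x) (grad g x)"
  have *: "ess_bdd (?h i)" if "i \<in> I" for i
    by (rule ess_bdd_mult[OF ess_bdd_const ess_bdd_grad_inner[OF assms(1)[OF that] assms(2)]])
  have "a (\<lambda>x. \<Sum>i\<in>I. k i * f i x) g = (LINT x|M. \<kappa> x * (\<Sum>i\<in>I. ?h i x))"
    unfolding a_form_def
  proof (rule integral_cong_AE)
    show "AE x in M. \<kappa> x * inner (grad (\<lambda>x. \<Sum>i\<in>I. k i * f i x) x) (grad g x) = \<kappa> x * (\<Sum>i\<in>I. ?h i x)"
      using AE_open_cells
    proof eventually_elim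
      case (elim x)
      then have "grad (\<lambda>x. \<Sum>i\<in>I. k i * f i x) x = (\<Sum>i\<in>I. k i *\<^sub>R grad (f i) x)"
        using assms(1) by (intro pw_smooth_sum(2))
      then show ?case by (simp add: inner_sum_left)
    qed
    show "(\<lambda>x. \<kappa> x * inner (grad (\<lambda>x. \<Sum>i\<in>I. k i * f i x) x) (grad g x)) \<in> borel_measurable M"
      by (intro borel_measurable_integrable weighted_integrable ess_bdd_grad_inner pw_smooth_sum(1) assms)
    show "(\<lambda>x. \<kappa> x * (\<Sum>i\<in>I. ?h i x)) \<in> borel_measurable M"
      by (intro borel_measurable_integrable weighted_integrable ess_bdd_sum *)
  qed
  also have "\<dots> = (\<Sum>i\<in>I. k i * a (f i) g)"
    unfolding a_form_def weighted_scale[symmetric] by (rule weighted_sum[OF *])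
  finally show ?thesis .
qed

lemma m_sum:
  assumes "\<And>i. i \<in> I \<Longrightarrow> ess_bdd (f i)" "ess_bdd g"
  shows "m (\<lambda>x. \<Sum>i\<in>I. k i * f i x) g = (\<Sum>i\<in>I. k i * m (f i) g)"
proof -
  have "m (\<lambda>x. \<Sum>i\<in>I. k i * f i x) g = (LINT x|M. (\<Sum>i\<in>I. k i * (f i x * g x)))"
    unfolding l2_form_def by (simp add: sum_distrib_right mult.assoc)
  also have "\<dots> = (\<Sum>i\<in>I. LINT x|M. k i * (f i x * g x))"
    by (rule Bochner_Integration.integral_sum)
      (intro ess_bdd_integrable ess_bdd_intros assms)
  finally show ?thesis by (simp add: l2_form_def)
qed

lemma w_sum:
  assumes "\<And>i. i \<in> I \<Longrightarrow> ess_bdd (f i)" "ess_bdd g"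
  shows "w (\<lambda>x. \<Sum>i\<in>I. k i * f i x) g = (\<Sum>i\<in>I. k i * w (f i) g)"
proof -
  have "w (\<lambda>x. \<Sum>i\<in>I. k i * f i x) g = (LINT x|M. \<kappa> x * (\<Sum>i\<in>I. k i * (f i x * g x)))"
    unfolding w_def by (simp add: sum_distrib_right mult.assoc)
  also have "\<dots> = (\<Sum>i\<in>I. LINT x|M. \<kappa> x * (k i * (f i x * g x)))"
    by (rule weighted_sum) (intro ess_bdd_intros assms)
  finally show ?thesis by (simp add: weighted_scale w_def)
qed

lemma a_nonneg: "0 \<le> a u u"
  unfolding a_form_def by (rule weighted_nonneg) simp

lemma w_nonneg: "0 \<le> w u u"
  unfolding w_def by (rule weighted_nonneg) simp

lemma m_nonneg: "0 \<le> m u u"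
  unfolding l2_form_def by (rule integral_nonneg_AE) simp

text \<open>Converts the weighted norm of the error and its pieces back into mass; the factor 1 /
  \<open>perm_min\<close> of the final constant originates here.\<close>

lemma m_le_w:
  assumes u: "ess_bdd u"
  shows "k0 * m u u \<le> w u u"
proof -
  have "k0 * m u u = (LINT x|M. k0 * (u x * u x))" by (simp add: l2_form_def)
  also have "\<dots> \<le> w u u"
    unfolding w_def
  proof (rule integral_mono_AE)
    show "AE x in M. k0 * (u x * u x) \<le> \<kappa> x * (u x * u x)"
      using AE_\<kappa> by eventually_elim (rule mult_right_mono, auto)
  qed (intro ess_bdd_integrable ess_bdd_intros ess_bdd_\<kappa> u)+
  finally show ?thesis .
qed

text \<open>Takes the place of a Friedrichs inequality. Vanishing energy makes u constant on every
  simplex, because a simplex has nonnull interior. So u has finite range, and a continuous function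
  with finite range on the connected whole space is constant; u vanishes outside the bounded
  domain.\<close>

lemma a_definite:
  assumes u: "u \<in> P1_zero T" and zero: "a u u = 0"
  shows "u x = 0"
proof -
  have u1: "u \<in> P1 T" using u by (simp add: P1_zero_def)
  note smooth = P1_zero_pw_smooth[OF u]
  have "AE x in M. \<kappa> x * inner (grad u x) (grad u x) = 0"
  proof (rule iffD1[OF integral_nonneg_eq_0_iff_AE])
    show "integrable M (\<lambda>x. \<kappa> x * inner (grad u x) (grad u x))"
      by (intro weighted_integrable ess_bdd_grad_inner smooth)
    show "AE x in M. 0 \<le> \<kappa> x * inner (grad u x) (grad u x)"
      using AE_\<kappa>_nonneg by eventually_elim simp
    show "(LINT x|M. \<kappa> x * inner (grad u x) (grad u x)) = 0"
      using zero by (simp add: a_form_def)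
  qed
  then have grad0: "AE x in M. grad u x = 0"
    using AE_\<kappa> by eventually_elim (use k0 in auto)
  have "\<exists>c. \<forall>y\<in>S. u y = c" if S: "S \<in> T" for S
  proof -
    obtain b c where bc: "\<And>y. y \<in> S \<Longrightarrow> u y = inner b y + c" using P1_affine[OF u1 S] by blast
    have "b = 0"
    proof (rule ccontr)
      assume "b \<noteq> 0"
      have "AE x in lebesgue. x \<in> \<Omega> \<longrightarrow> grad u x = 0" using grad0 by (simp add: AE_M_iff)
      then have "AE x in lebesgue. x \<notin> interior S"
      proof eventually_elim
        case (elim x)
        show ?case
        proof
          assume x: "x \<in> interior S"
          have "x \<in> \<Omega>" using x S open_cells_subset by (auto simp: open_cells_def)
          moreover have "grad u x = b" by (rule grad_eqI[OF P1_GDERIV[OF S x bc]])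
          ultimately show False using elim \<open>b \<noteq> 0\<close> by simp
        qed
      qed
      then have "interior S \<in> null_sets lebesgue"
        by (subst (asm) AE_iff_null_sets[symmetric]) auto
      then have "negligible (interior S)" by (simp add: negligible_iff_null_sets)
      then show False using open_not_negligible[OF open_interior simplex_interior[OF S]] by simp
    qed
    then show ?thesis using bc by (intro exI[of _ c]) simp
  qed
  then have "\<forall>S\<in>T. \<exists>c. \<forall>y\<in>S. u y = c" by blast
  from bchoice[OF this] obtain c where c: "\<forall>S\<in>T. \<forall>y\<in>S. u y = c S" by blast
  have "range u \<subseteq> insert 0 (c ` T)"
  proof
    fix r assume "r \<in> range u"
    then obtain y where y: "r = u y" by blast
    show "r \<in> insert 0 (c ` T)"
    proof (cases "y \<in> \<Union>T")
      case True
      then obtain S where "S \<in> T" "y \<in> S" by blast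
      then show ?thesis using c y by simp
    next
      case False
      then show ?thesis using P1_outside[OF u1] y by simp
    qed
  qed
  then have "finite (range u)" using finite_T finite_subset by blast
  then have "u constant_on UNIV"
    by (intro continuous_finite_range_constant connected_UNIV P1_zero_continuous[OF u])
  then obtain c' where c': "\<And>y. u y = c'" unfolding constant_on_def by auto
  obtain y where "y \<notin> \<Omega>" using bounded_\<Omega> not_bounded_UNIV by (metis UNIV_eq_I)
  then have "c' = 0" using P1_zero_outside[OF u, of y] c' by simp
  then show ?thesis using c' by simp
qed

end

section \<open>Weak gradients of finite element functions\<close>

lemma compact_continuous_norm_bound:
  fixes f :: "'a::topological_space \<Rightarrow> 'b::real_normed_vector"
  assumes "compact K" "continuous_on K f"
  obtains B where "\<And>x. x \<in> K \<Longrightarrow> norm (f x) \<le> B"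
  using compact_imp_bounded[OF compact_continuous_image[OF assms(2,1)]] by (auto simp: bounded_iff)

lemma GDERIV_difference_quotient:
  assumes D: "GDERIV F x :> D" and t: "t \<longlonglongrightarrow> 0" "\<And>n. t n \<noteq> 0"
  shows "(\<lambda>n. (F (x + t n *\<^sub>R b) - F x) / t n) \<longlonglongrightarrow> inner b D"
proof -
  let ?\<gamma> = "\<lambda>s. x + s *\<^sub>R b"
  have "(?\<gamma> has_derivative (\<lambda>s. s *\<^sub>R b)) (at 0)" by (auto intro!: derivative_eq_intros)
  moreover have "(F has_derivative (\<lambda>h. inner h D)) (at (?\<gamma> 0))"
    using D by (simp add: gderiv_def)
  ultimately have "((\<lambda>s. F (?\<gamma> s)) has_derivative (\<lambda>s. inner (s *\<^sub>R b) D)) (at 0)"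
    by (rule has_derivative_compose)
  moreover have "(\<lambda>s. inner (s *\<^sub>R b) D) = (*) (inner b D)" by (simp add: fun_eq_iff)
  ultimately have "((\<lambda>s. F (?\<gamma> s)) has_field_derivative inner b D) (at 0)"
    by (simp only: has_field_derivative_def)
  then have "((\<lambda>s. (F (?\<gamma> s) - F x) / s) \<longlongrightarrow> inner b D) (at 0)"
    by (simp add: DERIV_def)
  moreover have "filterlim t (at 0) sequentially"
    using t by (simp add: filterlim_at)
  ultimately show ?thesis by (rule filterlim_compose)
qed

text \<open>The integral of every difference quotient of F vanishes by translation invariance, and the
  quotients are dominated because F is Lipschitz.\<close>

lemma integral_directional_derivative:
  fixes F G :: "'a::euclidean_space \<Rightarrow> real"
  assumes lip: "\<And>x y. \<bar>F x - F y\<bar> \<le> L * norm (x - y)"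
    and supp: "\<And>x. r < norm x \<Longrightarrow> F x = 0"
    and G: "G \<in> borel_measurable lebesgue"
    and D: "AE x in lebesgue. \<exists>D. GDERIV F x :> D \<and> inner b D = G x"
  shows "(LINT x|lebesgue. G x) = 0"
proof -
  define t where "t n = 1 / real (Suc n)" for n
  have t: "t n \<noteq> 0" "0 < t n" "t n \<le> 1" for n by (auto simp: t_def field_simps)
  have t0: "t \<longlonglongrightarrow> 0" unfolding t_def by (rule LIMSEQ_Suc[OF lim_1_over_n])
  define s where "s n x = (F (x + t n *\<^sub>R b) - F x) / t n" for n x
  have L: "0 \<le> L * norm b" using lip[of b 0] by (simp add: order_trans[OF abs_ge_zero])
  have cont: "continuous_on UNIV F"
  proof -
    have "\<bar>L\<bar>-lipschitz_on UNIV F"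
    proof (rule lipschitz_onI)
      show "dist (F x) (F y) \<le> \<bar>L\<bar> * dist x y" for x y
        using order_trans[OF lip mult_right_mono[OF abs_ge_self norm_ge_zero]] by (simp add: dist_norm)
    qed simp
    then show ?thesis by (rule lipschitz_on_continuous_on)
  qed
  have Fb: "F \<in> borel_measurable borel" using cont by (rule borel_measurable_continuous_onI)
  have scont: "continuous_on UNIV (s n)" for n
    unfolding s_def using t(1)[of n]
    by (intro continuous_intros continuous_on_compose2[OF cont]) auto
  have sb: "s n \<in> borel_measurable borel" for n using scont by (rule borel_measurable_continuous_onI)
  \<comment> \<open>Since \<open>t n \<le> 1\<close>, a point and its translate both lie outside
    radius r as soon as the point lies outside radius \<open>r + norm b\<close>; inside, the
    Lipschitz bound dominates the quotient.\<close>
  let ?w = "\<lambda>x. indicat_real (cball 0 (r + norm b)) x * (L * norm b)"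
  have bound: "norm (s n x) \<le> ?w x" for n x
  proof (cases "x \<in> cball 0 (r + norm b)")
    case True
    have "\<bar>F (x + t n *\<^sub>R b) - F x\<bar> \<le> L * norm b * t n"
      using lip[of "x + t n *\<^sub>R b" x] t(2)[of n] by (simp add: mult_ac)
    then have "\<bar>s n x\<bar> \<le> L * norm b" using t(2)[of n] by (simp add: s_def field_simps)
    then show ?thesis using True by simp
  next
    case False
    then have "r + norm b < norm x" by simp
    moreover have "norm x \<le> norm (x + t n *\<^sub>R b) + norm b"
    proof -
      have "norm (t n *\<^sub>R b) \<le> norm b" using t(2,3)[of n] by (simp add: mult_left_le_one_le)
      moreover have "norm x \<le> norm (x + t n *\<^sub>R b) + norm (t n *\<^sub>R b)"
        using norm_triangle_ineq4[of "x + t n *\<^sub>R b" "t n *\<^sub>R b"] by simp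
      ultimately show ?thesis by linarith
    qed
    ultimately have "r < norm x" "r < norm (x + t n *\<^sub>R b)" using norm_ge_zero[of b] by linarith+
    then have "s n x = 0" using supp[of x] supp[of "x + t n *\<^sub>R b"] by (simp add: s_def)
    then show ?thesis using L by (simp add: indicator_def)
  qed
  have int0: "(LINT x|lebesgue. s n x) = 0" for n
  proof -
    obtain B where B: "\<And>x. x \<in> cball 0 r \<Longrightarrow> norm (F x) \<le> B"
      using compact_continuous_norm_bound[OF compact_cball continuous_on_subset[OF cont subset_UNIV]] by blast
    have intF: "integrable lborel F"
    proof (rule Bochner_Integration.integrable_bound)
      show "AE x in lborel. norm (F x) \<le> norm (indicat_real (cball 0 r) x * \<bar>B\<bar>)"
      proof (rule AE_I2)
        show "norm (F x) \<le> norm (indicat_real (cball 0 r) x * \<bar>B\<bar>)" for x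
        proof (cases "x \<in> cball 0 r")
          case True
          then show ?thesis using B[of x] by simp
        next
          case False
          then show ?thesis using supp[of x] by simp
        qed
      qed
      show "integrable lborel (\<lambda>x. indicat_real (cball 0 r) x * \<bar>B\<bar>)"
        using emeasure_bounded_finite[OF bounded_cball, of 0 r]
        by (intro integrable_mult_left integrable_real_indicator) (auto simp: less_top)
      show "F \<in> borel_measurable lborel" using Fb by simp
    qed
    have shift: "F \<in> borel_measurable (distr lborel borel ((+) c))" for c using Fb by simp
    have intS: "integrable lborel (\<lambda>x. F (x + c))" and eq: "(LINT x|lborel. F (x + c)) = (LINT x|lborel. F x)" for c
    proof -
      have "integrable (distr lborel borel ((+) c)) F" using intF by (simp add: lborel_distr_plus)
      then show "integrable lborel (\<lambda>x. F (x + c))"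
        by (subst (asm) integrable_distr_eq) (use Fb in \<open>simp_all add: add.commute\<close>)
      have "(LINT x|lborel. F x) = (LINT x|distr lborel borel ((+) c). F x)" by (simp add: lborel_distr_plus)
      also have "\<dots> = (LINT x|lborel. F (c + x))" by (rule integral_distr) (use Fb in simp_all)
      finally show "(LINT x|lborel. F (x + c)) = (LINT x|lborel. F x)" by (simp add: add.commute)
    qed
    have "(LINT x|lebesgue. s n x) = (LINT x|lborel. s n x)"
      by (rule integral_completion) (use sb in simp)
    also have "\<dots> = ((LINT x|lborel. F (x + t n *\<^sub>R b)) - (LINT x|lborel. F x)) / t n"
      unfolding s_def by (simp add: intS intF)
    also have "\<dots> = 0" by (simp add: eq)
    finally show ?thesis .
  qed
  have "(\<lambda>n. LINT x|lebesgue. s n x) \<longlonglongrightarrow> (LINT x|lebesgue. G x)"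
  proof (rule integral_dominated_convergence[where w = ?w])
    show "G \<in> borel_measurable lebesgue" by (rule G)
    show "s n \<in> borel_measurable lebesgue" for n
      using sb[of n] by (intro measurable_completion) simp
    show "integrable lebesgue ?w"
    proof (rule integrable_mult_left)
      show "integrable lebesgue (indicat_real (cball 0 (r + norm b)))"
        by (rule integrable_real_indicator)
          (use emeasure_bounded_finite[OF bounded_cball, of 0 "r + norm b"] in \<open>auto simp: less_top\<close>)
    qed
    show "AE x in lebesgue. (\<lambda>n. s n x) \<longlonglongrightarrow> G x"
      using D
    proof eventually_elim
      case (elim x)
      then obtain D where D: "GDERIV F x :> D" "inner b D = G x" by blast
      show ?case unfolding s_def D(2)[symmetric] by (rule GDERIV_difference_quotient[OF D(1) t0 t(1)])
    qed
    show "AE x in lebesgue. norm (s n x) \<le> ?w x" for n using bound by simp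
  qed
  then show ?thesis by (simp add: int0 LIMSEQ_const_iff)
qed

context mesh_measure
begin

lemma P1_zero_bounded:
  assumes u: "u \<in> P1_zero T"
  obtains B where "\<And>x. \<bar>u x\<bar> \<le> B"
proof -
  obtain B where B: "\<And>x. x \<in> \<Union>T \<Longrightarrow> norm (u x) \<le> B"
    using compact_continuous_norm_bound[OF compact_Union[OF order_refl]
        continuous_on_subset[OF P1_zero_continuous[OF u] subset_UNIV]] by blast
  have "\<bar>u x\<bar> \<le> \<bar>B\<bar>" for x
  proof (cases "x \<in> \<Union>T")
    case True
    then show ?thesis using B[of x] by simp
  next
    case False
    then show ?thesis using u P1_outside[of u x] by (simp add: P1_zero_def)
  qed
  then show thesis by (rule that)
qed

text \<open>The segment from x to y may leave the domain. The preimages of the simplices and of the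
  complement of \<Omega>, where u vanishes, are finitely many closed sets covering the unit
  interval, and Lipschitz bounds on closed pieces of an interval glue. The sum of the gradient norms
  serves as a common bound for all simplices.\<close>

lemma P1_zero_lipschitz:
  assumes u: "u \<in> P1_zero T"
  obtains L where "0 \<le> L" "\<And>x y. \<bar>u x - u y\<bar> \<le> L * norm (x - y)"
proof -
  have u1: "u \<in> P1 T" using u by (simp add: P1_zero_def)
  obtain b c where bc: "\<forall>S\<in>T. \<forall>x\<in>S. u x = inner (b S) x + c S" using P1_pieces[OF u1] by blast
  define L where "L = (\<Sum>S\<in>T. norm (b S))"
  have L0: "0 \<le> L" unfolding L_def by (intro sum_nonneg) simp
  have bL: "norm (b S) \<le> L" if "S \<in> T" for S
    unfolding L_def by (rule member_le_sum) (use that finite_T in auto)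
  have "\<bar>u x - u y\<bar> \<le> L * norm (x - y)" for x y
  proof -
    define \<gamma> where "\<gamma> t = x + t *\<^sub>R (y - x)" for t
    let ?I = "insert (- \<Omega>) T"
    let ?C = "L * norm (x - y)"
    have C0: "0 \<le> ?C" using L0 by simp
    have "?C-lipschitz_on {0..1} (\<lambda>t. u (\<gamma> t))"
    proof (rule lipschitz_on_closed_Union[where I = ?I and U = "\<lambda>V. \<gamma> -` V"])
      show "?C-lipschitz_on (\<gamma> -` V) (\<lambda>t. u (\<gamma> t))" if V: "V \<in> ?I" for V
      proof (cases "V = - \<Omega>")
        case True
        show ?thesis
        proof (rule lipschitz_onI[OF _ C0])
          fix s t assume "s \<in> \<gamma> -` V" "t \<in> \<gamma> -` V"
          then have "u (\<gamma> s) = 0" "u (\<gamma> t) = 0" using P1_zero_outside[OF u] True by auto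
          then show "dist (u (\<gamma> s)) (u (\<gamma> t)) \<le> ?C * dist s t" using C0 by simp
        qed
      next
        case False
        then have V: "V \<in> T" using V by blast
        show ?thesis
        proof (rule lipschitz_onI[OF _ C0])
          fix s t assume st: "s \<in> \<gamma> -` V" "t \<in> \<gamma> -` V"
          have "u (\<gamma> s) - u (\<gamma> t) = inner (b V) ((s - t) *\<^sub>R (y - x))"
            using bc V st by (simp add: \<gamma>_def inner_simps algebra_simps)
          then have "\<bar>u (\<gamma> s) - u (\<gamma> t)\<bar> \<le> norm (b V) * norm ((s - t) *\<^sub>R (y - x))"
            by (simp only: Cauchy_Schwarz_ineq2)
          also have "\<dots> \<le> L * (\<bar>s - t\<bar> * norm (x - y))"
            using bL[OF V] by (simp add: norm_minus_commute mult_right_mono)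
          finally show "dist (u (\<gamma> s)) (u (\<gamma> t)) \<le> ?C * dist s t"
            by (simp add: dist_real_def mult_ac)
        qed
      qed
      show "closed (\<gamma> -` V)" if "V \<in> ?I" for V
      proof (rule continuous_closed_vimage)
        show "closed V" using that simplex_closed by auto
        show "isCont \<gamma> t" for t unfolding \<gamma>_def by (intro continuous_intros)
      qed
      show "{0..1} \<subseteq> (\<Union>V\<in>?I. \<gamma> -` V)"
        using interior_subset[of "\<Union>T"] by auto
    qed (use finite_T C0 in auto)
    then have "dist (u (\<gamma> 0)) (u (\<gamma> 1)) \<le> ?C * dist 0 (1::real)"
      by (rule lipschitz_onD) auto
    then show ?thesis by (simp add: \<gamma>_def dist_real_def)
  qed
  with L0 show thesis by (rule that)
qed

lemma ess_bdd_integrable_on: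
  fixes f :: "'a \<Rightarrow> 'b::euclidean_space"
  assumes f: "ess_bdd f" and U: "U \<in> sets lebesgue" "U \<subseteq> \<Omega>"
  shows "integrable (lebesgue_on U) f"
proof -
  have "integrable lebesgue (\<lambda>x. indicator \<Omega> x *\<^sub>R f x)"
    using ess_bdd_integrable[OF f] by (simp add: integrable_restrict_space)
  from integrable_mult_indicator[OF U(1) this]
  have "integrable lebesgue (\<lambda>x. indicator U x *\<^sub>R (indicator \<Omega> x *\<^sub>R f x))" .
  also have "(\<lambda>x. indicator U x *\<^sub>R (indicator \<Omega> x *\<^sub>R f x)) = (\<lambda>x. indicator U x *\<^sub>R f x)"
    using U(2) by (auto simp: fun_eq_iff split: split_indicator)
  finally show ?thesis using U(1) by (simp add: integrable_restrict_space)
qed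

lemma ess_bdd_square_integrable:
  fixes f :: "'a \<Rightarrow> 'b::euclidean_space"
  assumes f: "ess_bdd f" and U: "U \<in> sets lebesgue" "U \<subseteq> \<Omega>"
  shows "f square_integrable_on U"
proof -
  have "ess_bdd (\<lambda>x. (norm (f x))\<^sup>2)"
    unfolding power2_norm_eq_inner by (rule ess_bdd_inner[OF f f])
  moreover have "f \<in> borel_measurable M" using f by (simp add: ess_bdd_def)
  ultimately show ?thesis
    unfolding square_integrable_on_def
    using ess_bdd_integrable_on[OF _ U] measurable_restrict_mono[OF _ U(2)] by blast
qed

lemma test_function_bounds:
  fixes \<phi> :: "'a \<Rightarrow> real"
  assumes D: "\<And>x. GDERIV \<phi> x :> d\<phi> x" and cont: "continuous_on UNIV d\<phi>"
    and K: "compact (closure {x. \<phi> x \<noteq> 0})"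
  obtains B where "0 \<le> B" "\<And>x. norm (d\<phi> x) \<le> B" "\<And>x. \<bar>\<phi> x\<bar> \<le> B"
    "\<And>x y. \<bar>\<phi> x - \<phi> y\<bar> \<le> B * norm (x - y)"
proof -
  define Z where "Z = closure {x. \<phi> x \<noteq> 0}"
  have Z: "compact Z" using K by (simp add: Z_def)
  then have "open (- Z)" by (simp add: compact_imp_closed open_Compl)
  have \<phi>0: "\<phi> x = 0" if "x \<notin> Z" for x
    using subsetD[OF closure_subset, of x "{x. \<phi> x \<noteq> 0}"] that unfolding Z_def by blast
  have d0: "d\<phi> x = 0" if "x \<notin> Z" for x
  proof -
    have "GDERIV \<phi> x :> 0"
      by (rule GDERIV_local_affine[of "- Z" _ _ _ 0]) (use that \<phi>0 \<open>open (- Z)\<close> in auto)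
    from grad_eqI[OF this] grad_eqI[OF D[of x]] show ?thesis by simp
  qed
  have \<phi>c: "continuous_on UNIV \<phi>"
    by (intro continuous_at_imp_continuous_on ballI has_derivative_continuous[OF D[unfolded gderiv_def]])
  obtain B1 where B1: "\<And>x. x \<in> Z \<Longrightarrow> norm (d\<phi> x) \<le> B1"
    using compact_continuous_norm_bound[OF Z continuous_on_subset[OF cont subset_UNIV]] by blast
  obtain B2 where B2: "\<And>x. x \<in> Z \<Longrightarrow> norm (\<phi> x) \<le> B2"
    using compact_continuous_norm_bound[OF Z continuous_on_subset[OF \<phi>c subset_UNIV]] by blast
  define B where "B = max \<bar>B1\<bar> \<bar>B2\<bar>"
  have dB: "norm (d\<phi> x) \<le> B" for x
    using B1[of x] d0[of x] by (cases "x \<in> Z") (auto simp: B_def)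
  show thesis
  proof (rule that)
    show "0 \<le> B" by (simp add: B_def)
    show "norm (d\<phi> x) \<le> B" for x by (rule dB)
    show "\<bar>\<phi> x\<bar> \<le> B" for x
      using B2[of x] \<phi>0[of x] by (cases "x \<in> Z") (auto simp: B_def)
    show "\<bar>\<phi> x - \<phi> y\<bar> \<le> B * norm (x - y)" for x y
    proof -
      have "norm (\<phi> x - \<phi> y) \<le> B * norm (x - y)"
      proof (rule differentiable_bound[where S = UNIV and f' = "\<lambda>x h. inner h (d\<phi> x)"])
        show "onorm (\<lambda>h. inner h (d\<phi> x)) \<le> B" for x
        proof (rule onorm_le)
          fix h
          have "norm (inner h (d\<phi> x)) \<le> norm h * norm (d\<phi> x)" by (simp add: Cauchy_Schwarz_ineq2)
          also have "\<dots> \<le> norm h * B" by (rule mult_left_mono[OF dB]) simp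
          finally show "norm (inner h (d\<phi> x)) \<le> B * norm h" by (simp add: mult.commute)
        qed
      qed (use D in \<open>auto simp: gderiv_def\<close>)
      then show ?thesis by simp
    qed
  qed
qed

text \<open>Makes the pointwise gradient admissible in \<open>projection_estimate\<close>. For a
  test function \<phi> the product u \<phi> is Lipschitz with compact support in U and
  differentiable off the skeleton, so its directional derivatives integrate to zero, which is
  integration by parts.\<close>

lemma P1_zero_weak_gradient:
  assumes u: "u \<in> P1_zero T" and U: "open U" "U \<subseteq> \<Omega>"
  shows "H1_with_gradient U u (grad u)"
proof -
  have Us: "U \<in> sets lebesgue" using U(1) by simp
  note smooth = P1_zero_pw_smooth[OF u]
  have by_parts: "(LINT x|lebesgue_on U. u x *\<^sub>R d\<phi> x) = - (LINT x|lebesgue_on U. \<phi> x *\<^sub>R grad u x)"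
    if D: "\<And>x. GDERIV \<phi> x :> d\<phi> x" and cont: "continuous_on UNIV d\<phi>"
      and K: "compact (closure {x. \<phi> x \<noteq> 0})" "closure {x. \<phi> x \<noteq> 0} \<subseteq> U" for \<phi> d\<phi>
  proof -
    obtain B where B: "0 \<le> B" "\<And>x. norm (d\<phi> x) \<le> B" "\<And>x. \<bar>\<phi> x\<bar> \<le> B"
      "\<And>x y. \<bar>\<phi> x - \<phi> y\<bar> \<le> B * norm (x - y)"
      using test_function_bounds[OF D cont K(1)] by blast
    obtain Bu where Bu: "\<And>x. \<bar>u x\<bar> \<le> Bu" using P1_zero_bounded[OF u] by blast
    obtain L where L: "0 \<le> L" "\<And>x y. \<bar>u x - u y\<bar> \<le> L * norm (x - y)"
      using P1_zero_lipschitz[OF u] by blast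
    have \<phi>c: "continuous_on UNIV \<phi>"
      unfolding continuous_on_eq_continuous_within
      using has_derivative_continuous[OF D[unfolded gderiv_def]] by blast
    define Z where "Z = closure {x. \<phi> x \<noteq> 0}"
    have Z: "compact Z" "Z \<subseteq> U" using K by (simp_all add: Z_def)
    then have "open (- Z)" by (simp add: compact_imp_closed open_Compl)
    have \<phi>0: "\<phi> x = 0" if "x \<notin> Z" for x
      using subsetD[OF closure_subset, of x "{x. \<phi> x \<noteq> 0}"] that unfolding Z_def by blast
    have ess\<phi>: "ess_bdd \<phi>"
      by (rule ess_bddI[where B = B])
        (use B(3) continuous_imp_measurable_on_sets_lebesgue[OF continuous_on_subset[OF \<phi>c subset_UNIV] \<Omega>_sets] in auto)
    have essd\<phi>: "ess_bdd d\<phi>"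
      by (rule ess_bddI[where B = B])
        (use B(2) continuous_imp_measurable_on_sets_lebesgue[OF continuous_on_subset[OF cont subset_UNIV] \<Omega>_sets] in auto)
    have e1: "ess_bdd (\<lambda>x. u x *\<^sub>R d\<phi> x)" and e2: "ess_bdd (\<lambda>x. \<phi> x *\<^sub>R grad u x)"
      using ess\<phi> essd\<phi> pw_smoothD(1,2)[OF smooth] by (auto intro: ess_bdd_scaleR)
    have e: "ess_bdd (\<lambda>x. u x *\<^sub>R d\<phi> x + \<phi> x *\<^sub>R grad u x)" using e1 e2 by (rule ess_bdd_add)
    have zero: "(LINT x|lebesgue_on U. u x *\<^sub>R d\<phi> x + \<phi> x *\<^sub>R grad u x) = 0" (is "?J = 0")
    proof -
      \<comment> \<open>The vector integral is tested against every direction b, so that a statement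
        about scalar derivatives applies; in the end b is the integral itself.\<close>
      have "inner ?J b = 0" for b
      proof -
        obtain r where r: "\<And>x. x \<in> Z \<Longrightarrow> norm x \<le> r"
          using compact_imp_bounded[OF Z(1)] by (auto simp: bounded_iff)
        let ?G = "\<lambda>x. indicat_real U x * inner (u x *\<^sub>R d\<phi> x + \<phi> x *\<^sub>R grad u x) b"
        let ?F = "\<lambda>x. u x * \<phi> x"
        have intU: "integrable (lebesgue_on U) (\<lambda>x. inner (u x *\<^sub>R d\<phi> x + \<phi> x *\<^sub>R grad u x) b)"
          by (intro ess_bdd_integrable_on ess_bdd_intros e Us U(2))
        have "inner ?J b = (LINT x|lebesgue_on U. inner (u x *\<^sub>R d\<phi> x + \<phi> x *\<^sub>R grad u x) b)"
          by (rule integral_inner_left[symmetric]) (rule ess_bdd_integrable_on[OF e Us U(2)])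
        also have "\<dots> = (LINT x|lebesgue. ?G x)"
          using Us by (simp add: integral_restrict_space)
        also have "\<dots> = 0"
        proof (rule integral_directional_derivative[where F = ?F and r = r and L = "Bu * B + B * L"])
          show "\<bar>?F x - ?F y\<bar> \<le> (Bu * B + B * L) * norm (x - y)" for x y
          proof -
            have "?F x - ?F y = u x * (\<phi> x - \<phi> y) + \<phi> y * (u x - u y)" by (simp add: algebra_simps)
            then have "\<bar>?F x - ?F y\<bar> \<le> \<bar>u x\<bar> * \<bar>\<phi> x - \<phi> y\<bar> + \<bar>\<phi> y\<bar> * \<bar>u x - u y\<bar>"
              by (metis abs_mult abs_triangle_ineq)
            also have "\<dots> \<le> Bu * (B * norm (x - y)) + B * (L * norm (x - y))"
              using Bu[of x] B L(2)[of x y] order_trans[OF abs_ge_zero Bu[of x]]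
              by (intro add_mono mult_mono) auto
            finally show ?thesis by (simp add: algebra_simps)
          qed
          show "?F x = 0" if "r < norm x" for x
          proof -
            have "x \<notin> Z" using r[of x] that by linarith
            then show ?thesis by (simp add: \<phi>0)
          qed
          have "integrable lebesgue ?G"
            using intU Us by (simp add: integrable_restrict_space)
          then show "?G \<in> borel_measurable lebesgue" by simp
          have "AE x in lebesgue. x \<in> \<Omega> \<longrightarrow> x \<in> open_cells" using AE_open_cells by (simp add: AE_M_iff)
          then show "AE x in lebesgue. \<exists>D. GDERIV ?F x :> D \<and> inner b D = ?G x"
          proof eventually_elim
            case (elim x)
            show ?case
            proof (cases "x \<in> U")
              case True
              then have "GDERIV u x :> grad u x" using elim U(2) pw_smoothD(3)[OF smooth] by blast
              from GDERIV_mult[OF this D[of x]] show ?thesis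
                using True by (intro exI conjI) (auto simp: inner_commute)
            next
              case False
              have "GDERIV ?F x :> 0"
                by (rule GDERIV_local_affine[of "- Z" _ _ _ 0])
                  (use False Z(2) \<phi>0 \<open>open (- Z)\<close> in auto)
              then show ?thesis using False by (intro exI[of _ 0]) simp
            qed
          qed
        qed
        finally show ?thesis .
      qed
      then have "inner ?J ?J = 0" by blast
      then show ?thesis by simp
    qed
    have "?J = (LINT x|lebesgue_on U. u x *\<^sub>R d\<phi> x) + (LINT x|lebesgue_on U. \<phi> x *\<^sub>R grad u x)"
      by (rule Bochner_Integration.integral_add) (intro ess_bdd_integrable_on e1 e2 Us U(2))+
    then show ?thesis using zero by (simp add: eq_neg_iff_add_eq_0)
  qed
  show ?thesis
    unfolding H1_with_gradient_def
  proof (intro conjI allI impI)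
    show "u square_integrable_on U" "grad u square_integrable_on U"
      by (rule ess_bdd_square_integrable[OF _ Us U(2)], rule pw_smoothD[OF smooth])+
  qed (elim conjE, rule by_parts, auto)
qed

end

section \<open>Overlap, partition of unity and nodal coordinates\<close>

text \<open>Finite overlap at a single point: Cauchy-Schwarz is applied to the possibly nonzero
  summands alone.\<close>

lemma norm_sum_le_card:
  fixes z :: "'i \<Rightarrow> 'b::real_normed_vector"
  assumes I: "finite I" and J: "J \<subseteq> I" "card J \<le> k" and zero: "\<And>i. i \<in> I - J \<Longrightarrow> z i = 0"
  shows "(norm (\<Sum>i\<in>I. z i))\<^sup>2 \<le> real k * (\<Sum>i\<in>I. (norm (z i))\<^sup>2)"
proof -
  have 1: "(\<Sum>i\<in>I. z i) = (\<Sum>i\<in>J. z i)" and 2: "(\<Sum>i\<in>I. (norm (z i))\<^sup>2) = (\<Sum>i\<in>J. (norm (z i))\<^sup>2)"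
    using I J(1) zero by (auto intro!: sum.mono_neutral_right)
  have "(norm (\<Sum>i\<in>J. z i))\<^sup>2 \<le> (\<Sum>i\<in>J. norm (z i))\<^sup>2"
    by (intro power_mono norm_sum) simp
  also have "\<dots> \<le> (\<Sum>i\<in>J. (norm (z i))\<^sup>2) * card J" by (rule sum_squared_le_sum_of_squares)
  also have "\<dots> \<le> (\<Sum>i\<in>J. (norm (z i))\<^sup>2) * k"
    using J(2) by (intro mult_left_mono sum_nonneg) auto
  finally show ?thesis by (simp add: 1 2 mult.commute)
qed

context weighted_mesh
begin

text \<open>A subdomain is made of whole fine elements, so an open fine element with one point
  outside it lies outside entirely. Thus u vanishes near x and not just at x.\<close>

lemma grad_zero_outside:
  assumes u: "u \<in> P1 T" and T': "T' \<subseteq> T" and zero: "\<And>y. y \<in> \<Omega> \<Longrightarrow> y \<notin> interior (\<Union>T') \<Longrightarrow> u y = 0"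
    and x: "x \<in> open_cells" "x \<notin> interior (\<Union>T')"
  shows "grad u x = 0"
proof -
  obtain S where S: "S \<in> T" "x \<in> interior S" using x by (auto simp: open_cells_def)
  show ?thesis
  proof (rule P1_grad_zero[OF u S])
    fix y assume y: "y \<in> interior S"
    have "y \<notin> interior (\<Union>T')"
    proof
      assume "y \<in> interior (\<Union>T')"
      then have "S \<in> T'" by (rule interior_in_subset[OF T' S(1) y])
      then have "interior S \<subseteq> interior (\<Union>T')" by (intro interior_mono) blast
      then show False using S(2) x(2) by blast
    qed
    moreover have "y \<in> \<Omega>" using y S(1) open_cells_subset by (auto simp: open_cells_def)
    ultimately show "u y = 0" by (rule zero[rotated])
  qed
qed

lemma a_eq_norm: "a u u = (LINT x|M. \<kappa> x * (norm (grad u x))\<^sup>2)"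
  by (simp add: a_form_def power2_norm_eq_inner)

lemma overlap_a:
  assumes I: "finite I" and T': "\<And>i. i \<in> I \<Longrightarrow> T' i \<subseteq> T"
    and v: "\<And>i. i \<in> I \<Longrightarrow> v i \<in> P1 T"
    and zero: "\<And>i x. i \<in> I \<Longrightarrow> x \<notin> interior (\<Union>(T' i)) \<Longrightarrow> v i x = 0"
    and card: "\<And>x. x \<in> \<Omega> \<Longrightarrow> card {i \<in> I. x \<in> interior (\<Union>(T' i))} \<le> No"
  shows "a (\<lambda>x. \<Sum>i\<in>I. v i x) (\<lambda>x. \<Sum>i\<in>I. v i x) \<le> real No * (\<Sum>i\<in>I. a (v i) (v i))"
proof -
  let ?s = "\<lambda>x. \<Sum>i\<in>I. v i x"
  have smooth: "pw_smooth (v i)" if "i \<in> I" for i by (rule P1_pw_smooth[OF v[OF that]])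
  have ssmooth: "pw_smooth ?s" using pw_smooth_sum(1)[of I v "\<lambda>_. 1"] smooth by simp
  have "a ?s ?s \<le> (LINT x|M. \<kappa> x * (real No * (\<Sum>i\<in>I. (norm (grad (v i) x))\<^sup>2)))"
    unfolding a_eq_norm
  proof (rule weighted_mono)
    show "ess_bdd (\<lambda>x. (norm (grad ?s x))\<^sup>2)"
      by (intro ess_bdd_norm2 pw_smoothD(2) ssmooth)
    show "ess_bdd (\<lambda>x. real No * (\<Sum>i\<in>I. (norm (grad (v i) x))\<^sup>2))"
      by (intro ess_bdd_intros pw_smoothD(2) smooth)
    show "AE x in M. (norm (grad ?s x))\<^sup>2 \<le> real No * (\<Sum>i\<in>I. (norm (grad (v i) x))\<^sup>2)"
      using AE_open_cells
    proof eventually_elim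
      case (elim x)
      have "grad ?s x = (\<Sum>i\<in>I. grad (v i) x)"
        using pw_smooth_sum(2)[of I v x "\<lambda>_. 1"] smooth elim by simp
      moreover have "(norm (\<Sum>i\<in>I. grad (v i) x))\<^sup>2 \<le> real No * (\<Sum>i\<in>I. (norm (grad (v i) x))\<^sup>2)"
      proof (rule norm_sum_le_card[OF I])
        show "card {i \<in> I. x \<in> interior (\<Union>(T' i))} \<le> No" using card elim open_cells_subset by blast
        show "grad (v i) x = 0" if "i \<in> I - {i \<in> I. x \<in> interior (\<Union>(T' i))}" for i
          by (rule grad_zero_outside[OF v T' zero elim]) (use that in auto)
      qed simp
      ultimately show ?case by simp
    qed
  qed
  also have "\<dots> = real No * (\<Sum>i\<in>I. a (v i) (v i))"
    unfolding weighted_scale a_eq_norm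
    by (subst weighted_sum) (auto intro!: ess_bdd_norm2 pw_smoothD(2) smooth)
  finally show ?thesis .
qed

lemma overlap_m:
  assumes I: "finite I" and v: "\<And>i. i \<in> I \<Longrightarrow> ess_bdd (v i)"
    and zero: "\<And>i x. i \<in> I \<Longrightarrow> x \<notin> W i \<Longrightarrow> v i x = 0"
    and card: "\<And>x. x \<in> \<Omega> \<Longrightarrow> card {i \<in> I. x \<in> W i} \<le> No"
  shows "m (\<lambda>x. \<Sum>i\<in>I. v i x) (\<lambda>x. \<Sum>i\<in>I. v i x) \<le> real No * (\<Sum>i\<in>I. m (v i) (v i))"
proof -
  have "m (\<lambda>x. \<Sum>i\<in>I. v i x) (\<lambda>x. \<Sum>i\<in>I. v i x) \<le> (LINT x|M. real No * (\<Sum>i\<in>I. v i x * v i x))"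
    unfolding l2_form_def
  proof (rule integral_mono_AE)
    show "integrable M (\<lambda>x. (\<Sum>i\<in>I. v i x) * (\<Sum>i\<in>I. v i x))"
      by (intro ess_bdd_integrable ess_bdd_intros v)
    show "integrable M (\<lambda>x. real No * (\<Sum>i\<in>I. v i x * v i x))"
      by (intro ess_bdd_integrable ess_bdd_intros v)
    show "AE x in M. (\<Sum>i\<in>I. v i x) * (\<Sum>i\<in>I. v i x) \<le> real No * (\<Sum>i\<in>I. v i x * v i x)"
    proof (rule AE_I2)
      fix x assume "x \<in> space M"
      then have x: "x \<in> \<Omega>" by simp
      have "(norm (\<Sum>i\<in>I. v i x))\<^sup>2 \<le> real No * (\<Sum>i\<in>I. (norm (v i x))\<^sup>2)"
        by (rule norm_sum_le_card[OF I _ card[OF x]]) (use zero in auto)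
      then show "(\<Sum>i\<in>I. v i x) * (\<Sum>i\<in>I. v i x) \<le> real No * (\<Sum>i\<in>I. v i x * v i x)"
        by (simp add: power2_eq_square)
    qed
  qed
  also have "\<dots> = real No * (\<Sum>i\<in>I. m (v i) (v i))"
    unfolding l2_form_def
    by (subst integral_mult_right_zero, subst Bochner_Integration.integral_sum)
      (auto intro!: ess_bdd_integrable ess_bdd_mult v)
  finally show ?thesis .
qed

lemma partition_of_unity_w:
  assumes e: "ess_bdd e" and \<theta>: "\<And>i. i \<in> I \<Longrightarrow> ess_bdd (\<theta> i)"
    and square: "\<And>x. x \<in> \<Omega> \<Longrightarrow> (\<Sum>i\<in>I. (\<theta> i x)\<^sup>2) \<le> 1"
  shows "(\<Sum>i\<in>I. w (\<lambda>x. \<theta> i x * e x) (\<lambda>x. \<theta> i x * e x)) \<le> w e e"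
proof -
  have "(\<Sum>i\<in>I. w (\<lambda>x. \<theta> i x * e x) (\<lambda>x. \<theta> i x * e x))
      = (LINT x|M. \<kappa> x * (\<Sum>i\<in>I. (\<theta> i x * e x) * (\<theta> i x * e x)))"
    unfolding w_def by (rule weighted_sum[symmetric]) (intro ess_bdd_mult \<theta> e)
  also have "\<dots> \<le> w e e"
    unfolding w_def
  proof (rule weighted_mono)
    show "AE x in M. (\<Sum>i\<in>I. (\<theta> i x * e x) * (\<theta> i x * e x)) \<le> e x * e x"
    proof (rule AE_I2)
      fix x assume "x \<in> space M"
      then have "(\<Sum>i\<in>I. (\<theta> i x)\<^sup>2) * (e x * e x) \<le> 1 * (e x * e x)"
        by (intro mult_right_mono square) auto
      then show "(\<Sum>i\<in>I. (\<theta> i x * e x) * (\<theta> i x * e x)) \<le> e x * e x"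
        by (simp add: sum_distrib_right power2_eq_square mult_ac sum_distrib_left)
    qed
  qed (intro ess_bdd_intros \<theta> e; assumption)+
  finally show ?thesis .
qed

text \<open>The product rule gives two terms. The first is controlled by the sum of the squares of
  the \<open>\<theta> i\<close>, the second by the fact that at most No of their gradients are
  nonzero at a point. The bound c is later Cchi / H, so \<open>w e e\<close> acquires exactly the
  scaling of the s-norm.\<close>

lemma partition_of_unity_a:
  assumes I: "finite I" and T': "\<And>i. i \<in> I \<Longrightarrow> T' i \<subseteq> T"
    and e: "pw_smooth e" and \<theta>: "\<And>i. i \<in> I \<Longrightarrow> \<theta> i \<in> P1 T"
    and zero: "\<And>i x. i \<in> I \<Longrightarrow> x \<in> \<Omega> \<Longrightarrow> x \<notin> interior (\<Union>(T' i)) \<Longrightarrow> \<theta> i x = 0"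
    and card: "\<And>x. x \<in> \<Omega> \<Longrightarrow> card {i \<in> I. x \<in> interior (\<Union>(T' i))} \<le> No"
    and square: "\<And>x. x \<in> \<Omega> \<Longrightarrow> (\<Sum>i\<in>I. (\<theta> i x)\<^sup>2) \<le> 1"
    and grad_bound: "\<And>i. i \<in> I \<Longrightarrow> AE x in M. norm (grad (\<theta> i) x) \<le> c"
  shows "(\<Sum>i\<in>I. a (\<lambda>x. \<theta> i x * e x) (\<lambda>x. \<theta> i x * e x)) \<le> 2 * a e e + 2 * real No * c\<^sup>2 * w e e"
proof -
  let ?p = "\<lambda>i x. \<theta> i x * e x"
  have smooth: "pw_smooth (\<theta> i)" if "i \<in> I" for i by (rule P1_pw_smooth[OF \<theta>[OF that]])
  have psmooth: "pw_smooth (?p i)" if "i \<in> I" for i by (rule pw_smooth_mult(1)[OF smooth[OF that] e])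
  have eb: "ess_bdd e" "ess_bdd (grad e)" using e by (auto simp: pw_smooth_def)
  have "(\<Sum>i\<in>I. a (?p i) (?p i)) = (LINT x|M. \<kappa> x * (\<Sum>i\<in>I. (norm (grad (?p i) x))\<^sup>2))"
    unfolding a_eq_norm
    by (rule weighted_sum[symmetric]) (intro ess_bdd_norm2 pw_smoothD(2) psmooth)
  also have "\<dots> \<le> (LINT x|M. \<kappa> x * (2 * (norm (grad e x))\<^sup>2 + (2 * real No * c\<^sup>2) * (e x * e x)))"
  proof (rule weighted_mono)
    show "ess_bdd (\<lambda>x. \<Sum>i\<in>I. (norm (grad (?p i) x))\<^sup>2)"
      by (intro ess_bdd_intros pw_smoothD(2) psmooth)
    show "ess_bdd (\<lambda>x. 2 * (norm (grad e x))\<^sup>2 + (2 * real No * c\<^sup>2) * (e x * e x))"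
      by (intro ess_bdd_intros eb)
    have "AE x in M. \<forall>i\<in>I. norm (grad (\<theta> i) x) \<le> c"
      using I grad_bound by (simp add: AE_finite_all)
    then show "AE x in M. (\<Sum>i\<in>I. (norm (grad (?p i) x))\<^sup>2)
        \<le> 2 * (norm (grad e x))\<^sup>2 + (2 * real No * c\<^sup>2) * (e x * e x)"
      using AE_open_cells
    proof eventually_elim
      case (elim x)
      have x: "x \<in> \<Omega>" using elim(2) open_cells_subset by blast
      let ?J = "{i \<in> I. x \<in> interior (\<Union>(T' i))}"
      have "(norm (grad (?p i) x))\<^sup>2
          \<le> 2 * ((\<theta> i x)\<^sup>2 * (norm (grad e x))\<^sup>2) + 2 * ((e x)\<^sup>2 * (norm (grad (\<theta> i) x))\<^sup>2)" if i: "i \<in> I" for i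
      proof -
        have "grad (?p i) x = \<theta> i x *\<^sub>R grad e x + e x *\<^sub>R grad (\<theta> i) x"
          by (rule pw_smooth_mult(2)[OF smooth[OF i] e elim(2)])
        then have "norm (grad (?p i) x) \<le> \<bar>\<theta> i x\<bar> * norm (grad e x) + \<bar>e x\<bar> * norm (grad (\<theta> i) x)"
          using norm_triangle_ineq[of "\<theta> i x *\<^sub>R grad e x" "e x *\<^sub>R grad (\<theta> i) x"] by simp
        then have "(norm (grad (?p i) x))\<^sup>2 \<le> (\<bar>\<theta> i x\<bar> * norm (grad e x) + \<bar>e x\<bar> * norm (grad (\<theta> i) x))\<^sup>2"
          by (rule power_mono) simp
        also have "\<dots> \<le> 2 * (\<bar>\<theta> i x\<bar> * norm (grad e x))\<^sup>2 + 2 * (\<bar>e x\<bar> * norm (grad (\<theta> i) x))\<^sup>2"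
          using sum_squares_bound[of "\<bar>\<theta> i x\<bar> * norm (grad e x)" "\<bar>e x\<bar> * norm (grad (\<theta> i) x)"]
          unfolding power2_sum by linarith
        finally show ?thesis by (simp add: power_mult_distrib)
      qed
      then have "(\<Sum>i\<in>I. (norm (grad (?p i) x))\<^sup>2)
          \<le> (\<Sum>i\<in>I. 2 * ((\<theta> i x)\<^sup>2 * (norm (grad e x))\<^sup>2) + 2 * ((e x)\<^sup>2 * (norm (grad (\<theta> i) x))\<^sup>2))"
        by (rule sum_mono)
      also have "\<dots> = 2 * ((\<Sum>i\<in>I. (\<theta> i x)\<^sup>2) * (norm (grad e x))\<^sup>2) + 2 * ((e x)\<^sup>2 * (\<Sum>i\<in>I. (norm (grad (\<theta> i) x))\<^sup>2))"
        by (simp add: sum.distrib sum_distrib_left sum_distrib_right)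
      also have "\<dots> \<le> 2 * (1 * (norm (grad e x))\<^sup>2) + 2 * ((e x)\<^sup>2 * (real No * c\<^sup>2))"
      proof (intro add_mono mult_left_mono mult_right_mono square x)
        have "(\<Sum>i\<in>I. (norm (grad (\<theta> i) x))\<^sup>2) = (\<Sum>i\<in>?J. (norm (grad (\<theta> i) x))\<^sup>2)"
        proof (rule sum.mono_neutral_right[OF I])
          show "\<forall>i\<in>I - ?J. (norm (grad (\<theta> i) x))\<^sup>2 = 0"
          proof
            fix i assume i: "i \<in> I - ?J"
            have "grad (\<theta> i) x = 0"
              by (rule grad_zero_outside[OF \<theta> T' zero elim(2)]) (use i in auto)
            then show "(norm (grad (\<theta> i) x))\<^sup>2 = 0" by simp
          qed
        qed auto
        also have "\<dots> \<le> (\<Sum>i\<in>?J. c\<^sup>2)"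
          using elim(1) by (intro sum_mono power_mono) auto
        also have "\<dots> \<le> real No * c\<^sup>2"
          using card[OF x] by (simp add: mult_right_mono)
        finally show "(\<Sum>i\<in>I. (norm (grad (\<theta> i) x))\<^sup>2) \<le> real No * c\<^sup>2" .
      qed auto
      also have "\<dots> = 2 * (norm (grad e x))\<^sup>2 + (2 * real No * c\<^sup>2) * (e x * e x)"
        by (simp add: power2_eq_square)
      finally show ?case .
    qed
  qed
  also have "\<dots> = 2 * a e e + 2 * real No * c\<^sup>2 * w e e"
    unfolding a_eq_norm w_def
    by (subst weighted_add) (auto intro!: ess_bdd_intros eb simp: weighted_scale)
  finally show ?thesis .
qed

end

text \<open>Linearity is expressed through finite linear combinations, since the functions do not form a
  vector space type.\<close>

definition linear_form_on :: "('a \<Rightarrow> real) set \<Rightarrow> (('a \<Rightarrow> real) \<Rightarrow> real) \<Rightarrow> bool" where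
  "linear_form_on V f \<longleftrightarrow> (\<forall>(n::nat) k g. (\<forall>i<n. g i \<in> V) \<longrightarrow>
     f (\<lambda>x. \<Sum>i<n. k i * g i x) = (\<Sum>i<n. k i * f (g i)))"

lemma linear_form_onD:
  fixes N :: nat
  assumes "linear_form_on V f" "\<And>i. i < N \<Longrightarrow> g i \<in> V"
  shows "f (\<lambda>x. \<Sum>i<N. k i * g i x) = (\<Sum>i<N. k i * f (g i))"
proof -
  have "\<forall>i<N. g i \<in> V" using assms(2) by blast
  with assms(1)[unfolded linear_form_on_def, THEN spec, THEN spec, THEN spec, of N g k]
  show ?thesis by (rule mp)
qed

section \<open>Coordinates in the nodal basis and solvability of variational problems\<close>

locale nodal_coordinates = simplicial +
  fixes ps :: "'a list"
  assumes ps: "distinct ps" "set ps = nodes T \<inter> interior (\<Union>T)"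
begin

abbreviation n :: nat where "n \<equiv> length ps"

definition comb :: "(nat \<Rightarrow> real) \<Rightarrow> 'a \<Rightarrow> real" where
  "comb c = (\<lambda>x. \<Sum>r<n. c r * hat T (ps ! r) x)"

lemma ps_nth: "r < n \<Longrightarrow> ps ! r \<in> nodes T" "r < n \<Longrightarrow> ps ! r \<in> interior (\<Union>T)"
  using ps(2) nth_mem by blast+

lemma hat_ps: "r < n \<Longrightarrow> hat T (ps ! r) \<in> P1_zero T"
  by (rule hat_P1_zero) (rule ps_nth)

lemma comb_P1_zero: "comb c \<in> P1_zero T"
  unfolding comb_def by (rule P1_zero_sum) (simp add: hat_ps)

lemma comb_nth: "r < n \<Longrightarrow> comb c (ps ! r) = c r"
proof -
  assume r: "r < n"
  have "comb c (ps ! r) = (\<Sum>s<n. if s = r then c s else 0)"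
    unfolding comb_def
  proof (rule sum.cong[OF refl])
    fix s assume s: "s \<in> {..<n}"
    have "hat T (ps ! s) (ps ! r) = (if ps ! r = ps ! s then 1 else 0)"
      by (rule hat_node) (rule ps_nth(1)[OF r])
    then show "c s * hat T (ps ! s) (ps ! r) = (if s = r then c s else 0)"
      using nth_eq_iff_index_eq[OF ps(1), of r s] r s by auto
  qed
  then show ?thesis using r by simp
qed

lemma P1_zero_eqI:
  assumes u: "u \<in> P1_zero T" and v: "v \<in> P1_zero T" and eq: "\<And>r. r < n \<Longrightarrow> u (ps ! r) = v (ps ! r)"
  shows "u = v"
proof (rule P1_eqI)
  fix p assume p: "p \<in> nodes T"
  show "u p = v p"
  proof (cases "p \<in> interior (\<Union>T)")
    case True
    then have "p \<in> set ps" using p ps(2) by blast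
    then obtain r where "r < n" "p = ps ! r" by (metis in_set_conv_nth)
    then show ?thesis using eq by simp
  next
    case False
    then show ?thesis using P1_zero_outside[OF u] P1_zero_outside[OF v] by simp
  qed
qed (use u v in \<open>auto simp: P1_zero_def\<close>)

lemma comb_values: "u \<in> P1_zero T \<Longrightarrow> comb (\<lambda>r. u (ps ! r)) = u"
  by (rule P1_zero_eqI[OF comb_P1_zero]) (auto simp: comb_nth)

lemma comb_eq_0:
  assumes "x \<in> carrier_vec n" "comb (vec_index x) = (\<lambda>_. 0)"
  shows "x = 0\<^sub>v n"
proof (rule eq_vecI)
  fix r assume "r < dim_vec (0\<^sub>v n :: real vec)"
  then have "r < n" by simp
  then show "vec_index x r = vec_index (0\<^sub>v n) r" using comb_nth[of r "vec_index x"] assms(2) by simp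
qed (use assms in simp)

abbreviation hats where "hats \<equiv> map (hat T) ps"

text \<open>Linearity is available in the first argument; symmetry carries it over to the second and
  also matches the transposed index order in \<open>form_mat\<close>.\<close>

lemma form_comb:
  assumes lin: "\<And>v. v \<in> P1_zero T \<Longrightarrow> linear_form_on (P1_zero T) (\<lambda>u. b u v)"
    and sym: "\<And>u v. u \<in> P1_zero T \<Longrightarrow> v \<in> P1_zero T \<Longrightarrow> b u v = b v u"
  shows "mat_form n (form_mat b hats) c d = b (comb c) (comb d)"
proof -
  have left: "b (comb c) v = (\<Sum>r<n. c r * b (hat T (ps ! r)) v)" if "v \<in> P1_zero T" for c v
    unfolding comb_def by (rule linear_form_onD[OF lin[OF that] hat_ps])
  have "b (comb c) (comb d) = (\<Sum>r<n. c r * b (comb d) (hat T (ps ! r)))"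
    unfolding left[OF comb_P1_zero]
    by (rule sum.cong[OF refl]) (use sym hat_ps comb_P1_zero in auto)
  also have "\<dots> = (\<Sum>r<n. c r * (\<Sum>s<n. d s * b (hat T (ps ! s)) (hat T (ps ! r))))"
    by (rule sum.cong[OF refl]) (use left hat_ps in auto)
  also have "\<dots> = mat_form n (form_mat b hats) c d"
    unfolding mat_form_def
    by (auto simp: form_mat_def sum_distrib_left mult_ac intro!: sum.cong)
  finally show ?thesis by simp
qed

text \<open>Supplies the solution of the coarse problem: in nodal coordinates the variational
  equation becomes a system with a positive definite, hence invertible, matrix.\<close>

lemma riesz:
  assumes lin: "\<And>v. v \<in> P1_zero T \<Longrightarrow> linear_form_on (P1_zero T) (\<lambda>u. b u v)"
    and sym: "\<And>u v. u \<in> P1_zero T \<Longrightarrow> v \<in> P1_zero T \<Longrightarrow> b u v = b v u"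
    and pos: "\<And>u. u \<in> P1_zero T \<Longrightarrow> u \<noteq> (\<lambda>_. 0) \<Longrightarrow> 0 < b u u"
    and f: "linear_form_on (P1_zero T) f"
  shows "\<exists>u\<in>P1_zero T. \<forall>v\<in>P1_zero T. b u v = f v"
proof -
  define S where "S = form_mat b hats"
  have S: "S \<in> carrier_mat n n" by (simp add: S_def form_mat_def)
  have Spos: "0 < v \<bullet> (S *\<^sub>v v)" if v: "v \<in> carrier_vec n" "v \<noteq> 0\<^sub>v n" for v
  proof -
    have "comb (vec_index v) \<noteq> (\<lambda>_. 0)"
      using comb_eq_0[OF v(1)] v(2) by blast
    then have "0 < b (comb (vec_index v)) (comb (vec_index v))" by (rule pos[OF comb_P1_zero])
    then show ?thesis
      using form_comb[OF lin sym, of "vec_index v" "vec_index v"] mat_form_eq_scalar_prod[OF S v(1) v(1)]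
      by (simp add: S_def)
  qed
  note inv = inv_mat_pos_def[OF S Spos]
  define y where "y = vec n (\<lambda>r. f (hat T (ps ! r)))"
  have y: "y \<in> carrier_vec n" by (simp add: y_def)
  define x where "x = inv_mat S *\<^sub>v y"
  have x: "x \<in> carrier_vec n" unfolding x_def using inv(2) y by auto
  have Sx: "S *\<^sub>v x = y"
    unfolding x_def using assoc_mult_mat_vec[OF S inv(2) y] inv(1) y by simp
  define u where "u = comb (vec_index x)"
  have hat_eq: "b u (hat T (ps ! r)) = f (hat T (ps ! r))" if r: "r < n" for r
  proof -
    have "b u (hat T (ps ! r)) = (\<Sum>s<n. vec_index x s * b (hat T (ps ! s)) (hat T (ps ! r)))"
      unfolding u_def comb_def by (rule linear_form_onD[OF lin[OF hat_ps[OF r]] hat_ps])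
    also have "\<dots> = vec_index (S *\<^sub>v x) r"
      using r x by (auto simp: S_def form_mat_def scalar_prod_def lessThan_atLeast0 mult.commute intro!: sum.cong)
    finally show ?thesis using r by (simp add: Sx y_def)
  qed
  have "b u v = f v" if v: "v \<in> P1_zero T" for v
  proof -
    have u: "u \<in> P1_zero T" by (simp add: u_def comb_P1_zero)
    have v_eq: "v = (\<lambda>x. \<Sum>r<n. v (ps ! r) * hat T (ps ! r) x)" using comb_values[OF v] by (simp add: comb_def)
    have "b u v = b v u" by (rule sym[OF u v])
    also have "\<dots> = (\<Sum>r<n. v (ps ! r) * b (hat T (ps ! r)) u)"
    proof -
      have "b v u = b (\<lambda>x. \<Sum>r<n. v (ps ! r) * hat T (ps ! r) x) u" by (rule arg_cong[OF v_eq])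
      also have "\<dots> = (\<Sum>r<n. v (ps ! r) * b (hat T (ps ! r)) u)"
        by (rule linear_form_onD[OF lin[OF u] hat_ps])
      finally show ?thesis .
    qed
    also have "\<dots> = (\<Sum>r<n. v (ps ! r) * f (hat T (ps ! r)))"
      using hat_eq sym[OF hat_ps u] by simp
    also have "\<dots> = f v"
    proof -
      have "f v = f (\<lambda>x. \<Sum>r<n. v (ps ! r) * hat T (ps ! r) x)" by (rule arg_cong[OF v_eq])
      also have "\<dots> = (\<Sum>r<n. v (ps ! r) * f (hat T (ps ! r)))"
        by (rule linear_form_onD[OF f hat_ps])
      finally show ?thesis by simp
    qed
    finally show ?thesis .
  qed
  then show ?thesis using comb_P1_zero u_def by blast
qed

end

section \<open>The auxiliary projection\<close>

lemma linear_form_on_diff: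
  assumes f: "linear_form_on V f" and u: "u \<in> V" "v \<in> V"
  shows "f (\<lambda>x. u x - v x) = f u - f v"
proof -
  have "f (\<lambda>x. \<Sum>i<(2::nat). (if i = 0 then 1 else -1) * (if i = 0 then u else v) x)
      = (\<Sum>i<(2::nat). (if i = 0 then 1 else -1) * f (if i = 0 then u else v))"
    by (rule linear_form_onD[OF f]) (use u in auto)
  then show ?thesis by (simp add: numeral_2_eq_2)
qed

text \<open>Only semidefiniteness is asked, since \<open>mean_form\<close> may vanish on nonzero
  functions; Young's inequality survives this.\<close>

locale form_on =
  fixes V :: "('a \<Rightarrow> real) set" and b :: "('a \<Rightarrow> real) \<Rightarrow> ('a \<Rightarrow> real) \<Rightarrow> real"
  assumes lin: "\<And>v. v \<in> V \<Longrightarrow> linear_form_on V (\<lambda>u. b u v)"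
    and sym: "\<And>u v. u \<in> V \<Longrightarrow> v \<in> V \<Longrightarrow> b u v = b v u"
    and nonneg: "\<And>u. u \<in> V \<Longrightarrow> 0 \<le> b u u"
    and diff_closed: "\<And>u v. u \<in> V \<Longrightarrow> v \<in> V \<Longrightarrow> (\<lambda>x. u x - v x) \<in> V"
begin

lemma diff_left: "u \<in> V \<Longrightarrow> v \<in> V \<Longrightarrow> z \<in> V \<Longrightarrow> b (\<lambda>x. u x - v x) z = b u z - b v z"
  using linear_form_on_diff[OF lin] .

lemma diff_diff: "u \<in> V \<Longrightarrow> v \<in> V \<Longrightarrow> b (\<lambda>x. u x - v x) (\<lambda>x. u x - v x) = b u u - 2 * b u v + b v v"
  using diff_left[of u v "\<lambda>x. u x - v x"] diff_left[of u v u] diff_left[of u v v]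
    sym[of u "\<lambda>x. u x - v x"] sym[of v "\<lambda>x. u x - v x"] sym[of u v] diff_closed
  by simp

lemma young: "u \<in> V \<Longrightarrow> v \<in> V \<Longrightarrow> 2 * b u v \<le> b u u + b v v"
  using diff_diff[of u v] nonneg[OF diff_closed[of u v]] by simp

lemma young': "u \<in> V \<Longrightarrow> v \<in> V \<Longrightarrow> - 2 * b u v \<le> b u u + b v v"
proof -
  assume uv: "u \<in> V" "v \<in> V"
  have z: "(\<lambda>x. v x - v x) \<in> V" using uv diff_closed by blast
  \<comment> \<open>Closure of V is postulated for differences, so the negative of v is written as a
    difference.\<close>
  let ?v = "\<lambda>x. (v x - v x) - v x"
  have v': "?v \<in> V" by (rule diff_closed[OF z uv(2)])
  have 1: "b ?v y = - b v y" if "y \<in> V" for y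
    using diff_left[OF z uv(2) that] diff_left[OF uv(2) uv(2) that] by simp
  have "b u ?v = - b u v" using sym[OF uv(1) v'] 1[OF uv(1)] sym[OF uv] by simp
  moreover have "b ?v ?v = b v v" using 1[OF v'] 1[OF uv(2)] sym[OF uv(2) v'] by simp
  ultimately show ?thesis using young[OF uv(1) v'] by simp
qed

lemma diff_le: "u \<in> V \<Longrightarrow> v \<in> V \<Longrightarrow> b (\<lambda>x. u x - v x) (\<lambda>x. u x - v x) \<le> 2 * b u u + 2 * b v v"
  using diff_diff[of u v] young'[of u v] by simp

end

lemma (in simplicial) P1_zero_diff: "u \<in> P1_zero T \<Longrightarrow> v \<in> P1_zero T \<Longrightarrow> (\<lambda>x. u x - v x) \<in> P1_zero T"
  using P1_zero_sum[of "{..<2::nat}" "\<lambda>i. if i = 0 then u else v" "\<lambda>i. if i = 0 then 1 else -1"]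
  by (simp add: numeral_2_eq_2)

context weighted_mesh
begin

lemma a_form_on: "form_on (P1_zero T) a"
proof
  show "linear_form_on (P1_zero T) (\<lambda>u. a u v)" if "v \<in> P1_zero T" for v
    unfolding linear_form_on_def using that
    by (auto intro!: a_sum P1_zero_pw_smooth)
qed (auto intro: a_commute a_nonneg P1_zero_diff)

lemma m_form_on: "form_on (P1_zero T) m"
proof
  show "linear_form_on (P1_zero T) (\<lambda>u. m u v)" if "v \<in> P1_zero T" for v
    unfolding linear_form_on_def using that
    by (auto intro!: m_sum pw_smoothD(1) P1_zero_pw_smooth)
qed (auto intro: m_commute m_nonneg P1_zero_diff)

lemma form_on_weighted_add:
  assumes b: "form_on V b" and c: "form_on V c" and "0 \<le> s"
  shows "form_on V (\<lambda>u v. s * b u v + c u v)"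
proof -
  interpret b: form_on V b by (rule b)
  interpret c: form_on V c by (rule c)
  show ?thesis
  proof
    show "linear_form_on V (\<lambda>u. s * b u v + c u v)" if v: "v \<in> V" for v
      unfolding linear_form_on_def
      using linear_form_onD[OF b.lin[OF v]] linear_form_onD[OF c.lin[OF v]]
      by (auto simp: sum.distrib sum_distrib_left algebra_simps)
    show "0 \<le> s * b u u + c u u" if "u \<in> V" for u
      using b.nonneg[OF that] c.nonneg[OF that] \<open>0 \<le> s\<close> by simp
  qed (auto simp: b.sym c.sym intro: b.diff_closed)
qed

lemma w_cong_AE:
  assumes "ess_bdd u" "ess_bdd u'" "ess_bdd v" "ess_bdd v'"
    and "AE x in M. u x = u' x" "AE x in M. v x = v' x"
  shows "w u v = w u' v'"
  unfolding w_def
proof (rule integral_cong_AE)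
  show "AE x in M. \<kappa> x * (u x * v x) = \<kappa> x * (u' x * v' x)"
    using assms(5,6) by eventually_elim simp
qed (intro borel_measurable_integrable weighted_integrable ess_bdd_mult assms)+

lemma w_diff_right:
  assumes "ess_bdd u" "ess_bdd v" "ess_bdd z"
  shows "w u (\<lambda>x. v x - z x) = w u v - w u z"
proof -
  have "w u (\<lambda>x. v x - z x) = (LINT x|M. \<kappa> x * (u x * v x) - \<kappa> x * (u x * z x))"
    unfolding w_def by (simp add: algebra_simps)
  also have "\<dots> = w u v - w u z"
    unfolding w_def
    by (rule Bochner_Integration.integral_diff) (intro weighted_integrable ess_bdd_mult assms)+
  finally show ?thesis .
qed

end

text \<open>Disjointness is asked off the skeleton, where a point determines its fine element and
  with it the coarse element; the integrals do not see the rest.\<close>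

locale disjoint_sets = weighted_mesh +
  fixes J :: "'k set" and D :: "'k \<Rightarrow> 'a set"
  assumes finite_J: "finite J" and D_sets: "\<And>k. k \<in> J \<Longrightarrow> D k \<in> sets lebesgue"
    and D_disjoint: "\<And>k l x. k \<in> J \<Longrightarrow> l \<in> J \<Longrightarrow> x \<in> open_cells \<Longrightarrow> x \<in> D k \<Longrightarrow> x \<in> D l \<Longrightarrow> k = l"
begin

abbreviation ind :: "'k \<Rightarrow> 'a \<Rightarrow> real" where "ind k \<equiv> indicat_real (D k)"

definition step :: "('k \<Rightarrow> real) \<Rightarrow> 'a \<Rightarrow> real" where
  "step c = (\<lambda>x. \<Sum>k\<in>J. c k * ind k x)"

definition moment :: "'k \<Rightarrow> ('a \<Rightarrow> real) \<Rightarrow> real" where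
  "moment k u = w (ind k) u"

definition vol :: "'k \<Rightarrow> real" where
  "vol k = w (ind k) (ind k)"

text \<open>The \<kappa>-weighted mean over \<open>D k\<close>, which is the coefficient of the
  projection. On a null component, such as an empty low part, the quotient is 0 by convention, and
  \<open>mean_vol\<close> still holds because the moment vanishes too.\<close>

definition mean :: "'k \<Rightarrow> ('a \<Rightarrow> real) \<Rightarrow> real" where
  "mean k u = moment k u / vol k"

text \<open>The indicators are w-orthogonal, so for K = J this is the w-product of the two
  projections (\<open>w_step_means\<close>). A smaller K keeps the contribution of some of the
  components, later the low ones.\<close>

definition mean_form :: "'k set \<Rightarrow> ('a \<Rightarrow> real) \<Rightarrow> ('a \<Rightarrow> real) \<Rightarrow> real" where
  "mean_form K u v = (\<Sum>k\<in>K. mean k u * moment k v)"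

lemma ess_bdd_ind: "k \<in> J \<Longrightarrow> ess_bdd (ind k)"
  by (rule ess_bdd_indicator[OF D_sets])

lemma ess_bdd_step: "ess_bdd (step c)"
  unfolding step_def by (intro ess_bdd_intros ess_bdd_ind)

lemma w_ind_ind: "k \<in> J \<Longrightarrow> l \<in> J \<Longrightarrow> k \<noteq> l \<Longrightarrow> w (ind k) (ind l) = 0"
  unfolding w_def
proof (rule integral_eq_zero_AE)
  assume kl: "k \<in> J" "l \<in> J" "k \<noteq> l"
  show "AE x in M. perm x * (ind k x * ind l x) = 0" for perm
    using AE_open_cells
  proof eventually_elim
    case (elim x)
    then show ?case using D_disjoint[OF kl(1,2) elim] kl(3) by (auto simp: indicator_def)
  qed
qed

lemma w_step: "ess_bdd u \<Longrightarrow> w (step c) u = (\<Sum>k\<in>J. c k * moment k u)"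
  unfolding step_def moment_def by (rule w_sum) (auto intro: ess_bdd_ind)

lemma moment_step:
  assumes k: "k \<in> J"
  shows "moment k (step c) = c k * vol k"
proof -
  have "moment k (step c) = w (step c) (ind k)" by (simp add: moment_def w_commute)
  also have "\<dots> = (\<Sum>l\<in>J. if l = k then c k * vol k else 0)"
    unfolding w_step[OF ess_bdd_ind[OF k]]
    by (rule sum.cong) (use k w_ind_ind in \<open>auto simp: moment_def vol_def\<close>)
  finally show ?thesis using k finite_J by simp
qed

lemma vol_zero:
  assumes k: "k \<in> J" and "vol k = 0"
  shows "AE x in M. x \<notin> D k" "moment k u = 0"
proof -
  have "m (ind k) (ind k) = 0"
    using m_le_w[OF ess_bdd_ind[OF k]] m_nonneg[of "ind k"] assms(2) k0
    by (simp add: vol_def mult_le_0_iff)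
  then have "(LINT x|M. ind k x * ind k x) = 0" by (simp add: l2_form_def)
  moreover have "integrable M (\<lambda>x. ind k x * ind k x)"
    by (intro ess_bdd_integrable ess_bdd_mult ess_bdd_ind k)
  ultimately have "AE x in M. ind k x * ind k x = 0"
    by (subst (asm) integral_nonneg_eq_0_iff_AE) auto
  then show *: "AE x in M. x \<notin> D k" by eventually_elim (auto simp: indicator_def)
  show "moment k u = 0"
    unfolding moment_def w_def
    by (rule integral_eq_zero_AE) (use * in \<open>eventually_elim, simp\<close>)
qed

lemma mean_vol: "k \<in> J \<Longrightarrow> mean k u * vol k = moment k u"
  using vol_zero(2)[of k u] by (simp add: mean_def)

lemma moment_sum:
  assumes "k \<in> J" "\<And>i. i \<in> I \<Longrightarrow> ess_bdd (f i)"
  shows "moment k (\<lambda>x. \<Sum>i\<in>I. c i * f i x) = (\<Sum>i\<in>I. c i * moment k (f i))"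
  unfolding moment_def w_commute[of "ind k"] by (rule w_sum[OF assms(2) ess_bdd_ind[OF assms(1)]])

lemma mean_form_on:
  assumes K: "K \<subseteq> J"
  shows "form_on (P1_zero T) (mean_form K)"
proof
  show "linear_form_on (P1_zero T) (\<lambda>u. mean_form K u v)" for v
    unfolding linear_form_on_def
  proof (intro allI impI)
    fix n :: nat and c :: "nat \<Rightarrow> real" and g :: "nat \<Rightarrow> 'a \<Rightarrow> real"
    assume g: "\<forall>i<n. g i \<in> P1_zero T"
    have "mean k (\<lambda>x. \<Sum>i<n. c i * g i x) = (\<Sum>i<n. c i * mean k (g i))" if "k \<in> K" for k
    proof -
      have "moment k (\<lambda>x. \<Sum>i<n. c i * g i x) = (\<Sum>i<n. c i * moment k (g i))"
        by (rule moment_sum) (use that K g in \<open>auto intro: pw_smoothD(1) P1_zero_pw_smooth\<close>)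
      then show ?thesis by (simp add: mean_def sum_divide_distrib)
    qed
    then have "mean_form K (\<lambda>x. \<Sum>i<n. c i * g i x) v = (\<Sum>k\<in>K. \<Sum>i<n. c i * (mean k (g i) * moment k v))"
      by (simp add: mean_form_def sum_distrib_right mult.assoc)
    also have "\<dots> = (\<Sum>i<n. c i * mean_form K (g i) v)"
      unfolding mean_form_def sum_distrib_left by (rule sum.swap)
    finally show "mean_form K (\<lambda>x. \<Sum>i<n. c i * g i x) v = (\<Sum>i<n. c i * mean_form K (g i) v)" .
  qed
  show "mean_form K u v = mean_form K v u" for u v
    by (simp add: mean_form_def mean_def mult.commute)
  have "0 \<le> vol k" for k unfolding vol_def by (rule w_nonneg)
  then show "0 \<le> mean_form K u u" for u
    by (auto simp: mean_form_def mean_def intro!: sum_nonneg divide_nonneg_nonneg)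
qed (rule P1_zero_diff)

lemma mean_form_mono: "K \<subseteq> J \<Longrightarrow> mean_form K u u \<le> mean_form J u u"
proof -
  assume K: "K \<subseteq> J"
  have "0 \<le> vol k" for k unfolding vol_def by (rule w_nonneg)
  then show ?thesis
    unfolding mean_form_def
    by (intro sum_mono2 finite_J K) (auto simp: mean_def intro!: divide_nonneg_nonneg)
qed

lemma w_step_means: "w (step (\<lambda>k. mean k u)) (step (\<lambda>k. mean k v)) = mean_form J u v"
  unfolding w_step[OF ess_bdd_step] mean_form_def
  by (rule sum.cong) (auto simp: moment_step mean_vol)

lemma w_step_step_means: "w (step c) (step (\<lambda>k. mean k v)) = (\<Sum>k\<in>J. c k * moment k v)"
  unfolding w_step[OF ess_bdd_step]
  by (rule sum.cong) (auto simp: moment_step mean_vol)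

lemma projection_orthogonal:
  assumes u: "ess_bdd u"
  shows "w (\<lambda>x. u x - step (\<lambda>k. mean k u) x) (step d) = 0"
proof -
  have "w (\<lambda>x. u x - step (\<lambda>k. mean k u) x) (step d) = w (step d) (\<lambda>x. u x - step (\<lambda>k. mean k u) x)"
    by (rule w_commute)
  also have "\<dots> = w (step d) u - w (step d) (step (\<lambda>k. mean k u))"
    by (rule w_diff_right[OF ess_bdd_step u ess_bdd_step])
  finally show ?thesis by (simp add: w_step_step_means w_step[OF u])
qed

text \<open>Testing with single indicators determines each coefficient whose component has positive
  measure. The others remain free, whence equality almost everywhere only.\<close>

lemma projection_unique:
  assumes u: "ess_bdd u" and orth: "\<And>d. w (\<lambda>x. u x - step c x) (step d) = 0"
  shows "AE x in M. step c x = step (\<lambda>k. mean k u) x"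
proof -
  have eq: "c k * vol k = moment k u" if k: "k \<in> J" for k
  proof -
    have "step (\<lambda>l. if l = k then 1 else 0) = ind k"
      unfolding step_def using k finite_J
      by (auto simp: fun_eq_iff if_distrib[where f = "\<lambda>r. r * _"] cong: if_cong)
    then have "0 = w (ind k) (\<lambda>x. u x - step c x)"
      using orth[of "\<lambda>l. if l = k then 1 else 0"] by (simp add: w_commute)
    also have "\<dots> = moment k u - moment k (step c)"
      unfolding moment_def by (rule w_diff_right[OF ess_bdd_ind[OF k] u ess_bdd_step])
    finally show ?thesis by (simp add: moment_step[OF k])
  qed
  have "AE x in M. \<forall>k\<in>J. c k * ind k x = mean k u * ind k x"
  proof (rule AE_finite_allI[OF finite_J])
    fix k assume k: "k \<in> J"
    show "AE x in M. c k * ind k x = mean k u * ind k x"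
    proof (cases "vol k = 0")
      case True
      show ?thesis using vol_zero(1)[OF k True] by eventually_elim simp
    next
      case False
      then have "c k = mean k u" using eq[OF k] by (simp add: mean_def field_simps)
      then show ?thesis by simp
    qed
  qed
  then show ?thesis unfolding step_def by eventually_elim (auto intro: sum.cong)
qed

text \<open>Expand the nonnegative weighted variance of u over \<open>D k\<close>;
  \<open>mean_vol\<close> merges its quadratic and linear terms without dividing by a possibly zero
  volume.\<close>

lemma mean_moment_le:
  assumes k: "k \<in> J" and u: "ess_bdd u"
  shows "mean k u * moment k u \<le> w (ind k) (\<lambda>x. u x * u x)"
proof -
  let ?\<mu> = "mean k u"
  have eb: "ess_bdd (\<lambda>x. ind k x * (u x * u x))" "ess_bdd (\<lambda>x. ind k x * u x)"
    by (intro ess_bdd_mult ess_bdd_ind k u)+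
  have "0 \<le> (LINT x|M. \<kappa> x * (ind k x * (u x - ?\<mu>)\<^sup>2))" by (rule weighted_nonneg) simp
  also have "\<dots> = (LINT x|M. \<kappa> x * ((ind k x * (u x * u x) + (- 2 * ?\<mu>) * (ind k x * u x)) + ?\<mu>\<^sup>2 * (ind k x * ind k x)))"
    by (rule Bochner_Integration.integral_cong) (auto simp: power2_eq_square algebra_simps indicator_def)
  also have "\<dots> = (LINT x|M. \<kappa> x * (ind k x * (u x * u x) + (- 2 * ?\<mu>) * (ind k x * u x)))
      + (LINT x|M. \<kappa> x * (?\<mu>\<^sup>2 * (ind k x * ind k x)))"
    by (intro weighted_add ess_bdd_intros eb ess_bdd_ind k)
  also have "(LINT x|M. \<kappa> x * (ind k x * (u x * u x) + (- 2 * ?\<mu>) * (ind k x * u x)))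
      = (LINT x|M. \<kappa> x * (ind k x * (u x * u x))) + (LINT x|M. \<kappa> x * ((- 2 * ?\<mu>) * (ind k x * u x)))"
    by (intro weighted_add ess_bdd_mult[OF ess_bdd_const] eb)
  also have "\<dots> + (LINT x|M. \<kappa> x * (?\<mu>\<^sup>2 * (ind k x * ind k x)))
      = w (ind k) (\<lambda>x. u x * u x) + (- 2 * ?\<mu>) * moment k u + ?\<mu>\<^sup>2 * vol k"
    unfolding moment_def vol_def w_def weighted_scale ..
  also have "?\<mu>\<^sup>2 * vol k = ?\<mu> * moment k u"
    using mean_vol[OF k, of u] by (simp add: power2_eq_square mult.assoc)
  finally show ?thesis by simp
qed

lemma sum_ind_le_1:
  assumes K: "K \<subseteq> J" and x: "x \<in> open_cells"
  shows "(\<Sum>k\<in>K. ind k x) \<le> 1"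
proof (cases "\<exists>k\<in>K. x \<in> D k")
  case True
  then obtain k where k: "k \<in> K" "x \<in> D k" by blast
  have "ind l x = (if l = k then 1 else 0)" if "l \<in> K" for l
    using D_disjoint[of l k x] that k K x by (auto simp: indicator_def)
  then have "(\<Sum>l\<in>K. ind l x) = (\<Sum>l\<in>K. if l = k then 1 else 0)" by (intro sum.cong) auto
  then show ?thesis using k(1) finite_subset[OF K finite_J] by simp
next
  case False
  then have "(\<Sum>k\<in>K. ind k x) = 0" by (intro sum.neutral) auto
  then show ?thesis by simp
qed

text \<open>Projection shrinks the weighted norm on each component, and there \<kappa> may be
  replaced by B. This is the passage from weighted norm to mass for the low components.\<close>

lemma mean_form_bound:
  assumes K: "K \<subseteq> J" and u: "ess_bdd u" and B: "0 \<le> B"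
    and bound: "\<And>k. k \<in> K \<Longrightarrow> AE x in M. x \<in> D k \<longrightarrow> \<kappa> x \<le> B"
  shows "mean_form K u u \<le> B * m u u"
proof -
  have "mean_form K u u \<le> (\<Sum>k\<in>K. w (ind k) (\<lambda>x. u x * u x))"
    unfolding mean_form_def by (rule sum_mono) (use K in \<open>auto intro: mean_moment_le[OF _ u]\<close>)
  also have "\<dots> = (LINT x|M. \<kappa> x * (\<Sum>k\<in>K. ind k x * (u x * u x)))"
    unfolding w_def
    by (rule weighted_sum[symmetric]) (use K in \<open>auto intro!: ess_bdd_mult ess_bdd_ind u\<close>)
  also have "\<dots> \<le> (LINT x|M. B * (u x * u x))"
  proof (rule integral_mono_AE)
    show "integrable M (\<lambda>x. \<kappa> x * (\<Sum>k\<in>K. ind k x * (u x * u x)))"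
      by (rule weighted_integrable) (use K in \<open>auto intro!: ess_bdd_intros ess_bdd_ind u\<close>)
    show "integrable M (\<lambda>x. B * (u x * u x))"
      by (intro ess_bdd_integrable ess_bdd_intros u)
    have "AE x in M. \<forall>k\<in>K. x \<in> D k \<longrightarrow> \<kappa> x \<le> B"
      by (rule AE_finite_allI[OF finite_subset[OF K finite_J] bound])
    then show "AE x in M. \<kappa> x * (\<Sum>k\<in>K. ind k x * (u x * u x)) \<le> B * (u x * u x)"
      using AE_open_cells
    proof eventually_elim
      case (elim x)
      have "\<kappa> x * (\<Sum>k\<in>K. ind k x * (u x * u x)) = (\<Sum>k\<in>K. \<kappa> x * (ind k x * (u x * u x)))"
        by (rule sum_distrib_left)
      also have "\<dots> \<le> (\<Sum>k\<in>K. B * (ind k x * (u x * u x)))"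
      proof (rule sum_mono)
        fix k assume "k \<in> K"
        then show "\<kappa> x * (ind k x * (u x * u x)) \<le> B * (ind k x * (u x * u x))"
          using elim(1) by (cases "x \<in> D k") (auto intro: mult_right_mono)
      qed
      also have "\<dots> = (\<Sum>k\<in>K. ind k x) * (B * (u x * u x))"
        by (simp add: sum_distrib_right sum_distrib_left mult_ac)
      also have "\<dots> \<le> 1 * (B * (u x * u x))"
        by (rule mult_right_mono[OF sum_ind_le_1[OF K elim(2)]]) (simp add: B)
      finally show ?case by simp
    qed
  qed
  also have "\<dots> = B * m u u" by (simp add: l2_form_def)
  finally show ?thesis .
qed

end

section \<open>The stable decomposition\<close>

lemma (in simplicial) P1_mult_quadratic:
  assumes u: "u \<in> P1 T" and v: "v \<in> P1 T"
  shows "piecewise_quadratic T (\<lambda>x. u x * v x)"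
  unfolding piecewise_quadratic_def
proof (intro conjI ballI)
  show "continuous_on (\<Union>T) (\<lambda>x. u x * v x)"
    using u v by (intro continuous_intros) (auto simp: P1_def)
  fix S assume S: "S \<in> T"
  obtain b c where u': "\<And>x. x \<in> S \<Longrightarrow> u x = inner b x + c" using P1_affine[OF u S] by blast
  obtain b' c' where v': "\<And>x. x \<in> S \<Longrightarrow> v x = inner b' x + c'" using P1_affine[OF v S] by blast
  let ?Q = "\<lambda>x. inner b x *\<^sub>R b'"
  have "linear ?Q" by (rule linearI) (auto simp: inner_add_right scaleR_add_left)
  moreover have "u x * v x = inner (?Q x) x + inner (c' *\<^sub>R b + c *\<^sub>R b') x + c * c'" if "x \<in> S" for x
    using u'[OF that] v'[OF that] by (simp add: inner_add_left algebra_simps)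
  ultimately show "\<exists>Q b c. linear Q \<and> (\<forall>x\<in>S. u x * v x = inner (Q x) x + inner b x + c)"
    by blast
qed

lemma add_layer_subset: "C \<subseteq> T \<Longrightarrow> (add_layer T ^^ n) C \<subseteq> T"
  by (cases n) (auto simp: add_layer_def)

locale two_level =
  fixes P :: "'a::euclidean_space discretisation" and U :: "'a set"
    and CP Cpi CI Cchi kb ct Ct :: real and No :: nat
  assumes meshes: "meshes P U" and U: "U \<noteq> {}"
    and coefficient: "coefficient_bounds P"
    and high: "high_components P CP" and kappa0: "kappa0 P \<le> kb"
    and projection: "projection_estimate P Cpi"
    and cover: "overlapping_cover P No" and pou: "partition_of_unity P Cchi"
    and interpolation: "interpolation_stable P CI"
    and bases: "matrix_bases P"
    and time_step: "0 < time_step P" "ct * (coarse_size P)\<^sup>2 \<le> time_step P"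
      "time_step P \<le> Ct * (coarse_size P)\<^sup>2" and ct: "0 < ct"

sublocale two_level \<subseteq> weighted_mesh "fine_mesh P" "perm P" "perm_min P" "perm_max P"
proof
  show "triangulation (fine_mesh P)" "\<And>S. S \<in> fine_mesh P \<Longrightarrow> int DIM('a) simplex S"
    using meshes by (auto simp: meshes_def simplicial_mesh_def)
  note c = coefficient[unfolded coefficient_bounds_def region_def]
  show "perm P \<in> borel_measurable (lebesgue_on (interior (\<Union>(fine_mesh P))))"
    by (rule c[THEN conjunct1])
  show "0 < perm_min P" by (rule c[THEN conjunct2, THEN conjunct1])
  show "AE x in lebesgue_on (interior (\<Union>(fine_mesh P))). perm_min P \<le> perm P x \<and> perm P x \<le> perm_max P"
    by (rule c[THEN conjunct2, THEN conjunct2])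
qed

section \<open>Coarse elements and their components\<close>

context two_level
begin

abbreviation N :: nat where "N \<equiv> ncells P"
abbreviation H :: real where "H \<equiv> coarse_size P"

abbreviation cind :: "nat \<Rightarrow> 'a \<Rightarrow> real" where "cind i \<equiv> indicat_real (cell P i)"

lemma region: "region P = \<Omega>"
  by (simp add: region_def)

lemma cell_mesh: "i \<in> {1..N} \<Longrightarrow> cell_mesh P i \<subseteq> fine_mesh P"
  using meshes unfolding meshes_def by blast

lemma cell_open: "open (cell P i)"
  by (simp add: cell_def)

lemma cell_subset: "i \<in> {1..N} \<Longrightarrow> cell P i \<subseteq> \<Omega>"
  unfolding cell_def by (intro interior_mono Union_mono cell_mesh)

lemma cell_nonempty: "i \<in> {1..N} \<Longrightarrow> cell P i \<noteq> {}"
proof -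
  assume i: "i \<in> {1..N}"
  then obtain S where S: "S \<in> cell_mesh P i" using meshes unfolding meshes_def by blast
  then have "interior S \<subseteq> cell P i" unfolding cell_def by (intro interior_mono) blast
  moreover have "interior S \<noteq> {}" using simplex_interior cell_mesh[OF i] S by blast
  ultimately show ?thesis by blast
qed

lemma N_pos: "1 \<in> {1..N}"
proof -
  have "fine_mesh P \<noteq> {}"
    using meshes U by (auto simp: meshes_def simplicial_mesh_def)
  then have "{1..N} \<noteq> {}" using meshes by (auto simp: meshes_def)
  then show ?thesis by simp
qed

lemma H_pos: "0 < H"
proof -
  obtain x where x: "x \<in> cell P 1" using cell_nonempty[OF N_pos] by blast
  obtain r where r: "0 < r" "ball x r \<subseteq> cell P 1" using cell_open x openE by blast
  obtain b :: 'a where b: "b \<in> Basis" using nonempty_Basis by blast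
  let ?y = "x + (r / 2) *\<^sub>R b"
  have xy: "dist x ?y = r / 2" using r b by (simp add: dist_norm)
  then have "?y \<in> cell P 1" using r by (auto intro: subsetD[OF r(2)])
  moreover have "bounded (cell P 1)" using bounded_\<Omega> cell_subset[OF N_pos] bounded_subset by blast
  ultimately have "dist x ?y \<le> diameter (cell P 1)" using x by (intro diameter_bounded_bound)
  also have "\<dots> \<le> Max ((\<lambda>i. diameter (cell P i)) ` {1..N})"
    by (rule Max_ge) (use N_pos in auto)
  also have "\<dots> = H" using meshes by (simp add: meshes_def)
  finally show ?thesis using xy r by simp
qed

text \<open>Off the skeleton, membership in an open coarse cell becomes a combinatorial question
  about fine elements.\<close>

lemma cell_mem_iff:
  assumes "S \<in> fine_mesh P" "x \<in> interior S" "i \<in> {1..N}"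
  shows "x \<in> cell P i \<longleftrightarrow> S \<in> cell_mesh P i"
proof
  show "S \<in> cell_mesh P i" if "x \<in> cell P i"
    using interior_in_subset[OF cell_mesh[OF assms(3)] assms(1,2)] that by (simp add: cell_def)
  show "x \<in> cell P i" if "S \<in> cell_mesh P i"
    using interior_mono[of S "\<Union>(cell_mesh P i)"] that assms(2) by (auto simp: cell_def)
qed

lemma cell_unique: "x \<in> open_cells \<Longrightarrow> i \<in> {1..N} \<Longrightarrow> j \<in> {1..N} \<Longrightarrow> x \<in> cell P i \<Longrightarrow> x \<in> cell P j \<Longrightarrow> i = j"
proof -
  assume x: "x \<in> open_cells" and ij: "i \<in> {1..N}" "j \<in> {1..N}" and xc: "x \<in> cell P i" "x \<in> cell P j"
  obtain S where S: "S \<in> fine_mesh P" "x \<in> interior S" using x by (auto simp: open_cells_def)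
  have "S \<in> cell_mesh P i" "S \<in> cell_mesh P j" using cell_mem_iff[OF S] ij xc by auto
  moreover have "disjoint_family_on (cell_mesh P) {1..N}" using meshes by (simp add: meshes_def)
  ultimately show "i = j" using ij unfolding disjoint_family_on_def by blast
qed

lemma sum_cells: "x \<in> open_cells \<Longrightarrow> (\<Sum>i=1..N. cind i x) = 1"
proof -
  assume x: "x \<in> open_cells"
  obtain S where S: "S \<in> fine_mesh P" "x \<in> interior S" using x by (auto simp: open_cells_def)
  then obtain i where i: "i \<in> {1..N}" "S \<in> cell_mesh P i" using meshes unfolding meshes_def by blast
  then have xi: "x \<in> cell P i" using cell_mem_iff[OF S] by blast
  have "cind j x = (if j = i then 1 else 0)" if "j \<in> {1..N}" for j
  proof (cases "x \<in> cell P j")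
    case True
    then have "j = i" by (rule cell_unique[OF x that i(1) _ xi])
    then show ?thesis using xi by simp
  next
    case False
    then have "j \<noteq> i" using xi by blast
    then show ?thesis using False by simp
  qed
  then have "(\<Sum>j=1..N. cind j x) = (\<Sum>j=1..N. if j = i then 1 else 0)"
    by (intro sum.cong) auto
  then show ?thesis using i(1) by simp
qed

text \<open>The components of all coarse elements, with the low-permeability one at index 0.\<close>

definition component :: "nat \<times> nat \<Rightarrow> 'a set" where
  "component k = (if snd k = 0 then low P (fst k) else high P (fst k) (snd k))"

definition J :: "(nat \<times> nat) set" where
  "J = Sigma {1..N} (\<lambda>i. {0..nhigh P i})"

definition J_low :: "(nat \<times> nat) set" where
  "J_low = {1..N} \<times> {0}"

lemma finite_Jset: "finite J"
  by (simp add: J_def)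

lemma J_low_subset: "J_low \<subseteq> J"
  by (auto simp: J_def J_low_def)

lemma high_components:
  assumes i: "i \<in> {1..N}"
  shows "j \<in> {1..nhigh P i} \<Longrightarrow> open (high P i j)" "j \<in> {1..nhigh P i} \<Longrightarrow> high P i j \<subseteq> cell P i"
    "disjoint_family_on (high P i) {1..nhigh P i}" "ess_max (low P i) (perm P) < ereal (kappa0 P)"
proof -
  note h = bspec[OF high[unfolded high_components_def] i]
  show "disjoint_family_on (high P i) {1..nhigh P i}" by (rule h[THEN conjunct2, THEN conjunct1])
  show "ess_max (low P i) (perm P) < ereal (kappa0 P)" by (rule h[THEN conjunct2, THEN conjunct2])
  assume "j \<in> {1..nhigh P i}"
  note hj = bspec[OF h[THEN conjunct1] this]
  show "open (high P i j)"
    using hj[THEN conjunct2, THEN conjunct2, THEN conjunct1] by (simp add: lipschitz_domain_def)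
  show "high P i j \<subseteq> cell P i"
    by (rule hj[THEN conjunct2, THEN conjunct2, THEN conjunct2, THEN conjunct1])
qed

lemma component_subset: "k \<in> J \<Longrightarrow> component k \<subseteq> cell P (fst k)"
proof -
  assume k: "k \<in> J"
  show ?thesis
  proof (cases "snd k = 0")
    case True
    then show ?thesis by (auto simp: component_def low_def)
  next
    case False
    then have "fst k \<in> {1..N}" "snd k \<in> {1..nhigh P (fst k)}" using k by (auto simp: J_def)
    then have "high P (fst k) (snd k) \<subseteq> cell P (fst k)" by (rule high_components(2))
    then show ?thesis using False by (simp add: component_def)
  qed
qed

lemma component_sets: "k \<in> J \<Longrightarrow> component k \<in> sets lebesgue"
proof -
  assume k: "k \<in> J"
  show ?thesis
  proof (cases "snd k = 0")
    case True
    have "open (\<Union>j\<in>{1..nhigh P (fst k)}. high P (fst k) j)"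
      using high_components(1) k by (auto simp: J_def)
    then show ?thesis using cell_open True by (simp add: component_def low_def sets.Diff)
  next
    case False
    then have "open (component k)" using high_components(1)[of "fst k" "snd k"] k by (auto simp: J_def component_def)
    then show ?thesis by simp
  qed
qed

lemma component_disjoint:
  assumes k: "k \<in> J" and l: "l \<in> J" and x: "x \<in> open_cells" "x \<in> component k" "x \<in> component l"
  shows "k = l"
proof -
  have fst_in: "fst k \<in> {1..N}" "fst l \<in> {1..N}" using k l by (auto simp: J_def)
  have fst_eq: "fst k = fst l"
    by (rule cell_unique[OF x(1) fst_in]) (use component_subset k l x in blast)+
  have disj: "disjoint_family_on (high P (fst k)) {1..nhigh P (fst k)}"
    using fst_in(1) by (rule high_components(3))
  have r: "snd k \<in> {1..nhigh P (fst k)} \<or> snd k = 0" "snd l \<in> {1..nhigh P (fst k)} \<or> snd l = 0"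
    using k l fst_eq by (auto simp: J_def)
  have "snd k = snd l"
  proof (cases "snd k = 0 \<or> snd l = 0")
    case True
    then show ?thesis using r x(2,3) fst_eq by (auto simp: component_def low_def split: if_splits)
  next
    case False
    then have "x \<in> high P (fst k) (snd k)" "x \<in> high P (fst k) (snd l)"
      using x(2,3) fst_eq by (auto simp: component_def)
    then show ?thesis using disj r False unfolding disjoint_family_on_def by blast
  qed
  then show ?thesis using fst_eq by (simp add: prod_eq_iff)
qed

end

sublocale two_level \<subseteq> disjoint_sets "fine_mesh P" "perm P" "perm_min P" "perm_max P" J component
proof
  show "finite J" by (rule finite_Jset)
  show "component k \<in> sets lebesgue" if "k \<in> J" for k by (rule component_sets[OF that])
  show "k = l" if "k \<in> J" "l \<in> J" "x \<in> open_cells" "x \<in> component k" "x \<in> component l" for k l x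
    by (rule component_disjoint[OF that])
qed

section \<open>The auxiliary space and the coarse problem\<close>

context two_level
begin

lemma sum_J: "(\<Sum>k\<in>J. f k) = (\<Sum>i=1..N. f (i, 0) + (\<Sum>j=1..nhigh P i. f (i, j)))" for f :: "nat \<times> nat \<Rightarrow> real"
proof -
  have "(\<Sum>k\<in>J. f k) = (\<Sum>i=1..N. \<Sum>j=0..nhigh P i. f (i, j))"
    unfolding J_def by (subst sum.Sigma) auto
  then show ?thesis by (simp add: sum.atLeast_Suc_atMost)
qed

lemma step_components:
  "step c = (\<lambda>x. (\<Sum>i=1..N. \<Sum>j=1..nhigh P i. c (i, j) * indicat_real (high P i j) x)
     + (\<Sum>i=1..N. c (i, 0) * indicat_real (low P i) x))"
  unfolding step_def sum_J by (rule ext) (simp add: component_def sum.distrib add.commute)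

text \<open>Low coefficients go to index 0. The auxiliary space thereby becomes the span of one
  disjoint family, to which the projection by means applies.\<close>

lemma aux_iff: "\<psi> \<in> aux P \<longleftrightarrow> (\<exists>c. \<psi> = step c)"
proof
  assume "\<psi> \<in> aux P"
  then obtain c1 :: "nat \<Rightarrow> nat \<Rightarrow> real" and c2 :: "nat \<Rightarrow> real" where
    c: "\<psi> = (\<lambda>x. (\<Sum>i=1..N. \<Sum>j=1..nhigh P i. c1 i j * indicat_real (high P i j) x)
        + (\<Sum>i=1..N. c2 i * indicat_real (low P i) x))"
    by (auto simp: aux_def aux1_def aux2_def)
  have "\<psi> = step (\<lambda>(i, j). if j = 0 then c2 i else c1 i j)"
    unfolding c step_components by simp
  then show "\<exists>c. \<psi> = step c" by blast
next
  assume "\<exists>c. \<psi> = step c"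
  then obtain c where "\<psi> = step c" by blast
  then show "\<psi> \<in> aux P"
    unfolding aux_def step_components
    by (intro CollectI exI[of _ "\<lambda>x. \<Sum>i=1..N. \<Sum>j=1..nhigh P i. c (i, j) * indicat_real (high P i j) x"]
        exI[of _ "\<lambda>x. \<Sum>i=1..N. c (i, 0) * indicat_real (low P i) x"])
      (auto simp: aux1_def aux2_def)
qed

lemma step_aux1: "(\<And>k. k \<in> J_low \<Longrightarrow> c k = 0) \<Longrightarrow> step c \<in> aux1 P"
  unfolding aux1_def step_components
  by (intro CollectI exI[of _ "\<lambda>i j. c (i, j)"]) (simp add: J_low_def)

lemma s_glob_eq: "s_glob P u v = w u v / H\<^sup>2"
  by (simp add: region s_form_eq)

text \<open>\<open>aux_proj\<close> is a choice that leaves null sets open. The explicit projection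
  by means shows that a choice exists and fixes its values almost everywhere, which is enough for
  all integrals.\<close>

lemma aux_proj:
  assumes u: "ess_bdd u"
  shows "ess_bdd (aux_proj P u)" "AE x in M. aux_proj P u x = step (\<lambda>k. mean k u) x"
proof -
  have "\<exists>\<psi>. \<psi> \<in> aux P \<and> (\<forall>\<phi>\<in>aux P. s_glob P (\<lambda>x. u x - \<psi> x) \<phi> = 0)"
    by (rule exI[of _ "step (\<lambda>k. mean k u)"]) (auto simp: aux_iff s_glob_eq projection_orthogonal[OF u])
  from someI_ex[OF this] have 1: "aux_proj P u \<in> aux P"
    and 2: "\<And>\<phi>. \<phi> \<in> aux P \<Longrightarrow> s_glob P (\<lambda>x. u x - aux_proj P u x) \<phi> = 0"
    by (simp_all add: aux_proj_def)
  from 1 obtain c where c: "aux_proj P u = step c" by (auto simp: aux_iff)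
  show "ess_bdd (aux_proj P u)" by (simp add: c ess_bdd_step)
  have "w (\<lambda>x. u x - step c x) (step d) = 0" for d
    using 2[of "step d"] H_pos by (simp add: c aux_iff s_glob_eq) blast
  then show "AE x in M. aux_proj P u x = step (\<lambda>k. mean k u) x"
    unfolding c by (rule projection_unique[OF u])
qed

lemma w_aux_proj:
  assumes u: "ess_bdd u" and v: "ess_bdd v"
  shows "w (aux_proj P u) (aux_proj P v) = mean_form J u v"
proof -
  have "w (aux_proj P u) (aux_proj P v) = w (step (\<lambda>k. mean k u)) (step (\<lambda>k. mean k v))"
    by (rule w_cong_AE) (intro aux_proj u v ess_bdd_step)+
  then show ?thesis by (simp add: w_step_means)
qed

lemma w_step_aux_proj:
  assumes v: "ess_bdd v"
  shows "w (step c) (aux_proj P v) = (\<Sum>k\<in>J. c k * moment k v)"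
proof -
  have "w (step c) (aux_proj P v) = w (step c) (step (\<lambda>k. mean k v))"
    by (rule w_cong_AE) (use v in \<open>auto intro: aux_proj ess_bdd_step\<close>)
  then show ?thesis by (simp add: w_step_step_means)
qed

abbreviation V where "V \<equiv> P1_zero (fine_mesh P)"

lemma V_ess_bdd: "v \<in> V \<Longrightarrow> ess_bdd v"
  by (rule pw_smoothD(1)[OF P1_zero_pw_smooth])

text \<open>The left-hand side of the coarse problem times H^2, with the product of projections
  expressed through means; unlike \<open>aux_proj\<close> it involves no choice of
  representative.\<close>

definition coarse_form :: "('a \<Rightarrow> real) \<Rightarrow> ('a \<Rightarrow> real) \<Rightarrow> real" where
  "coarse_form u v = H\<^sup>2 * a u v + mean_form J u v"

lemma coarse_form_on: "form_on V coarse_form"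
  unfolding coarse_form_def by (rule form_on_weighted_add[OF a_form_on mean_form_on]) auto

lemma solves_coarse_problem_iff:
  "solves_coarse_problem P (step c) p \<longleftrightarrow>
    p \<in> V \<and> (\<forall>v\<in>V. coarse_form p v = (\<Sum>k\<in>J. c k * moment k v))"
proof -
  have "a_glob P p v + s_glob P (aux_proj P p) (aux_proj P v) = s_glob P (step c) (aux_proj P v)
    \<longleftrightarrow> coarse_form p v = (\<Sum>k\<in>J. c k * moment k v)" if "p \<in> V" "v \<in> V" for v
  proof -
    note eb = V_ess_bdd[OF that(1)] V_ess_bdd[OF that(2)]
    have "H\<^sup>2 \<noteq> 0" using H_pos by simp
    then show ?thesis
      by (simp add: region s_form_eq w_aux_proj[OF eb] w_step_aux_proj[OF eb(2)] coarse_form_def field_simps)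
  qed
  then show ?thesis unfolding solves_coarse_problem_def by blast
qed

end

sublocale two_level \<subseteq> nodal_coordinates "fine_mesh P" "node_list P"
  using bases by unfold_locales (auto simp: matrix_bases_def region)

section \<open>Coarse approximation and its error\<close>

context two_level
begin

lemma coarse_space_subset: "coarse_space1 P \<subseteq> V"
  by (auto simp: coarse_space1_def solves_coarse_problem_def)

text \<open>The coarse function carries the high-permeability means of v; the error then only sees the
  low-permeability means, where the coefficient is bounded.\<close>

lemma coarse_approximation:
  assumes v: "v \<in> V"
  obtains v0 where "v0 \<in> coarse_space1 P"
    "coarse_form (\<lambda>x. v x - v0 x) (\<lambda>x. v x - v0 x) \<le> H\<^sup>2 * a v v + mean_form J_low v v"
proof -
  interpret cf: form_on V coarse_form by (rule coarse_form_on)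
  interpret af: form_on V a by (rule a_form_on)
  interpret lf: form_on V "mean_form J_low" by (rule mean_form_on[OF J_low_subset])
  define c where "c k = (if k \<in> J_low then 0 else mean k v)" for k
  have "\<exists>p\<in>V. \<forall>z\<in>V. coarse_form p z = w (step c) z"
  proof (rule riesz)
    show "0 < coarse_form u u" if u: "u \<in> V" "u \<noteq> (\<lambda>_. 0)" for u
    proof -
      have "a u u \<noteq> 0" using a_definite[OF u(1)] u(2) by blast
      then have "0 < a u u" using a_nonneg[of u] by simp
      moreover have "0 \<le> mean_form J u u" using form_on.nonneg[OF mean_form_on[OF order_refl] u(1)] .
      ultimately show ?thesis using H_pos by (simp add: coarse_form_def add_pos_nonneg)
    qed
    show "linear_form_on V (w (step c))"
      unfolding linear_form_on_def w_commute[of "step c"]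
      by (auto intro!: w_sum V_ess_bdd ess_bdd_step)
  qed (auto intro: cf.lin cf.sym)
  then obtain v0 where v0: "v0 \<in> V" "\<And>z. z \<in> V \<Longrightarrow> coarse_form v0 z = w (step c) z" by blast
  have eq: "coarse_form v0 z = (\<Sum>k\<in>J. c k * moment k z)" if "z \<in> V" for z
    using v0(2)[OF that] w_step[OF V_ess_bdd[OF that]] by simp
  have v0_coarse: "v0 \<in> coarse_space1 P"
    unfolding coarse_space1_def
    by (rule CollectI, rule bexI[of _ "step c"]) (auto simp: solves_coarse_problem_iff v0(1) eq c_def intro: step_aux1)
  let ?e = "\<lambda>x. v x - v0 x"
  have e: "?e \<in> V" by (rule P1_zero_diff[OF v v0(1)])
  have "coarse_form ?e ?e = coarse_form v ?e - coarse_form v0 ?e" by (rule cf.diff_left[OF v v0(1) e])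
  also have "\<dots> = H\<^sup>2 * a v ?e + (\<Sum>k\<in>J. (mean k v - c k) * moment k ?e)"
    unfolding eq[OF e] by (simp add: coarse_form_def mean_form_def sum_subtractf left_diff_distrib)
  also have "(\<Sum>k\<in>J. (mean k v - c k) * moment k ?e) = (\<Sum>k\<in>J_low. (mean k v - c k) * moment k ?e)"
    by (rule sum.mono_neutral_right[OF finite_Jset J_low_subset]) (simp add: c_def)
  also have "\<dots> = mean_form J_low v ?e" by (simp add: mean_form_def c_def)
  \<comment> \<open>Both remaining terms are products with the error. After doubling, Young's
    inequality leaves at most one \<open>coarse_form ?e ?e\<close> on the right, which is
    absorbed.\<close>
  finally have "2 * coarse_form ?e ?e = H\<^sup>2 * (2 * a v ?e) + 2 * mean_form J_low v ?e" by simp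
  also have "\<dots> \<le> H\<^sup>2 * (a v v + a ?e ?e) + (mean_form J_low v v + mean_form J_low ?e ?e)"
    by (intro add_mono mult_left_mono af.young lf.young v e) auto
  also have "\<dots> \<le> H\<^sup>2 * a v v + mean_form J_low v v + coarse_form ?e ?e"
    using mean_form_mono[OF J_low_subset, of ?e] by (simp add: coarse_form_def algebra_simps)
  finally have "coarse_form ?e ?e \<le> H\<^sup>2 * a v v + mean_form J_low v v" by simp
  with v0_coarse show thesis by (rule that)
qed

text \<open>On a low component \<kappa> is below \<open>kappa0\<close> almost everywhere, so these
  means are controlled by the unweighted mass without reference to the contrast. The absolute value
  spares a sign condition on kb.\<close>

lemma low_bound: "v \<in> V \<Longrightarrow> mean_form J_low v v \<le> \<bar>kb\<bar> * m v v"
proof (rule mean_form_bound[OF J_low_subset V_ess_bdd])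
  fix k assume k: "k \<in> J_low"
  then have i: "fst k \<in> {1..N}" and low: "component k = low P (fst k)" by (auto simp: J_low_def component_def)
  have sets: "low P (fst k) \<in> sets lebesgue" using component_sets[OF subsetD[OF J_low_subset k]] low by simp
  have "ess_max (low P (fst k)) (perm P) < ereal (kappa0 P)"
    using i by (rule high_components(4))
  then have less: "esssup (lebesgue_on (low P (fst k))) (\<lambda>x. ereal (perm P x)) < ereal (kappa0 P)"
    by (simp add: ess_max_def)
  have "AE x in lebesgue_on (low P (fst k)). perm P x \<le> \<bar>kb\<bar>"
    using esssup_AE[of "\<lambda>x. ereal (perm P x)" "lebesgue_on (low P (fst k))"]
  proof eventually_elim
    case (elim x)
    then have "ereal (perm P x) < ereal (kappa0 P)" using less by (rule le_less_trans)
    then show ?case using kappa0 by simp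
  qed
  then have "AE x in lebesgue. x \<in> low P (fst k) \<longrightarrow> perm P x \<le> \<bar>kb\<bar>"
    using sets by (simp add: AE_restrict_space_iff)
  then show "AE x in M. x \<in> component k \<longrightarrow> perm P x \<le> \<bar>kb\<bar>"
    unfolding AE_M_iff low by eventually_elim simp
qed auto

text \<open>A component lies in one coarse cell, so truncation to cell i keeps its moment or kills
  it. Hence the global projection of a truncated function, as used in \<open>cell_proj\<close>, acts
  cell by cell.\<close>

lemma moment_cell:
  assumes k: "k \<in> J" and i: "i \<in> {1..N}" and e: "ess_bdd e"
  shows "moment k (\<lambda>x. cind i x * e x) = (if fst k = i then moment k e else 0)"
proof -
  have fk: "fst k \<in> {1..N}" using k by (auto simp: J_def)
  have eb: "ess_bdd (cind i)" by (rule ess_bdd_indicator) (simp add: cell_open)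
  have "moment k (\<lambda>x. cind i x * e x)
      = (LINT x|M. perm P x * (if fst k = i then ind k x * e x else 0))"
    unfolding moment_def w_def
  proof (rule integral_cong_AE)
    show "AE x in M. perm P x * (ind k x * (cind i x * e x))
        = perm P x * (if fst k = i then ind k x * e x else 0)"
      using AE_open_cells
    proof eventually_elim
      case (elim x)
      show ?case
      proof (cases "x \<in> component k")
        case True
        then have xk: "x \<in> cell P (fst k)" using component_subset[OF k] by blast
        show ?thesis
        proof (cases "fst k = i")
          case True
          then show ?thesis using xk by simp
        next
          case False
          then have "x \<notin> cell P i" using cell_unique[OF elim fk i xk] by blast
          then show ?thesis using False by simp
        qed
      qed simp
    qed
    show "(\<lambda>x. perm P x * (ind k x * (cind i x * e x))) \<in> borel_measurable M"
      by (intro borel_measurable_integrable weighted_integrable ess_bdd_mult ess_bdd_ind k eb e)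
    show "(\<lambda>x. perm P x * (if fst k = i then ind k x * e x else 0)) \<in> borel_measurable M"
      by (cases "fst k = i")
        (auto intro!: borel_measurable_integrable weighted_integrable ess_bdd_mult ess_bdd_ind k e)
  qed
  then show ?thesis by (simp add: moment_def w_def)
qed

lemma sum_mean_form_cells:
  assumes e: "ess_bdd e"
  shows "(\<Sum>i=1..N. mean_form J (\<lambda>x. cind i x * e x) (\<lambda>x. cind i x * e x))
    = mean_form J e e"
proof -
  have "(\<Sum>i=1..N. mean_form J (\<lambda>x. cind i x * e x) (\<lambda>x. cind i x * e x))
      = (\<Sum>i=1..N. \<Sum>k\<in>J. if fst k = i then mean k e * moment k e else 0)"
    unfolding mean_form_def mean_def
    by (intro sum.cong refl) (simp add: moment_cell[OF _ _ e])
  also have "\<dots> = (\<Sum>k\<in>J. \<Sum>i=1..N. if fst k = i then mean k e * moment k e else 0)"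
    by (rule sum.swap)
  also have "\<dots> = (\<Sum>k\<in>J. mean k e * moment k e)"
    by (intro sum.cong refl) (auto simp: J_def sum.delta')
  finally show ?thesis by (simp add: mean_form_def)
qed

lemma sum_cells_weighted:
  assumes f: "ess_bdd f"
  shows "(\<Sum>i=1..N. LINT x|M. perm P x * (cind i x * f x)) = (LINT x|M. perm P x * f x)"
proof -
  have eb: "ess_bdd (\<lambda>x. cind i x * f x)" for i
    by (intro ess_bdd_mult ess_bdd_indicator f) (simp add: cell_open)
  have "(\<Sum>i=1..N. LINT x|M. perm P x * (cind i x * f x))
      = (LINT x|M. perm P x * (\<Sum>i=1..N. cind i x * f x))"
    by (rule weighted_sum[symmetric]) (rule eb)
  also have "\<dots> = (LINT x|M. perm P x * f x)"
  proof (rule integral_cong_AE)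
    show "AE x in M. perm P x * (\<Sum>i=1..N. cind i x * f x) = perm P x * f x"
      using AE_open_cells
    proof eventually_elim
      case (elim x)
      show ?case using sum_cells[OF elim] by (simp flip: sum_distrib_right)
    qed
  qed (intro borel_measurable_integrable weighted_integrable ess_bdd_sum eb f)+
  finally show ?thesis .
qed

lemma cell_projection_error:
  assumes e: "e \<in> V" and i: "i \<in> {1..N}"
  defines "q \<equiv> cell_proj P i e"
  shows "(LINT x|M. perm P x * (cind i x * ((e x - q x) * (e x - q x))))
    \<le> \<bar>Cpi\<bar> * H\<^sup>2 * (LINT x|M. perm P x * (cind i x * (norm (grad e x))\<^sup>2))"
    (is "?L \<le> \<bar>Cpi\<bar> * H\<^sup>2 * ?G")
proof -
  have cs: "cell P i \<in> sets lebesgue" by (simp add: cell_open)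
  have "H1_with_gradient (cell P i) e (grad e)"
    by (rule P1_zero_weak_gradient[OF e cell_open cell_subset[OF i]])
  then have est: "(s_norm (perm P) H (cell P i) (\<lambda>x. e x - q x))\<^sup>2
      \<le> Cpi * (LINT x|lebesgue_on (cell P i). perm P x * (norm (grad e x))\<^sup>2)"
    using projection i unfolding projection_estimate_def q_def by blast
  have G: "(LINT x|lebesgue_on (cell P i). perm P x * (norm (grad e x))\<^sup>2) = ?G"
    unfolding integral_sub[OF cs cell_subset[OF i]]
    by (rule Bochner_Integration.integral_cong) auto
  have "(LINT x|lebesgue_on (cell P i). perm P x * (e x - q x) * (e x - q x)) = ?L"
    unfolding integral_sub[OF cs cell_subset[OF i]]
    by (rule Bochner_Integration.integral_cong) auto
  moreover have L0: "0 \<le> ?L" by (rule weighted_nonneg) simp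
  ultimately have "(s_norm (perm P) H (cell P i) (\<lambda>x. e x - q x))\<^sup>2 = ?L / H\<^sup>2"
    by (simp add: s_norm_def s_form_def)
  then have "?L / H\<^sup>2 \<le> Cpi * ?G" using est G by simp
  also have "\<dots> \<le> \<bar>Cpi\<bar> * ?G"
    by (rule mult_right_mono[OF abs_ge_self weighted_nonneg]) simp
  finally show ?thesis using H_pos by (simp add: field_simps)
qed

text \<open>On each cell e is split into e minus its projection and the projection. The first part
  is bounded by the projection estimate; the second parts add up over the cells to the full
  \<open>mean_form\<close>.\<close>

lemma w_error_bound:
  assumes e: "e \<in> V"
  shows "w e e \<le> 2 * \<bar>Cpi\<bar> * (H\<^sup>2 * a e e) + 2 * mean_form J e e"
proof -
  note eb = V_ess_bdd[OF e]
  note smooth = P1_zero_pw_smooth[OF e]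
  let ?c = "\<lambda>i. cind i"
  have cb: "ess_bdd (?c i)" for i by (rule ess_bdd_indicator) (simp add: cell_open)
  let ?q = "\<lambda>i. cell_proj P i e"
  have qb: "ess_bdd (?q i)" for i
    unfolding cell_proj_def by (intro aux_proj(1) ess_bdd_mult cb eb)
  have wq: "w (?q i) (?q i) = mean_form J (\<lambda>x. ?c i x * e x) (\<lambda>x. ?c i x * e x)" for i
    unfolding cell_proj_def by (intro w_aux_proj ess_bdd_mult cb eb)
  have db: "ess_bdd (\<lambda>x. ?c i x * ((e x - ?q i x) * (e x - ?q i x)))" for i
    by (intro ess_bdd_intros cb eb qb)
  have "w e e = (\<Sum>i=1..N. LINT x|M. perm P x * (?c i x * (e x * e x)))"
    unfolding w_def by (rule sum_cells_weighted[symmetric]) (intro ess_bdd_mult eb)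
  also have "\<dots> \<le> (\<Sum>i=1..N. 2 * (\<bar>Cpi\<bar> * H\<^sup>2 * (LINT x|M. perm P x * (?c i x * (norm (grad e x))\<^sup>2)))
      + 2 * mean_form J (\<lambda>x. ?c i x * e x) (\<lambda>x. ?c i x * e x))"
  proof (rule sum_mono)
    fix i assume i: "i \<in> {1..N}"
    let ?f = "\<lambda>x. ?c i x * ((e x - ?q i x) * (e x - ?q i x))"
    have "(LINT x|M. perm P x * (?c i x * (e x * e x))) \<le> (LINT x|M. perm P x * (2 * ?f x + 2 * (?q i x * ?q i x)))"
    proof (rule weighted_mono)
      \<comment> \<open>The indicator is dropped from the projection term so that this term
        integrates to the full \<open>w (?q i) (?q i)\<close>, the quantity that \<open>wq\<close>
        evaluates.\<close>
      show "AE x in M. ?c i x * (e x * e x) \<le> 2 * ?f x + 2 * (?q i x * ?q i x)"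
      proof (rule AE_I2)
        fix x
        have "e x * e x + (e x - 2 * ?q i x)\<^sup>2 = 2 * ((e x - ?q i x) * (e x - ?q i x)) + 2 * (?q i x * ?q i x)"
          by (simp add: power2_eq_square algebra_simps)
        then have "e x * e x \<le> 2 * ((e x - ?q i x) * (e x - ?q i x)) + 2 * (?q i x * ?q i x)"
          using zero_le_power2[of "e x - 2 * ?q i x"] by linarith
        then show "?c i x * (e x * e x) \<le> 2 * ?f x + 2 * (?q i x * ?q i x)"
          by (cases "x \<in> cell P i") auto
      qed
    qed (intro ess_bdd_intros cb eb qb db)+
    also have "\<dots> = 2 * (LINT x|M. perm P x * ?f x) + 2 * w (?q i) (?q i)"
      unfolding w_def weighted_scale[symmetric]
      by (intro weighted_add ess_bdd_intros qb db)
    also have "\<dots> \<le> 2 * (\<bar>Cpi\<bar> * H\<^sup>2 * (LINT x|M. perm P x * (?c i x * (norm (grad e x))\<^sup>2))) + 2 * w (?q i) (?q i)"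
      using cell_projection_error[OF e i] by simp
    finally show "(LINT x|M. perm P x * (?c i x * (e x * e x)))
      \<le> 2 * (\<bar>Cpi\<bar> * H\<^sup>2 * (LINT x|M. perm P x * (?c i x * (norm (grad e x))\<^sup>2)))
        + 2 * mean_form J (\<lambda>x. ?c i x * e x) (\<lambda>x. ?c i x * e x)"
      by (simp only: wq)
  qed
  also have "\<dots> = 2 * (\<bar>Cpi\<bar> * H\<^sup>2 * (\<Sum>i=1..N. LINT x|M. perm P x * (?c i x * (norm (grad e x))\<^sup>2)))
      + 2 * mean_form J e e"
    unfolding sum_mean_form_cells[OF eb, symmetric] by (simp add: sum.distrib sum_distrib_left)
  also have "(\<Sum>i=1..N. LINT x|M. perm P x * (?c i x * (norm (grad e x))\<^sup>2)) = a e e"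
    unfolding a_eq_norm
    by (rule sum_cells_weighted) (intro ess_bdd_norm2 pw_smoothD(2) smooth)
  finally show ?thesis by (simp add: mult.assoc)
qed

section \<open>Energy, overlap and localisation of the error\<close>

definition energy :: "('a \<Rightarrow> real) \<Rightarrow> ('a \<Rightarrow> real) \<Rightarrow> real" where
  "energy u v = time_step P * a u v + m u v"

lemma energy_form_on: "form_on V energy"
  unfolding energy_def by (rule form_on_weighted_add[OF a_form_on m_form_on]) (use time_step in simp)

lemma energy_nonneg: "0 \<le> energy u u"
  using a_nonneg[of u] m_nonneg[of u] time_step(1) by (simp add: energy_def)

lemma energy_definite: "u \<in> V \<Longrightarrow> energy u u = 0 \<Longrightarrow> u x = 0"
proof (rule a_definite)
  assume "energy u u = 0"
  then have "time_step P * a u u = 0"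
    using a_nonneg[of u] m_nonneg[of u] time_step(1) by (simp add: energy_def add_nonneg_eq_0_iff)
  then show "a u u = 0" using time_step(1) by simp
qed

definition layers :: "nat \<Rightarrow> 'a set set" where
  "layers i = (add_layer (fine_mesh P) ^^ nlayers P i) (cell_mesh P i)"

lemma layers_subset: "i \<in> {1..N} \<Longrightarrow> layers i \<subseteq> fine_mesh P"
  unfolding layers_def by (rule add_layer_subset[OF cell_mesh])

lemma subdomain_eq: "subdomain P i = interior (\<Union>(layers i))"
  by (simp add: subdomain_def layers_def)

lemma subdomain_card: "x \<in> \<Omega> \<Longrightarrow> card {i \<in> {1..N}. x \<in> interior (\<Union>(layers i))} \<le> No"
  using cover by (simp add: overlapping_cover_def region subdomain_eq)

lemma local_spaces_overlap:
  assumes v: "\<And>i. i \<in> {1..N} \<Longrightarrow> v i \<in> schwarz_space P i"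
  shows "energy (\<lambda>x. \<Sum>i=1..N. v i x) (\<lambda>x. \<Sum>i=1..N. v i x) \<le> real No * (\<Sum>i=1..N. energy (v i) (v i))"
proof -
  have v': "v i \<in> V" "x \<notin> interior (\<Union>(layers i)) \<Longrightarrow> v i x = 0" if "i \<in> {1..N}" for i x
    using v[OF that] that by (auto simp: schwarz_space_def P1_zero_on_def subdomain_eq)
  have "a (\<lambda>x. \<Sum>i=1..N. v i x) (\<lambda>x. \<Sum>i=1..N. v i x) \<le> real No * (\<Sum>i=1..N. a (v i) (v i))"
    by (rule overlap_a[of _ layers]) (use v' layers_subset subdomain_card in \<open>auto simp: P1_zero_def\<close>)
  moreover have "m (\<lambda>x. \<Sum>i=1..N. v i x) (\<lambda>x. \<Sum>i=1..N. v i x) \<le> real No * (\<Sum>i=1..N. m (v i) (v i))"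
    by (rule overlap_m[of _ _ "\<lambda>i. interior (\<Union>(layers i))"])
      (use v' V_ess_bdd subdomain_card in auto)
  ultimately have "energy (\<lambda>x. \<Sum>i=1..N. v i x) (\<lambda>x. \<Sum>i=1..N. v i x)
      \<le> time_step P * (real No * (\<Sum>i=1..N. a (v i) (v i))) + real No * (\<Sum>i=1..N. m (v i) (v i))"
    unfolding energy_def using time_step(1) by (intro add_mono mult_left_mono) auto
  also have "\<dots> = real No * (\<Sum>i=1..N. energy (v i) (v i))"
    by (simp add: energy_def sum.distrib sum_distrib_left algebra_simps)
  finally show ?thesis .
qed

lemma pou_P1: "i \<in> {1..N} \<Longrightarrow> pou P i \<in> P1 (fine_mesh P)"
  and pou_zero: "i \<in> {1..N} \<Longrightarrow> x \<in> \<Omega> \<Longrightarrow> x \<notin> interior (\<Union>(layers i)) \<Longrightarrow> pou P i x = 0"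
  and pou_grad: "i \<in> {1..N} \<Longrightarrow> AE x in M. norm (grad (pou P i) x) \<le> Cchi / H"
  and pou_sum: "x \<in> \<Omega> \<Longrightarrow> (\<Sum>i=1..N. pou P i x) = 1"
  and pou_square: "x \<in> \<Omega> \<Longrightarrow> (\<Sum>i=1..N. (pou P i x)\<^sup>2) \<le> 1"
  using pou unfolding partition_of_unity_def region subdomain_eq by auto

text \<open>The product with the partition of unity is piecewise quadratic and leaves the finite
  element space; interpolation brings it back. The pieces still sum to e because they do so at the
  nodes.\<close>

definition piece :: "('a \<Rightarrow> real) \<Rightarrow> nat \<Rightarrow> 'a \<Rightarrow> real" where
  "piece e i = nodal_interp (fine_mesh P) (\<lambda>x. pou P i x * e x)"

lemma piece_node: "p \<in> nodes (fine_mesh P) \<Longrightarrow> piece e i p = pou P i p * e p"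
  unfolding piece_def by (rule nodal_interp(2))

text \<open>Nodal values outside the subdomain vanish: inside the domain through the partition of
  unity, elsewhere through e. \<open>P1_vanish\<close> extends this from nodes to all
  points.\<close>

lemma piece_schwarz_space:
  assumes e: "e \<in> V" and i: "i \<in> {1..N}"
  shows "piece e i \<in> schwarz_space P i"
proof -
  have P1: "piece e i \<in> P1 (fine_mesh P)" unfolding piece_def by (rule nodal_interp(1))
  have zero: "piece e i p = 0" if "p \<in> nodes (fine_mesh P)" "p \<notin> interior (\<Union>(layers i))" for p
    using piece_node[OF that(1), of e i] pou_zero[OF i _ that(2)] P1_zero_outside[OF e, of p]
    by (cases "p \<in> \<Omega>") auto
  have outside: "piece e i x = 0" if "x \<notin> interior (\<Union>(layers i))" for x
    by (rule P1_vanish[OF layers_subset[OF i] P1 zero that])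
  have "piece e i \<in> V"
    unfolding P1_zero_iff
  proof (intro conjI P1 ballI impI)
    fix p assume "p \<notin> \<Omega>"
    moreover have "interior (\<Union>(layers i)) \<subseteq> \<Omega>"
      by (intro interior_mono Union_mono layers_subset[OF i])
    ultimately show "piece e i p = 0" using outside by blast
  qed
  then show ?thesis using outside i by (simp add: schwarz_space_def P1_zero_on_def subdomain_eq)
qed

lemma sum_pieces:
  assumes e: "e \<in> V"
  shows "e = (\<lambda>x. \<Sum>i=1..N. piece e i x)"
proof (rule P1_zero_eqI[OF e])
  have "piece e i \<in> V" if "i \<in> {1..N}" for i
    using piece_schwarz_space[OF e that] that by (auto simp: schwarz_space_def P1_zero_on_def)
  then show "(\<lambda>x. \<Sum>i=1..N. piece e i x) \<in> V"
    using P1_zero_sum[of "{1..N}" "piece e" "\<lambda>_. 1"] by simp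
  fix r assume r: "r < n"
  have "(\<Sum>i=1..N. piece e i (node_list P ! r)) = (\<Sum>i=1..N. pou P i (node_list P ! r)) * e (node_list P ! r)"
    by (simp add: piece_node[OF ps_nth(1)[OF r]] sum_distrib_right)
  then show "e (node_list P ! r) = (\<Sum>i=1..N. piece e i (node_list P ! r))"
    using pou_sum[OF ps_nth(2)[OF r]] by simp
qed

lemma sqrt_le_imp_le:
  assumes "sqrt x \<le> c * sqrt y" "0 \<le> x" "0 \<le> y"
  shows "x \<le> c\<^sup>2 * y"
proof -
  have "(sqrt x)\<^sup>2 \<le> (c * sqrt y)\<^sup>2" using assms by (intro power_mono) auto
  then show ?thesis using assms by (simp add: power_mult_distrib)
qed

lemma piece_bounds:
  assumes e: "e \<in> V" and i: "i \<in> {1..N}"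
  shows "a (piece e i) (piece e i) \<le> CI\<^sup>2 * a (\<lambda>x. pou P i x * e x) (\<lambda>x. pou P i x * e x)"
    "w (piece e i) (piece e i) \<le> CI\<^sup>2 * w (\<lambda>x. pou P i x * e x) (\<lambda>x. pou P i x * e x)"
proof -
  have q: "piecewise_quadratic (fine_mesh P) (\<lambda>x. pou P i x * e x)"
    using e by (intro P1_mult_quadratic pou_P1 i) (simp add: P1_zero_def)
  note st = interpolation[unfolded interpolation_stable_def, rule_format, OF q, folded piece_def]
  show "a (piece e i) (piece e i) \<le> CI\<^sup>2 * a (\<lambda>x. pou P i x * e x) (\<lambda>x. pou P i x * e x)"
    by (rule sqrt_le_imp_le[OF _ a_nonneg a_nonneg])
      (use st[THEN conjunct1] in \<open>simp only: a_norm_def region\<close>)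
  have "w (piece e i) (piece e i) / H\<^sup>2 \<le> CI\<^sup>2 * (w (\<lambda>x. pou P i x * e x) (\<lambda>x. pou P i x * e x) / H\<^sup>2)"
    by (rule sqrt_le_imp_le)
      (use st[THEN conjunct2] w_nonneg in \<open>simp_all only: s_norm_def region s_form_eq zero_le_divide_iff zero_le_power2, auto\<close>)
  then show "w (piece e i) (piece e i) \<le> CI\<^sup>2 * w (\<lambda>x. pou P i x * e x) (\<lambda>x. pou P i x * e x)"
    using H_pos by (simp add: divide_le_cancel)
qed

end

text \<open>Dominates both coefficients in \<open>w_error_bound\<close>. This and the following
  constants live outside the locale, so that they can be named before a discretisation is given;
  absolute values replace sign conditions.\<close>

definition w_const :: "real \<Rightarrow> real" where
  "w_const Cpi = 2 * \<bar>Cpi\<bar> + 2"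

text \<open>1 / ct comes from H^2 \<le> \<open>time_step\<close> / ct in the gradient term, |kb|
  from the bound on the low means.\<close>

definition coarse_const :: "real \<Rightarrow> real \<Rightarrow> real" where
  "coarse_const ct kb = 1 / ct + \<bar>kb\<bar>"

text \<open>|Ct| bounds the stiffness part through the upper bound on the time step; the quotient
  converts the weighted norm into mass, k standing for \<open>perm_min\<close>.\<close>

definition error_const :: "real \<Rightarrow> real \<Rightarrow> real \<Rightarrow> real" where
  "error_const k Ct Cpi = \<bar>Ct\<bar> + w_const Cpi / k"

text \<open>\<open>CI\<^sup>2\<close> is the price of nodal interpolation. The bracket is the cutoff
  estimate \<open>partition_of_unity_a\<close> with c = Cchi / H after H has cancelled, plus the
  mass part.\<close>

definition piece_const :: "real \<Rightarrow> real \<Rightarrow> real \<Rightarrow> real \<Rightarrow> real \<Rightarrow> nat \<Rightarrow> real" where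
  "piece_const k Ct Cpi CI Cchi No =
     CI\<^sup>2 * (\<bar>Ct\<bar> * (2 + 2 * real No * Cchi\<^sup>2 * w_const Cpi) + w_const Cpi / k)"

text \<open>The summand 2 and the factor 2 come from writing the coarse part as v minus the error;
  \<open>coarse_const\<close> converts the coarse form of the error into the energy of v.\<close>

definition stability_const :: "real \<Rightarrow> real \<Rightarrow> real \<Rightarrow> real \<Rightarrow> real \<Rightarrow> real \<Rightarrow> real \<Rightarrow> nat \<Rightarrow> real" where
  "stability_const k ct Ct kb Cpi CI Cchi No =
     2 + (2 * error_const k Ct Cpi + piece_const k Ct Cpi CI Cchi No) * coarse_const ct kb"

lemma stability_const_pos:
  assumes "0 < k" "0 < ct"
  shows "0 < stability_const k ct Ct kb Cpi CI Cchi No"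
  unfolding stability_const_def error_const_def piece_const_def coarse_const_def w_const_def
  using assms by (intro add_pos_nonneg mult_nonneg_nonneg add_nonneg_nonneg) auto

section \<open>Assembly of the stable decomposition\<close>

context two_level
begin

abbreviation Ccoarse :: real where "Ccoarse \<equiv> coarse_const ct kb"
abbreviation Cerr :: real where "Cerr \<equiv> error_const (perm_min P) Ct Cpi"
abbreviation Cpieces :: real where "Cpieces \<equiv> piece_const (perm_min P) Ct Cpi CI Cchi No"
abbreviation Cstab :: real where "Cstab \<equiv> stability_const (perm_min P) ct Ct kb Cpi CI Cchi No"

lemma coarse_error_bound:
  assumes v: "v \<in> V"
  obtains v0 where "v0 \<in> coarse_space1 P"
    "coarse_form (\<lambda>x. v x - v0 x) (\<lambda>x. v x - v0 x) \<le> Ccoarse * energy v v"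
proof -
  obtain v0 where v0: "v0 \<in> coarse_space1 P"
    "coarse_form (\<lambda>x. v x - v0 x) (\<lambda>x. v x - v0 x) \<le> H\<^sup>2 * a v v + mean_form J_low v v"
    using coarse_approximation[OF v] by blast
  have "H\<^sup>2 * a v v \<le> (time_step P / ct) * a v v"
    using time_step(2) ct by (intro mult_right_mono a_nonneg) (simp add: field_simps)
  also have "\<dots> \<le> 1 / ct * energy v v"
    using m_nonneg[of v] ct by (simp add: energy_def divide_right_mono)
  finally have 1: "H\<^sup>2 * a v v \<le> 1 / ct * energy v v" .
  have "m v v \<le> energy v v"
    using a_nonneg[of v] time_step(1) by (simp add: energy_def)
  then have "mean_form J_low v v \<le> \<bar>kb\<bar> * energy v v"
    using low_bound[OF v] mult_left_mono[of "m v v" "energy v v" "\<bar>kb\<bar>"] by simp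
  then have "coarse_form (\<lambda>x. v x - v0 x) (\<lambda>x. v x - v0 x) \<le> Ccoarse * energy v v"
    using v0(2) 1 unfolding coarse_const_def distrib_right by linarith
  with v0(1) show thesis by (rule that)
qed

lemma Ct_pos: "0 < Ct"
proof -
  have "0 < Ct * H\<^sup>2" using time_step(1,3) by linarith
  then show ?thesis by (simp add: zero_less_mult_iff)
qed

text \<open>Everything asked of the error is paid by \<open>coarse_form\<close>: its stiffness part
  through the upper bound on the time step, its mass through the weighted norm and division by
  \<open>perm_min\<close>.\<close>

lemma error_bounds:
  assumes e: "e \<in> V"
  shows "H\<^sup>2 * a e e \<le> coarse_form e e" "w e e \<le> w_const Cpi * coarse_form e e"
    "time_step P * a e e \<le> \<bar>Ct\<bar> * coarse_form e e"
    "energy e e \<le> Cerr * coarse_form e e"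
proof -
  have mf: "0 \<le> mean_form J e e" using form_on.nonneg[OF mean_form_on[OF order_refl] e] .
  have a0: "0 \<le> H\<^sup>2 * a e e" by (intro mult_nonneg_nonneg a_nonneg) simp
  show 1: "H\<^sup>2 * a e e \<le> coarse_form e e" using mf by (simp add: coarse_form_def)
  have "w e e \<le> 2 * \<bar>Cpi\<bar> * (H\<^sup>2 * a e e) + 2 * mean_form J e e" by (rule w_error_bound[OF e])
  also have "\<dots> \<le> w_const Cpi * (H\<^sup>2 * a e e) + w_const Cpi * mean_form J e e"
    by (intro add_mono mult_right_mono a0 mf) (auto simp: w_const_def)
  finally show 2: "w e e \<le> w_const Cpi * coarse_form e e" by (simp add: coarse_form_def distrib_left)
  have "time_step P * a e e \<le> (\<bar>Ct\<bar> * H\<^sup>2) * a e e"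
    using time_step(3) Ct_pos by (intro mult_right_mono a_nonneg) simp
  also have "\<dots> \<le> \<bar>Ct\<bar> * coarse_form e e"
    using mult_left_mono[OF 1, of "\<bar>Ct\<bar>"] by (simp add: mult.assoc)
  finally show 3: "time_step P * a e e \<le> \<bar>Ct\<bar> * coarse_form e e" .
  have "m e e \<le> w e e / perm_min P"
    using m_le_w[OF V_ess_bdd[OF e]] k0 by (simp add: field_simps)
  also have "\<dots> \<le> w_const Cpi / perm_min P * coarse_form e e"
    using divide_right_mono[OF 2, of "perm_min P"] k0 by simp
  finally show "energy e e \<le> Cerr * coarse_form e e"
    unfolding energy_def error_const_def distrib_right by (rule add_mono[OF 3])
qed

lemma pieces_bound:
  assumes e: "e \<in> V"
  shows "(\<Sum>i=1..N. energy (piece e i) (piece e i))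
    \<le> Cpieces * coarse_form e e"
proof -
  let ?p = "\<lambda>i x. pou P i x * e x"
  let ?X = "coarse_form e e"
  note b = error_bounds[OF e]
  have pV: "piece e i \<in> V" if "i \<in> {1..N}" for i
    using piece_schwarz_space[OF e that] that by (auto simp: schwarz_space_def P1_zero_on_def)
  have sq: "0 \<le> CI\<^sup>2" by simp
  have "(\<Sum>i=1..N. a (piece e i) (piece e i)) \<le> CI\<^sup>2 * (\<Sum>i=1..N. a (?p i) (?p i))"
    unfolding sum_distrib_left by (intro sum_mono piece_bounds(1) e)
  also have "\<dots> \<le> CI\<^sup>2 * (2 * a e e + 2 * real No * (Cchi / H)\<^sup>2 * w e e)"
    by (intro mult_left_mono sq partition_of_unity_a[of _ layers] layers_subset P1_zero_pw_smooth e
        pou_P1 pou_zero subdomain_card pou_square pou_grad finite_atLeastAtMost)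
  finally have "time_step P * (\<Sum>i=1..N. a (piece e i) (piece e i))
      \<le> (\<bar>Ct\<bar> * H\<^sup>2) * (CI\<^sup>2 * (2 * a e e + 2 * real No * (Cchi / H)\<^sup>2 * w e e))"
    using time_step(1,3) Ct_pos
    by (intro mult_mono) (auto intro!: sum_nonneg a_nonneg)
  \<comment> \<open>H^2 from the time step cancels H^{-2} from the gradients of the partition of
    unity.\<close>
  also have "\<dots> = CI\<^sup>2 * (\<bar>Ct\<bar> * (2 * (H\<^sup>2 * a e e) + 2 * real No * Cchi\<^sup>2 * w e e))"
    using H_pos by (simp add: power_divide field_simps)
  also have "\<dots> \<le> CI\<^sup>2 * (\<bar>Ct\<bar> * (2 * ?X + 2 * real No * Cchi\<^sup>2 * (w_const Cpi * ?X)))"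
    by (intro mult_left_mono add_mono b(1,2)) auto
  finally have 1: "time_step P * (\<Sum>i=1..N. a (piece e i) (piece e i))
      \<le> CI\<^sup>2 * (\<bar>Ct\<bar> * (2 * ?X + 2 * real No * Cchi\<^sup>2 * (w_const Cpi * ?X)))" .
  have "perm_min P * (\<Sum>i=1..N. m (piece e i) (piece e i)) \<le> (\<Sum>i=1..N. w (piece e i) (piece e i))"
    unfolding sum_distrib_left by (intro sum_mono m_le_w V_ess_bdd pV)
  also have "\<dots> \<le> CI\<^sup>2 * (\<Sum>i=1..N. w (?p i) (?p i))"
    unfolding sum_distrib_left by (intro sum_mono piece_bounds(2) e)
  also have "\<dots> \<le> CI\<^sup>2 * w e e"
    by (intro mult_left_mono sq partition_of_unity_w V_ess_bdd e pou_square
        pw_smoothD(1) P1_pw_smooth pou_P1)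
  also have "\<dots> \<le> CI\<^sup>2 * (w_const Cpi * ?X)"
    by (intro mult_left_mono b(2) sq)
  finally have 2: "(\<Sum>i=1..N. m (piece e i) (piece e i)) \<le> CI\<^sup>2 * (w_const Cpi / perm_min P * ?X)"
    using k0 by (simp add: field_simps)
  have "(\<Sum>i=1..N. energy (piece e i) (piece e i))
      = time_step P * (\<Sum>i=1..N. a (piece e i) (piece e i)) + (\<Sum>i=1..N. m (piece e i) (piece e i))"
    by (simp add: energy_def sum.distrib sum_distrib_left)
  also have "\<dots> \<le> CI\<^sup>2 * (\<bar>Ct\<bar> * (2 * ?X + 2 * real No * Cchi\<^sup>2 * (w_const Cpi * ?X)))
      + CI\<^sup>2 * (w_const Cpi / perm_min P * ?X)"
    by (rule add_mono[OF 1 2])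
  also have "\<dots> = Cpieces * ?X"
    by (simp add: piece_const_def algebra_simps)
  finally show ?thesis .
qed

lemma stable_decomposition:
  assumes v: "v \<in> V"
  obtains u where "\<And>i. i \<le> N \<Longrightarrow> u i \<in> schwarz_space P i" "\<And>x. v x = (\<Sum>i=0..N. u i x)"
    "(\<Sum>i=0..N. energy (u i) (u i))
       \<le> Cstab * energy v v"
proof -
  obtain v0 where v0: "v0 \<in> coarse_space1 P"
    "coarse_form (\<lambda>x. v x - v0 x) (\<lambda>x. v x - v0 x) \<le> Ccoarse * energy v v"
    using coarse_error_bound[OF v] by blast
  have v0V: "v0 \<in> V" using v0(1) coarse_space_subset by blast
  define e where "e x = v x - v0 x" for x
  have e: "e \<in> V" unfolding e_def by (rule P1_zero_diff[OF v v0V])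
  have X: "coarse_form e e \<le> Ccoarse * energy v v"
    using v0(2) by (simp only: e_def[abs_def])
  have C3: "0 \<le> Cerr" unfolding error_const_def w_const_def using k0 by simp
  have C2: "0 \<le> Cpieces" unfolding piece_const_def w_const_def using k0 by simp
  define u where "u i = (if i = 0 then v0 else piece e i)" for i
  \<comment> \<open>The coarse part is estimated as v minus the error, which avoids a separate
    stability bound for the coarse solve.\<close>
  have "v0 = (\<lambda>x. v x - e x)" by (simp add: e_def)
  then have "energy v0 v0 \<le> 2 * energy v v + 2 * energy e e"
    using form_on.diff_le[OF energy_form_on v e] by simp
  also have "\<dots> \<le> 2 * energy v v + 2 * (Cerr * coarse_form e e)"
    using error_bounds(4)[OF e] by simp
  finally have "(\<Sum>i=0..N. energy (u i) (u i)) \<le> 2 * energy v v + 2 * (Cerr * coarse_form e e) + Cpieces * coarse_form e e"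
    using pieces_bound[OF e] by (simp add: u_def sum.atLeast_Suc_atMost)
  also have "\<dots> = 2 * energy v v + (2 * Cerr + Cpieces) * coarse_form e e" by (simp add: algebra_simps)
  also have "\<dots> \<le> 2 * energy v v + (2 * Cerr + Cpieces) * (Ccoarse * energy v v)"
    using X C2 C3 by (intro add_left_mono mult_left_mono) auto
  also have "\<dots> = Cstab * energy v v"
    by (simp add: stability_const_def algebra_simps)
  finally have "(\<Sum>i=0..N. energy (u i) (u i))
       \<le> Cstab * energy v v" .
  moreover have "u i \<in> schwarz_space P i" if "i \<le> N" for i
  proof (cases "i = 0")
    case True
    then show ?thesis using v0(1) by (simp add: u_def schwarz_space_def)
  next
    case False
    then show ?thesis using piece_schwarz_space[OF e, of i] \<open>i \<le> N\<close> by (simp add: u_def)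
  qed
  moreover have "v x = (\<Sum>i=0..N. u i x)" for x
  proof -
    have "e x = (\<Sum>i=1..N. piece e i x)" by (rule fun_cong[OF sum_pieces[OF e]])
    then show ?thesis by (simp add: u_def sum.atLeast_Suc_atMost e_def)
  qed
  ultimately show thesis by (rule that[rotated 2])
qed

end

section \<open>The preconditioned matrix\<close>

text \<open>A basis list is characterised by unique representation. Adding the null relation c to
  the coefficients of one member of V, here the first basis function, gives a second representation
  of it.\<close>

lemma is_basis_list_independent:
  assumes basis: "is_basis_list fs V" and zero: "\<And>x. (\<Sum>j<length fs. c j * (fs ! j) x) = 0"
    and j: "j < length fs"
  shows "c j = 0"
proof -
  have "fs ! 0 \<in> set fs" using j by (intro nth_mem) linarith
  then have "fs ! 0 \<in> V" using basis unfolding is_basis_list_def by blast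
  then have ex1: "\<exists>!d::real list. length d = length fs \<and> fs ! 0 = (\<lambda>x. \<Sum>j<length fs. d ! j * (fs ! j) x)"
    using basis by (simp add: is_basis_list_def)
  then obtain d where d: "length d = length fs" "fs ! 0 = (\<lambda>x. \<Sum>j<length fs. d ! j * (fs ! j) x)"
    by blast
  define d' where "d' = map (\<lambda>j. d ! j + c j) [0..<length fs]"
  have "(\<lambda>x. \<Sum>j<length fs. d' ! j * (fs ! j) x) = (\<lambda>x. \<Sum>j<length fs. d ! j * (fs ! j) x)"
    using zero by (simp add: d'_def distrib_right sum.distrib fun_eq_iff)
  then have "length d' = length fs \<and> fs ! 0 = (\<lambda>x. \<Sum>j<length fs. d' ! j * (fs ! j) x)"
    using d(2) by (simp add: d'_def)
  then have "d' = d" using ex1 d by blast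
  then have "d' ! j = d ! j" by simp
  then show ?thesis using j by (simp add: d'_def)
qed

section \<open>Passage between matrices and functions\<close>

context two_level
begin

abbreviation basis :: "nat \<Rightarrow> ('a \<Rightarrow> real) list" where "basis \<equiv> local_basis P"
abbreviation nloc :: "nat \<Rightarrow> nat" where "nloc i \<equiv> length (basis i)"

definition local_fun :: "nat \<Rightarrow> real vec \<Rightarrow> 'a \<Rightarrow> real" where
  "local_fun i c = (\<lambda>x. \<Sum>j<nloc i. vec_index c j * (basis i ! j) x)"

lemma basis_list: "i \<le> N \<Longrightarrow> is_basis_list (basis i) (schwarz_space P i)"
  using bases by (simp add: matrix_bases_def)

lemma schwarz_space_subset: "i \<le> N \<Longrightarrow> schwarz_space P i \<subseteq> V"
  using coarse_space_subset by (auto simp: schwarz_space_def P1_zero_on_def)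

lemma basis_mem: "i \<le> N \<Longrightarrow> j < nloc i \<Longrightarrow> basis i ! j \<in> schwarz_space P i"
  using basis_list[of i] nth_mem[of j "basis i"] unfolding is_basis_list_def by blast

lemma local_fun_V: "i \<le> N \<Longrightarrow> local_fun i c \<in> V"
  unfolding local_fun_def
  by (rule P1_zero_sum) (use basis_mem schwarz_space_subset in blast)

lemma local_fun_schwarz_space: "i \<in> {1..N} \<Longrightarrow> local_fun i c \<in> schwarz_space P i"
proof -
  assume i: "i \<in> {1..N}"
  have "local_fun i c x = 0" if "x \<notin> subdomain P i" for x
    unfolding local_fun_def
  proof (rule sum.neutral, rule ballI)
    fix j assume "j \<in> {..<nloc i}"
    then have "(basis i ! j) x = 0"
      using basis_mem[of i j] i that by (simp add: schwarz_space_def P1_zero_on_def)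
    then show "vec_index c j * (basis i ! j) x = 0" by simp
  qed
  then show ?thesis using local_fun_V[of i c] i by (simp add: schwarz_space_def P1_zero_on_def)
qed

lemma local_fun_surj:
  assumes i: "i \<le> N" and v: "v \<in> schwarz_space P i"
  obtains c where "c \<in> carrier_vec (nloc i)" "local_fun i c = v"
proof -
  obtain d where d: "length d = nloc i" "v = (\<lambda>x. \<Sum>j<nloc i. d ! j * (basis i ! j) x)"
    using basis_list[OF i] v unfolding is_basis_list_def by blast
  have "local_fun i (vec_of_list d) = v"
    unfolding d(2) local_fun_def by (simp add: vec_of_list_index)
  moreover have "vec_of_list d \<in> carrier_vec (nloc i)" using d(1) by (simp add: carrier_dim_vec)
  ultimately show thesis by (rule that[rotated])
qed

lemma RT_carrier: "RT P i \<in> carrier_mat n (nloc i)"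
  by (simp add: RT_def inclusion_mat_def)

lemma RT_mult:
  assumes c: "c \<in> carrier_vec (nloc i)" and r: "r < n"
  shows "vec_index (RT P i *\<^sub>v c) r = local_fun i c (node_list P ! r)"
  using c r
  by (auto simp: RT_def inclusion_mat_def local_fun_def scalar_prod_def lessThan_atLeast0 mult.commute
      intro!: sum.cong)

text \<open>The columns of \<open>RT P i\<close> hold nodal values, and a function in V is
  determined by its nodal values; so multiplication by this matrix is the inclusion of the local
  space.\<close>

lemma comb_RT:
  assumes i: "i \<le> N" and c: "c \<in> carrier_vec (nloc i)"
  shows "comb (vec_index (RT P i *\<^sub>v c)) = local_fun i c"
  by (rule P1_zero_eqI[OF comb_P1_zero local_fun_V[OF i]]) (simp add: comb_nth RT_mult[OF c])

lemma RT_inj: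
  assumes i: "i \<le> N" and c: "c \<in> carrier_vec (nloc i)" and zero: "RT P i *\<^sub>v c = 0\<^sub>v n"
  shows "c = 0\<^sub>v (nloc i)"
proof (rule eq_vecI)
  have "comb (vec_index (0\<^sub>v n)) x = 0" for x by (simp add: comb_def)
  then have "(\<Sum>j<nloc i. vec_index c j * (basis i ! j) x) = 0" for x
    using comb_RT[OF i c] by (simp add: zero local_fun_def fun_eq_iff)
  then show "vec_index c j = vec_index (0\<^sub>v (nloc i)) j" if "j < dim_vec (0\<^sub>v (nloc i) :: real vec)" for j
    using is_basis_list_independent[OF basis_list[OF i], of "vec_index c" j] that by simp
qed (use c in simp)

lemma A_tilde_eq: "A_tilde P = form_mat energy hats"
  by (rule eq_matI) (simp_all add: A_tilde_def stiffness_def mass_def form_mat_def energy_def region)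

lemma A_tilde_carrier: "A_tilde P \<in> carrier_mat n n"
  by (simp add: A_tilde_eq form_mat_def)

lemma A_tilde_form: "mat_form n (A_tilde P) c d = energy (comb c) (comb d)"
  unfolding A_tilde_eq
  by (rule form_comb[OF form_on.lin[OF energy_form_on] form_on.sym[OF energy_form_on]])

lemma A_tilde_local_eq: "A_tilde_local P i = transpose_mat (RT P i) * A_tilde P * RT P i"
proof -
  have K: "stiffness P \<in> carrier_mat n n" and Mm: "mass P \<in> carrier_mat n n"
    by (simp_all add: stiffness_def mass_def form_mat_def)
  note R = RT_carrier[of i]
  have RT: "transpose_mat (RT P i) \<in> carrier_mat (nloc i) n" using R by simp
  let ?t = "time_step P"
  have "transpose_mat (RT P i) * A_tilde P * RT P i
      = (transpose_mat (RT P i) * (?t \<cdot>\<^sub>m stiffness P) + transpose_mat (RT P i) * mass P) * RT P i"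
    unfolding A_tilde_def using mult_add_distrib_mat[OF RT, of "?t \<cdot>\<^sub>m stiffness P" n "mass P"] K Mm by simp
  also have "\<dots> = transpose_mat (RT P i) * (?t \<cdot>\<^sub>m stiffness P) * RT P i + transpose_mat (RT P i) * mass P * RT P i"
    by (rule add_mult_distrib_mat[OF mult_carrier_mat[OF RT] mult_carrier_mat[OF RT Mm] R])
      (use K in simp)
  also have "transpose_mat (RT P i) * (?t \<cdot>\<^sub>m stiffness P) = ?t \<cdot>\<^sub>m (transpose_mat (RT P i) * stiffness P)"
    by (rule mult_smult_distrib[OF RT K])
  also have "\<dots> * RT P i = ?t \<cdot>\<^sub>m (transpose_mat (RT P i) * stiffness P * RT P i)"
    by (rule mult_smult_assoc_mat[OF mult_carrier_mat[OF RT K] R])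
  finally show ?thesis by (simp add: A_tilde_local_def)
qed

lemma eigenvalue_bounds:
  assumes ev: "eigenvalue (schwarz_preconditioner P * A_tilde P) \<mu>"
  shows "1 \<le> Cstab * \<mu>" (is "1 \<le> ?C * \<mu>")
    "\<mu> \<le> (real No + 1) + 1"
proof -
  have sym: "A_tilde P $$ (r, c) = A_tilde P $$ (c, r)" if "r < n" "c < n" for r c
    using that form_on.sym[OF energy_form_on hat_ps[OF that(1)] hat_ps[OF that(2)]]
    by (simp add: A_tilde_eq form_mat_def)
  have pos: "0 < vec_form n (A_tilde P) x x"
    if x: "x \<in> carrier_vec n" "x \<noteq> 0\<^sub>v n" for x
  proof -
    have "energy (comb (vec_index x)) (comb (vec_index x)) \<noteq> 0"
    proof
      assume "energy (comb (vec_index x)) (comb (vec_index x)) = 0"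
      then have zero: "comb (vec_index x) y = 0" for y by (rule energy_definite[OF comb_P1_zero])
      have "x = 0\<^sub>v n" by (rule comb_eq_0[OF x(1) ext]) (rule zero)
      then show False using x(2) by simp
    qed
    then show ?thesis using energy_nonneg[of "comb (vec_index x)"] by (simp add: A_tilde_form)
  qed
  have B: "schwarz_preconditioner P = mat n n (\<lambda>rc. \<Sum>i=0..N.
      (RT P i * inv_mat (transpose_mat (RT P i) * A_tilde P * RT P i) * transpose_mat (RT P i)) $$ rc)"
    by (simp add: schwarz_preconditioner_def A_tilde_local_eq)
  let ?R = "\<lambda>c i. RT P i *\<^sub>v c i"
  have overlap: "mat_form n (A_tilde P) (\<lambda>r. \<Sum>i=1..N. vec_index (?R c i) r) (\<lambda>r. \<Sum>i=1..N. vec_index (?R c i) r)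
      \<le> (real No + 1) * (\<Sum>i=1..N. vec_form n (A_tilde P) (?R c i) (?R c i))"
    if c: "\<And>i. i \<le> N \<Longrightarrow> c i \<in> carrier_vec (nloc i)" for c
  proof -
    let ?v = "\<lambda>i. local_fun i (c i)"
    have v: "comb (vec_index (?R c i)) = ?v i" if "i \<in> {1..N}" for i
      using comb_RT c that by simp
    have "comb (\<lambda>r. \<Sum>i=1..N. vec_index (?R c i) r) = (\<lambda>x. \<Sum>i=1..N. comb (vec_index (?R c i)) x)"
      unfolding comb_def by (rule ext) (simp add: sum_distrib_right sum.swap[of _ "{..<n}"])
    also have "\<dots> = (\<lambda>x. \<Sum>i=1..N. ?v i x)" by (rule ext, rule sum.cong) (use v in auto)
    finally have eq: "comb (\<lambda>r. \<Sum>i=1..N. vec_index (?R c i) r) = (\<lambda>x. \<Sum>i=1..N. ?v i x)" .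
    have "energy (\<lambda>x. \<Sum>i=1..N. ?v i x) (\<lambda>x. \<Sum>i=1..N. ?v i x) \<le> real No * (\<Sum>i=1..N. energy (?v i) (?v i))"
      by (rule local_spaces_overlap[OF local_fun_schwarz_space])
    \<comment> \<open>One more than No, since \<open>schwarz_eigenvalue_bounds\<close> demands a
      positive overlap constant.\<close>
    also have "\<dots> \<le> (real No + 1) * (\<Sum>i=1..N. energy (?v i) (?v i))"
      by (intro mult_right_mono sum_nonneg energy_nonneg) simp
    also have "(\<Sum>i=1..N. energy (?v i) (?v i))
        = (\<Sum>i=1..N. vec_form n (A_tilde P) (?R c i) (?R c i))"
      by (rule sum.cong) (use v in \<open>auto simp: A_tilde_form\<close>)
    finally show ?thesis unfolding A_tilde_form eq .
  qed
  have decomposition: "\<exists>c. (\<forall>i\<le>N. c i \<in> carrier_vec (nloc i)) \<and>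
      (\<forall>r<n. vec_index x r = (\<Sum>i=0..N. vec_index (?R c i) r)) \<and>
      (\<Sum>i=0..N. vec_form n (A_tilde P) (?R c i) (?R c i))
        \<le> ?C * vec_form n (A_tilde P) x x" if x: "x \<in> carrier_vec n" for x
  proof -
    obtain u where u: "\<And>i. i \<le> N \<Longrightarrow> u i \<in> schwarz_space P i"
      "\<And>y. comb (vec_index x) y = (\<Sum>i=0..N. u i y)"
      "(\<Sum>i=0..N. energy (u i) (u i)) \<le> ?C * energy (comb (vec_index x)) (comb (vec_index x))"
      using stable_decomposition[OF comb_P1_zero[of "vec_index x"]] by blast
    have "\<forall>i\<in>{..N}. \<exists>c. c \<in> carrier_vec (nloc i) \<and> local_fun i c = u i"
    proof
      fix i assume "i \<in> {..N}"
      then have i: "i \<le> N" by simp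
      obtain c where "c \<in> carrier_vec (nloc i)" "local_fun i c = u i"
        by (rule local_fun_surj[OF i u(1)[OF i]])
      then show "\<exists>c. c \<in> carrier_vec (nloc i) \<and> local_fun i c = u i" by blast
    qed
    from bchoice[OF this] obtain c where c: "\<And>i. i \<le> N \<Longrightarrow> c i \<in> carrier_vec (nloc i)"
      "\<And>i. i \<le> N \<Longrightarrow> local_fun i (c i) = u i" by auto
    have "vec_index x r = (\<Sum>i=0..N. vec_index (?R c i) r)" if r: "r < n" for r
    proof -
      have "vec_index x r = (\<Sum>i=0..N. u i (node_list P ! r))"
        using comb_nth[OF r, of "vec_index x"] u(2) by simp
      also have "\<dots> = (\<Sum>i=0..N. vec_index (?R c i) r)"
        by (rule sum.cong) (use c RT_mult r in auto)
      finally show ?thesis .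
    qed
    moreover have "(\<Sum>i=0..N. vec_form n (A_tilde P) (?R c i) (?R c i))
        = (\<Sum>i=0..N. energy (u i) (u i))"
      by (rule sum.cong) (use c comb_RT in \<open>auto simp: A_tilde_form\<close>)
    ultimately show ?thesis using c(1) u(3) by (intro exI[of _ c]) (simp add: A_tilde_form)
  qed
  note bounds = schwarz_eigenvalue_bounds[OF A_tilde_carrier sym pos RT_carrier RT_inj B _ overlap
      stability_const_pos[OF k0 ct] decomposition ev]
  show "1 \<le> ?C * \<mu>" by (rule bounds(1)) auto
  show "\<mu> \<le> (real No + 1) + 1" by (rule bounds(2)) auto
qed

end

theorem theorem5:
  fixes \<Omega> :: "'a::euclidean_space set"
    and \<kappa>\<^sub>m\<^sub>i\<^sub>n c\<^sub>t C\<^sub>t \<eta>\<^sub>b \<kappa>\<^sub>b C\<^sub>P C\<^sub>\<pi> C\<^sub>I C\<^sub>\<chi> :: real and N\<^sub>o :: nat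
  assumes "DIM('a) = 2 \<or> DIM('a) = 3"
    and "open \<Omega>" "connected \<Omega>" "bounded \<Omega>" "\<Omega> \<noteq> {}"
    and "0 < c\<^sub>t" "c\<^sub>t \<le> C\<^sub>t"
  shows "\<exists>B. \<forall>P :: 'a discretisation.
     meshes P \<Omega> \<and> coefficient_bounds P \<and> perm_min P = \<kappa>\<^sub>m\<^sub>i\<^sub>n \<and>
     high_components P C\<^sub>P \<and> eta0 P \<le> \<eta>\<^sub>b \<and> kappa0 P \<le> \<kappa>\<^sub>b \<and>
     projection_estimate P C\<^sub>\<pi> \<and> overlapping_cover P N\<^sub>o \<and> partition_of_unity P C\<^sub>\<chi> \<and>
     interpolation_stable P C\<^sub>I \<and> matrix_bases P \<and>
     0 < time_step P \<and>
     c\<^sub>t * (coarse_size P)\<^sup>2 \<le> time_step P \<and> time_step P \<le> C\<^sub>t * (coarse_size P)\<^sup>2 \<longrightarrow>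
     (\<forall>\<mu>\<in>spectrum (schwarz_preconditioner P * A_tilde P). 0 < \<mu>) \<and>
     cond_number (schwarz_preconditioner P * A_tilde P) \<le> B"
proof -
  let ?C = "stability_const \<kappa>\<^sub>m\<^sub>i\<^sub>n c\<^sub>t C\<^sub>t \<kappa>\<^sub>b C\<^sub>\<pi> C\<^sub>I C\<^sub>\<chi> N\<^sub>o"
  \<comment> \<open>The second term of the maximum covers a mesh without interior nodes, where the spectrum is empty.\<close>
  let ?B = "max ((real N\<^sub>o + 2) * ?C) (Max {} / Min {})"
  show ?thesis
  proof (intro exI[of _ ?B] allI impI, elim conjE)
    fix P :: "'a discretisation"
    assume P: "meshes P \<Omega>" "coefficient_bounds P" "perm_min P = \<kappa>\<^sub>m\<^sub>i\<^sub>n" "high_components P C\<^sub>P"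
      "kappa0 P \<le> \<kappa>\<^sub>b" "projection_estimate P C\<^sub>\<pi>" "overlapping_cover P N\<^sub>o" "partition_of_unity P C\<^sub>\<chi>"
      "interpolation_stable P C\<^sub>I" "matrix_bases P" "0 < time_step P"
      "c\<^sub>t * (coarse_size P)\<^sup>2 \<le> time_step P" "time_step P \<le> C\<^sub>t * (coarse_size P)\<^sup>2"
    interpret two_level P \<Omega> C\<^sub>P C\<^sub>\<pi> C\<^sub>I C\<^sub>\<chi> \<kappa>\<^sub>b c\<^sub>t C\<^sub>t N\<^sub>o
      by (rule two_level.intro) (rule P assms)+
    let ?X = "schwarz_preconditioner P * A_tilde P"
    have C: "0 < ?C" using stability_const_pos[OF k0 \<open>0 < c\<^sub>t\<close>] P(3) by simp
    have X: "?X \<in> carrier_mat (length (node_list P)) (length (node_list P))"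
      using A_tilde_carrier by (auto simp: schwarz_preconditioner_def)
    \<comment> \<open>The upper bound is M + 1 with the overlap constant M =
      \<open>N\<^sub>o + 1\<close> of \<open>eigenvalue_bounds\<close>.\<close>
    have bounds: "1 / ?C \<le> \<mu>" "\<mu> \<le> real N\<^sub>o + 2" if "\<mu> \<in> spectrum ?X" for \<mu>
      using eigenvalue_bounds[of \<mu>] that C P(3) by (auto simp: spectrum_def field_simps)
    have pos: "0 < \<mu>" if "\<mu> \<in> spectrum ?X" for \<mu>
    proof -
      have "0 < 1 / ?C" using C by simp
      then show ?thesis using bounds(1)[OF that] by (rule less_le_trans)
    qed
    moreover have "cond_number ?X \<le> ?B"
    proof (cases "spectrum ?X = {}")
      case True
      then show ?thesis by (simp add: cond_number_def)
    next
      case False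
      note fin = card_finite_spectrum(1)[OF X]
      have "cond_number ?X \<le> (real N\<^sub>o + 2) / (1 / ?C)"
        unfolding cond_number_def
      proof (rule frac_le)
        show "Max (spectrum ?X) \<le> real N\<^sub>o + 2" using Max_in[OF fin False] by (rule bounds(2))
        show "1 / ?C \<le> Min (spectrum ?X)" using Min_in[OF fin False] by (rule bounds(1))
      qed (use C in auto)
      then show ?thesis by simp
    qed
    ultimately show "(\<forall>\<mu>\<in>spectrum ?X. 0 < \<mu>) \<and> cond_number ?X \<le> ?B" by blast
  qed
qed

end
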